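(* Work in the discrete setting described in the context. For $0\le m\le M-1$ consider the following scheme: given $\vec X^m\in V_\partial^h$ and $\vec U^m$, find $\vec U^{m+1}\in\mathbb U^m$, $P^{m+1}\in\mathbb P^m$, $\vec X^{m+1}\in V_\partial^h$ and $\kappa^{m+1}\in V^h$ such that for all $(\vec\chi,q,\zeta,\vec\eta)\in\mathbb U^m\times\mathbb P^m\times V^h\times V_\partial^h$: (i) $\tfrac12\Big[\big(\tfrac{\rho^m\vec U^{m+1}-I_0^m\rho^{m-1}I_2^m\vec U^m}{\Delta t},\vec\chi\,r\big)+\big(I_0^m\rho^{m-1}\tfrac{\vec U^{m+1}-I_2^m\vec U^m}{\Delta t},\vec\chi\,r\big)\Big]+\mathscr A(\rho^m,I_2^m\vec U^m;\vec U^{m+1},\vec\chi)+2\big(\mu^m\,\mathbb D_c(\vec U^{m+1}),\mathbb D_c(\vec\chi)\,r\big)+2\big(\mu^m r^{-1}[\vec U^{m+1}\cdot\vec e_1],[\vec\chi\cdot\vec e_1]\big)^\diamond-\big(P^{m+1},\nabla_c\cdot[r\vec\chi]\big)-\gamma\big\langle(\vec X^m\cdot\vec e_1)\,\kappa^{m+1}-\vec\nu^m\cdot\vec e_1,\vec\nu^m\cdot\vec\chi\,|\vec X^m_\alpha|\big\rangle=\big(\rho^m\vec g,\vec\chi\,r\big)$; (ii) $\big(\nabla_c\cdot[r\vec U^{m+1}],q\big)=0$; (iii) $\tfrac1{\Delta t}\big\langle\vec X^{m+1}-\vec X^m,\zeta\,\vec f^{m+\frac12}\big\rangle-\big\langle(\vec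 X^m\cdot\vec e_1)\,\vec U^{m+1},\zeta\,\vec\nu^m|\vec X^m_\alpha|\big\rangle=0$; (iv) $\big\langle\kappa^{m+1}\vec\nu^m,\vec\eta\,|\vec X^m_\alpha|\big\rangle^h+\big\langle\vec X^{m+1}_\alpha,\vec\eta_\alpha|\vec X^m_\alpha|^{-1}\big\rangle=0$, where, with $\vec X^{m+\frac12}=\frac12(\vec X^m+\vec X^{m+1})$, $$\vec f^{m+\frac12}=-\tfrac16\big[(\vec X^m\cdot\vec e_1)\vec X^m_\alpha+4(\vec X^{m+\frac12}\cdot\vec e_1)\vec X^{m+\frac12}_\alpha+(\vec X^{m+1}\cdot\vec e_1)\vec X^{m+1}_\alpha\big]^\perp.$$ Let $(\vec U^{m+1},P^{m+1},\vec X^{m+1},\kappa^{m+1})$ be a solution of (i)-(iv), and assume that $1_{\mathcal R^m_-}-\omega^m\in\mathbb P^m$ for $m=0,\dots,M-1$, where $\omega^m=\int_{\mathcal R^m_-}r\,dr\,dz\big/\int_{\mathcal R}r\,dr\,dz$. Then $$M(\vec X^{m+1})=M(\vec X^m),\qquad m=0,\dots,M-1.$$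
   Context: Domain. Points of the half-plane $\{r\ge0\}\subset\mathbb R^2$ are written $(r,z)$, with $\vec e_1=(1,0)^T$, $\vec e_2=(0,1)^T$. $\mathcal R\subset\{r>0\}$ is a bounded polygonal domain with boundary $\partial\mathcal R=\partial_1\mathcal R\cup\partial_2\mathcal R\cup\partial_z\mathcal R$, where $\partial_z\mathcal R$ is the part on the $z$-axis $\{r=0\}$; $\vec n$ is its outer unit normal. $\mathbb I=(0,1)$, $\partial\mathbb I=\{0,1\}$. $(\cdot,\cdot)$ and $\langle\cdot,\cdot\rangle$ are the $L^2$-inner products over $\mathcal R$ and $\mathbb I$ (for scalars, vectors, or matrices with the Frobenius product). $\nabla_c=\vec e_1\partial_r+\vec e_2\partial_z$, $\mathbb D_c(\vec u)=\frac12[\nabla_c\vec u+(\nabla_c\vec u)^T]$, and $\mathscr A(\rho,\vec v;\vec u,\vec\chi)=\frac12\big(\rho\,r,[\vec v\cdot\nabla_c]\vec u\cdot\vec\chi-[\vec v\cdot\nabla_c]\vec\chi\cdot\vec u\big)$. Constants $\rho_\pm,\mu_\pm,\gamma>0$ and a body acceleration $\vec g$ with values in $\mathbb R^2$ (e.g. constant) are given. $1_A$ is the characteristic function of a set $A$. Spaces. $L^2_a(\mathcal R)=\{\chi:\int_{\mathcal R}r^a\chi^2\,dr\,dz<\infty\}$; $H^1_a(\mathcal R)=\{\chi\in L^2_a:\partial_r\chi,\partial_z\chi\in L^2_a\}$. $\mathbb U=\{\vec\chi\in[H^1_1(\mathcal R)]^2:\vec\chi\cdot\vec e_1\in L^2_{-1}(\mathcal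 R),\ \vec\chi=\vec0\text{ on }\partial_1\mathcal R,\ \vec\chi\cdot\vec n=0\text{ on }\partial_2\mathcal R\}$; $\mathbb P=\{\chi\in L^2_1(\mathcal R):\int_{\mathcal R}r\chi\,dr\,dz=0\}$; $V_\partial=\{\vec\eta\in[H^1(\mathbb I)]^2:\vec\eta\cdot\vec e_1=0\text{ on }\partial\mathbb I\}$. Discretization. $\Delta t=T/M$, $t_m=m\Delta t$. With $h=1/J_\Gamma$, $\alpha_j=jh$, $\mathbb I_j=[\alpha_{j-1},\alpha_j]$, $V^h$ is the space of continuous functions on $\overline{\mathbb I}$ that are affine on each $\mathbb I_j$, $1\le j\le J_\Gamma$, and $V^h_\partial=[V^h]^2\cap V_\partial$. The mass-lumped product of piecewise continuous functions with possible jumps at the nodes is $\langle\vec v,\vec w\rangle^h=\frac h2\sum_{j=1}^{J_\Gamma}[(\vec v\cdot\vec w)(\alpha_j^-)+(\vec v\cdot\vec w)(\alpha_{j-1}^+)]$, with one-sided limits $g(\alpha_j^\pm)=\lim_{\delta\searrow0}g(\alpha_j\pm\delta)$. Curves: $\vec X^m\in V^h_\partial$, $\Gamma^m=\vec X^m(\overline{\mathbb I})$, with standing assumption $\vec X^m\cdot\vec e_1>0$ in $\mathbb I$ and $|\vec X^m_\alpha|>0$ in $\mathbb I$ for $0\le m\le M$ (subscript $\alpha$ is differentiation in $\alpha$). $\vec\tau^m=\vec X^m_\alpha/|\vec X^m_\alpha|$, $\vec\nu^m=-(\vec\tau^m)^\perp$, where $\perp$ is clockwise rotation by $\pi/2$.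 $\Gamma^m$ divides $\mathcal R$ into $\mathcal R^m_-$ (enclosed by $\Gamma^m$ and $\partial_z\mathcal R$) and $\mathcal R^m_+$, and $\vec\nu^m$ points into $\mathcal R^m_+$. In integrals over $\mathbb I$, bulk functions such as $\vec U^{m+1}$, $\vec\chi$ are evaluated at $\vec X^m(\alpha)$. For each $m$, $\mathscr T^m$ is a regular partition of $\overline{\mathcal R}$ into finitely many disjoint non-degenerate open triangles (not necessarily fitted to $\Gamma^m$). $S^m_k$ ($k\ge1$): continuous functions on $\overline{\mathcal R}$ that are polynomials of degree $\le k$ on each triangle; $S^m_0$: piecewise constants. $\mathbb U^m=[S^m_2]^2\cap\mathbb U$. $\mathbb P^m$ is either $S_1^m\cap\mathbb P$, or this space enriched by the single function $1_{\mathcal R^m_-}-\omega^m$ with $\omega^m=\int_{\mathcal R^m_-}r\,dr\,dz/\int_{\mathcal R}r\,dr\,dz$; in either case $\mathbb P^m\subset\mathbb P$. $I_2^m:[C(\overline{\mathcal R})]^2\to[S_2^m]^2$ is standard Lagrange interpolation; $I_0^m:L^1(\mathcal R)\to S^m_0$ is $(I_0^m\eta)|_o=|o|^{-1}\int_o\eta\,dr\,dz$. $\rho^m,\mu^m\in S_0^m$ equal $\rho_\pm,\mu_\pm$ on triangles contained in $\mathcal R^m_\pm$, and $\frac12(\rho_-+\rho_+)$, $\frac12(\mu_-+\mu_+)$ on triangles meeting $\Gamma^m$. Set $\rho^{-1}=\rho^0$. Initial data: $\vec U^0\in\mathbb U^0$, $\vec X^0\in V^h_\partial$; for $m\ge1$,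 $\vec U^m\in\mathbb U^{m-1}$ is the velocity computed at the previous step. $(\cdot,\cdot)^\diamond$ is an approximation of $(\cdot,\cdot)$ by an elementwise quadrature rule with only interior sampling points (so that terms with $r^{-1}$ are well defined). Enclosed volume: $M(\vec X)=\pi\langle(\vec X\cdot\vec e_1)^2\,\vec\nu,\vec e_1|\vec X_\alpha|\rangle$ with $\vec\nu|\vec X_\alpha|=-(\vec X_\alpha)^\perp$ (not to be confused with the number $M$ of time steps). *)

theory Defs
  imports "HOL-Analysis.Analysis"
begin

text \<open>Points \<open>(r, z)\<close> of the meridian half-plane, and vectors in the plane.\<close>
type_synonym point = "real \<times> real"

abbreviation e1 :: point where "e1 \<equiv> (1, 0)"

text \<open>Clockwise rotation by \<open>pi / 2\<close>.\<close>
definition perp :: "point \<Rightarrow> point" where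
  "perp v = (snd v, - fst v)"

definition segment_union :: "point set \<Rightarrow> bool" where
  "segment_union D \<longleftrightarrow>
     (\<exists>F. finite F \<and> (\<forall>s\<in>F. \<exists>a b. a \<noteq> b \<and> s = closed_segment a b) \<and> D = \<Union>F)"

text \<open>The condition \<open>interior (closure R) = R\<close> excludes slits and punctures, so that the outer
  normal exists at all but finitely many boundary points. Holes are allowed.\<close>
definition polygonal_domain :: "point set \<Rightarrow> bool" where
  "polygonal_domain R \<longleftrightarrow> R \<noteq> {} \<and> open R \<and> connected R \<and> bounded R \<and>
     interior (closure R) = R \<and> segment_union (frontier R)"

definition axis_boundary :: "point set \<Rightarrow> point set" where
  "axis_boundary R = frontier R \<inter> {x. fst x = 0}"

text \<open>\<open>n\<close> is the outer unit normal at the boundary point \<open>x\<close>; there is none at a corner.\<close>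
definition outer_normal :: "point set \<Rightarrow> point \<Rightarrow> point \<Rightarrow> bool" where
  "outer_normal R x n \<longleftrightarrow> norm n = 1 \<and>
     (\<exists>\<epsilon>>0. \<forall>y\<in>ball x \<epsilon>. y \<in> R \<longleftrightarrow> (y - x) \<bullet> n < 0)"

text \<open>All functions are total; only their values on the closure of the domain matter.
  A function is smooth iff it has a family \<open>D\<close> of iterated partial derivatives, indexed by lists
  of basis directions.\<close>
definition smooth_fun :: "('a::euclidean_space \<Rightarrow> real) \<Rightarrow> bool" where
  "smooth_fun \<phi> \<longleftrightarrow> (\<exists>D. D [] = \<phi> \<and>
     (\<forall>bs x. (D bs has_derivative (\<lambda>h. \<Sum>b\<in>Basis. (h \<bullet> b) * D (b # bs) x)) (at x)))"

definition test_functions :: "'a::euclidean_space set \<Rightarrow> ('a \<Rightarrow> real) set" where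
  "test_functions \<Omega> = {\<phi>. smooth_fun \<phi> \<and> (\<exists>K. compact K \<and> K \<subseteq> \<Omega> \<and> (\<forall>x. x \<notin> K \<longrightarrow> \<phi> x = 0))}"

definition weak_deriv ::
  "'a::euclidean_space set \<Rightarrow> 'a \<Rightarrow> ('a \<Rightarrow> real) \<Rightarrow> ('a \<Rightarrow> real) \<Rightarrow> bool" where
  "weak_deriv \<Omega> b f g \<longleftrightarrow> (\<forall>\<phi>\<in>test_functions \<Omega>.
     (LINT x:\<Omega>|lebesgue. f x * frechet_derivative \<phi> (at x) b) = - (LINT x:\<Omega>|lebesgue. g x * \<phi> x))"

definition L2_weighted :: "'a::euclidean_space set \<Rightarrow> ('a \<Rightarrow> real) \<Rightarrow> ('a \<Rightarrow> real) set" where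
  "L2_weighted \<Omega> w = {f. set_borel_measurable lebesgue \<Omega> f \<and>
     set_integrable lebesgue \<Omega> (\<lambda>x. w x * (f x)\<^sup>2)}"

definition H1_weighted :: "'a::euclidean_space set \<Rightarrow> ('a \<Rightarrow> real) \<Rightarrow> ('a \<Rightarrow> real) set" where
  "H1_weighted \<Omega> w = {f \<in> L2_weighted \<Omega> w. \<forall>b\<in>Basis. \<exists>g\<in>L2_weighted \<Omega> w. weak_deriv \<Omega> b f g}"

definition L2r :: "int \<Rightarrow> point set \<Rightarrow> (point \<Rightarrow> real) set" where
  "L2r a R = L2_weighted R (\<lambda>x. fst x powi a)"

definition H1r :: "int \<Rightarrow> point set \<Rightarrow> (point \<Rightarrow> real) set" where
  "H1r a R = H1_weighted R (\<lambda>x. fst x powi a)"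

text \<open>The velocity space, restricted to functions that are continuous up to the boundary. It is
  only ever intersected with a finite element space of continuous functions, and for continuous
  functions the boundary trace is the pointwise restriction.\<close>
definition velocity_space :: "point set \<Rightarrow> point set \<Rightarrow> point set \<Rightarrow> (point \<Rightarrow> point) set" where
  "velocity_space R d1 d2 = {\<xi>. continuous_on (closure R) \<xi> \<and>
     (fst \<circ> \<xi>) \<in> H1r 1 R \<and> (snd \<circ> \<xi>) \<in> H1r 1 R \<and> (fst \<circ> \<xi>) \<in> L2r (-1) R \<and>
     (\<forall>x\<in>d1. \<xi> x = 0) \<and> (\<forall>x\<in>d2. \<forall>n. outer_normal R x n \<longrightarrow> \<xi> x \<bullet> n = 0)}"

definition pressure_space :: "point set \<Rightarrow> (point \<Rightarrow> real) set" where
  "pressure_space R = {q \<in> L2r 1 R. (LINT x:R|lebesgue. fst x * q x) = 0}"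

text \<open>An element of \<open>H\<^sup>1(0,1)\<close> is represented by its continuous version, which has values at 0 and 1.\<close>
definition V_bd :: "(real \<Rightarrow> point) set" where
  "V_bd = {\<eta>. continuous_on {0..1} \<eta> \<and>
     (fst \<circ> \<eta>) \<in> H1_weighted {0<..<1} (\<lambda>_. 1) \<and> (snd \<circ> \<eta>) \<in> H1_weighted {0<..<1} (\<lambda>_. 1) \<and>
     \<eta> 0 \<bullet> e1 = 0 \<and> \<eta> 1 \<bullet> e1 = 0}"

text \<open>On matrices of type \<open>real^2^2\<close> the library inner product is the Frobenius product.\<close>
definition ip :: "point set \<Rightarrow> (point \<Rightarrow> 'b::euclidean_space) \<Rightarrow> (point \<Rightarrow> 'b) \<Rightarrow> real" where
  "ip R f g = (LINT x:R|lebesgue. f x \<bullet> g x)"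

definition ipI :: "(real \<Rightarrow> 'b::euclidean_space) \<Rightarrow> (real \<Rightarrow> 'b) \<Rightarrow> real" where
  "ipI f g = (LINT t:{0<..<1}|lebesgue. f t \<bullet> g t)"

text \<open>Classical partial derivatives. They are applied only to continuous, elementwise polynomial
  functions, for which they exist on the open elements and agree a.e. with the weak ones.\<close>
definition d_r :: "(point \<Rightarrow> 'b::real_normed_vector) \<Rightarrow> point \<Rightarrow> 'b" where
  "d_r f x = vector_derivative (\<lambda>s. f (s, snd x)) (at (fst x))"

definition d_z :: "(point \<Rightarrow> 'b::real_normed_vector) \<Rightarrow> point \<Rightarrow> 'b" where
  "d_z f x = vector_derivative (\<lambda>s. f (fst x, s)) (at (snd x))"

definition div_c :: "(point \<Rightarrow> point) \<Rightarrow> point \<Rightarrow> real" where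
  "div_c u x = fst (d_r u x) + snd (d_z u x)"

definition grad_c :: "(point \<Rightarrow> point) \<Rightarrow> point \<Rightarrow> real^2^2" where
  "grad_c u x = vector [vector [fst (d_r u x), fst (d_z u x)], vector [snd (d_r u x), snd (d_z u x)]]"

definition sym_grad_c :: "(point \<Rightarrow> point) \<Rightarrow> point \<Rightarrow> real^2^2" where
  "sym_grad_c u x = (1/2) *\<^sub>R (grad_c u x + transpose (grad_c u x))"

definition convect :: "(point \<Rightarrow> point) \<Rightarrow> (point \<Rightarrow> point) \<Rightarrow> point \<Rightarrow> point" where
  "convect v u x = fst (v x) *\<^sub>R d_r u x + snd (v x) *\<^sub>R d_z u x"

definition A_form ::
  "point set \<Rightarrow> (point \<Rightarrow> real) \<Rightarrow> (point \<Rightarrow> point) \<Rightarrow> (point \<Rightarrow> point) \<Rightarrow> (point \<Rightarrow> point) \<Rightarrow> real" where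
  "A_form R \<rho> v u \<xi> =
     1/2 * ip R (\<lambda>x. \<rho> x * fst x) (\<lambda>x. convect v u x \<bullet> \<xi> x - convect v \<xi> x \<bullet> u x)"

definition grid_nodes :: "nat \<Rightarrow> real set" where
  "grid_nodes J = (\<lambda>j. real j / real J) ` {0..J}"

definition Vh :: "nat \<Rightarrow> (real \<Rightarrow> real) set" where
  "Vh J = {f. continuous_on {0..1} f \<and>
     (\<forall>j\<in>{1..J}. \<exists>a b. \<forall>t\<in>{real (j - 1) / real J .. real j / real J}. f t = a + b * t)}"

definition Vh_bd :: "nat \<Rightarrow> (real \<Rightarrow> point) set" where
  "Vh_bd J = {\<eta>. (fst \<circ> \<eta>) \<in> Vh J \<and> (snd \<circ> \<eta>) \<in> Vh J} \<inter> V_bd"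

text \<open>Mass-lumped product, with one-sided limits at the grid nodes.\<close>
definition ip_lumped :: "nat \<Rightarrow> (real \<Rightarrow> 'b::euclidean_space) \<Rightarrow> (real \<Rightarrow> 'b) \<Rightarrow> real" where
  "ip_lumped J v w = (1 / real J) / 2 *
     (\<Sum>j=1..J. Lim (at_left (real j / real J)) (\<lambda>t. v t \<bullet> w t)
             + Lim (at_right (real (j - 1) / real J)) (\<lambda>t. v t \<bullet> w t))"

abbreviation d_\<alpha> :: "(real \<Rightarrow> point) \<Rightarrow> real \<Rightarrow> point" where
  "d_\<alpha> X t \<equiv> vector_derivative X (at t)"

definition tangent :: "(real \<Rightarrow> point) \<Rightarrow> real \<Rightarrow> point" where
  "tangent X t = d_\<alpha> X t /\<^sub>R norm (d_\<alpha> X t)"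

definition normal :: "(real \<Rightarrow> point) \<Rightarrow> real \<Rightarrow> point" where
  "normal X t = - perp (tangent X t)"

definition enclosed_volume :: "(real \<Rightarrow> point) \<Rightarrow> real" where
  "enclosed_volume X =
     pi * ipI (\<lambda>t. (X t \<bullet> e1)\<^sup>2 *\<^sub>R normal X t) (\<lambda>t. norm (d_\<alpha> X t) *\<^sub>R e1)"

definition f_half :: "(real \<Rightarrow> point) \<Rightarrow> (real \<Rightarrow> point) \<Rightarrow> real \<Rightarrow> point" where
  "f_half X Y t = (let Z = (\<lambda>s. (1/2) *\<^sub>R (X s + Y s)) in
     - (1/6) *\<^sub>R perp ((X t \<bullet> e1) *\<^sub>R d_\<alpha> X t + (4 * (Z t \<bullet> e1)) *\<^sub>R d_\<alpha> Z t + (Y t \<bullet> e1) *\<^sub>R d_\<alpha> Y t))"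

text \<open>The curve \<open>X\<close> divides \<open>R\<close> into the inner phase \<open>Rm\<close>, enclosed by the curve and the axis, and
  the outer phase \<open>Rp\<close>, into which the normal points. At grid nodes the normal is undefined.\<close>
definition divides_domain ::
  "point set \<Rightarrow> nat \<Rightarrow> (real \<Rightarrow> point) \<Rightarrow> point set \<Rightarrow> point set \<Rightarrow> bool" where
  "divides_domain R J X Rm Rp \<longleftrightarrow>
     X ` {0<..<1} \<subseteq> R \<and> Rm \<noteq> Rp \<and> components (R - X ` {0..1}) = {Rm, Rp} \<and>
     frontier Rm \<subseteq> X ` {0..1} \<union> axis_boundary R \<and>
     (\<forall>t\<in>{0<..<1} - grid_nodes J. \<forall>\<^sub>F \<epsilon> in at_right 0. X t + \<epsilon> *\<^sub>R normal X t \<in> Rp)"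

text \<open>A mesh is the set of its closed triangles; the open elements are their interiors.
  Regular means conforming: two triangles meet in a common (possibly empty) face.\<close>
definition regular_partition :: "point set \<Rightarrow> point set set \<Rightarrow> bool" where
  "regular_partition R \<T> \<longleftrightarrow> triangulation \<T> \<and> (\<forall>K\<in>\<T>. 2 simplex K) \<and> \<Union>\<T> = closure R"

definition poly2 :: "nat \<Rightarrow> (nat \<Rightarrow> nat \<Rightarrow> real) \<Rightarrow> point \<Rightarrow> real" where
  "poly2 k c x = (\<Sum>i\<le>k. \<Sum>j\<le>k - i. c i j * fst x ^ i * snd x ^ j)"

text \<open>The spaces of continuous elements of degree at most \<open>k\<close>, for \<open>k \<ge> 1\<close>.\<close>
definition S_FE :: "point set \<Rightarrow> point set set \<Rightarrow> nat \<Rightarrow> (point \<Rightarrow> real) set" where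
  "S_FE R \<T> k = {f. continuous_on (closure R) f \<and> (\<forall>K\<in>\<T>. \<exists>c. \<forall>x\<in>K. f x = poly2 k c x)}"

definition S_FE_vec :: "point set \<Rightarrow> point set set \<Rightarrow> nat \<Rightarrow> (point \<Rightarrow> point) set" where
  "S_FE_vec R \<T> k = {v. (fst \<circ> v) \<in> S_FE R \<T> k \<and> (snd \<circ> v) \<in> S_FE R \<T> k}"

definition U_FE :: "point set \<Rightarrow> point set \<Rightarrow> point set \<Rightarrow> point set set \<Rightarrow> (point \<Rightarrow> point) set" where
  "U_FE R d1 d2 \<T> = S_FE_vec R \<T> 2 \<inter> velocity_space R d1 d2"

definition vol_ratio :: "point set \<Rightarrow> point set \<Rightarrow> real" where
  "vol_ratio R Rm = (LINT x:Rm|lebesgue. fst x) / (LINT x:R|lebesgue. fst x)"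

definition phase_fun :: "point set \<Rightarrow> point set \<Rightarrow> point \<Rightarrow> real" where
  "phase_fun R Rm x = indicator Rm x - vol_ratio R Rm"

definition P_FE :: "point set \<Rightarrow> point set set \<Rightarrow> (point \<Rightarrow> real) set" where
  "P_FE R \<T> = S_FE R \<T> 1 \<inter> pressure_space R"

definition P_FE_enriched :: "point set \<Rightarrow> point set set \<Rightarrow> point set \<Rightarrow> (point \<Rightarrow> real) set" where
  "P_FE_enriched R \<T> Rm = {\<lambda>x. p x + c * phase_fun R Rm x | p c. p \<in> P_FE R \<T>}"

text \<open>Quadratic Lagrange interpolation. The nodes are the vertices (\<open>a = b\<close>) and the edge midpoints.
  The interpolant is unique on \<open>closure R\<close>.\<close>
definition lagrange_nodes :: "point set set \<Rightarrow> point set" where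
  "lagrange_nodes \<T> = {midpoint a b | a b. \<exists>K\<in>\<T>. a extreme_point_of K \<and> b extreme_point_of K}"

definition I2 :: "point set \<Rightarrow> point set set \<Rightarrow> (point \<Rightarrow> point) \<Rightarrow> (point \<Rightarrow> point)" where
  "I2 R \<T> v = (SOME w. w \<in> S_FE_vec R \<T> 2 \<and> (\<forall>p\<in>lagrange_nodes \<T>. w p = v p))"

text \<open>Piecewise constants are set to 0 on the element edges, a null set.\<close>
definition I0 :: "point set set \<Rightarrow> (point \<Rightarrow> real) \<Rightarrow> point \<Rightarrow> real" where
  "I0 \<T> \<eta> x = (\<Sum>K\<in>\<T>. indicator (interior K) x *
     ((LINT y:interior K|lebesgue. \<eta> y) / measure lebesgue (interior K)))"

text \<open>An open element that lies in neither phase is one that meets the curve.\<close>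
definition phase_coeff ::
  "point set set \<Rightarrow> point set \<Rightarrow> point set \<Rightarrow> real \<Rightarrow> real \<Rightarrow> point \<Rightarrow> real" where
  "phase_coeff \<T> Rm Rp cm cp x = (\<Sum>K\<in>\<T>. indicator (interior K) x *
     (if interior K \<subseteq> Rm then cm else if interior K \<subseteq> Rp then cp else (cm + cp) / 2))"

text \<open>A quadrature rule assigns to every element finitely many pairs (sampling point, weight).\<close>
definition interior_quadrature :: "point set set \<Rightarrow> (point set \<Rightarrow> (point \<times> real) set) \<Rightarrow> bool" where
  "interior_quadrature \<T> Q \<longleftrightarrow> (\<forall>K\<in>\<T>. finite (Q K) \<and> fst ` Q K \<subseteq> interior K)"

definition ip_quad :: "point set set \<Rightarrow> (point set \<Rightarrow> (point \<times> real) set) \<Rightarrow>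
    (point \<Rightarrow> real) \<Rightarrow> (point \<Rightarrow> real) \<Rightarrow> real" where
  "ip_quad \<T> Q f g = (\<Sum>K\<in>\<T>. \<Sum>(p, w)\<in>Q K. w * (f p * g p))"

definition momentum_eq where
  "momentum_eq R \<T> Q \<gamma> \<Delta>t g \<rho> \<rho>old \<mu> Xm Um U P \<kappa> \<xi> \<longleftrightarrow>
     1/2 * (ip R (\<lambda>x. (\<rho> x *\<^sub>R U x - I0 \<T> \<rho>old x *\<^sub>R I2 R \<T> Um x) /\<^sub>R \<Delta>t) (\<lambda>x. fst x *\<^sub>R \<xi> x)
          + ip R (\<lambda>x. I0 \<T> \<rho>old x *\<^sub>R ((U x - I2 R \<T> Um x) /\<^sub>R \<Delta>t)) (\<lambda>x. fst x *\<^sub>R \<xi> x))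
     + A_form R \<rho> (I2 R \<T> Um) U \<xi>
     + 2 * ip R (\<lambda>x. \<mu> x *\<^sub>R sym_grad_c U x) (\<lambda>x. fst x *\<^sub>R sym_grad_c \<xi> x)
     + 2 * ip_quad \<T> Q (\<lambda>x. \<mu> x * inverse (fst x) * (U x \<bullet> e1)) (\<lambda>x. \<xi> x \<bullet> e1)
     - ip R P (div_c (\<lambda>x. fst x *\<^sub>R \<xi> x))
     - \<gamma> * ipI (\<lambda>t. (Xm t \<bullet> e1) * \<kappa> t - normal Xm t \<bullet> e1)
               (\<lambda>t. (normal Xm t \<bullet> \<xi> (Xm t)) * norm (d_\<alpha> Xm t))
     = ip R (\<lambda>x. \<rho> x *\<^sub>R g x) (\<lambda>x. fst x *\<^sub>R \<xi> x)"

definition incompressibility_eq where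
  "incompressibility_eq R U q \<longleftrightarrow> ip R (div_c (\<lambda>x. fst x *\<^sub>R U x)) q = 0"

definition kinematic_eq where
  "kinematic_eq \<Delta>t Xm U X \<zeta> \<longleftrightarrow>
     1 / \<Delta>t * ipI (\<lambda>t. X t - Xm t) (\<lambda>t. \<zeta> t *\<^sub>R f_half Xm X t)
     - ipI (\<lambda>t. (Xm t \<bullet> e1) *\<^sub>R U (Xm t)) (\<lambda>t. (\<zeta> t * norm (d_\<alpha> Xm t)) *\<^sub>R normal Xm t) = 0"

definition curvature_eq where
  "curvature_eq J Xm X \<kappa> \<eta> \<longleftrightarrow>
     ip_lumped J (\<lambda>t. \<kappa> t *\<^sub>R normal Xm t) (\<lambda>t. norm (d_\<alpha> Xm t) *\<^sub>R \<eta> t)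
     + ipI (d_\<alpha> X) (\<lambda>t. d_\<alpha> \<eta> t /\<^sub>R norm (d_\<alpha> Xm t)) = 0"

definition scheme_solution where
  "scheme_solution R d1 d2 \<T> Q PP J \<gamma> \<Delta>t g \<rho> \<rho>old \<mu> Xm Um U P X \<kappa> \<longleftrightarrow>
     U \<in> U_FE R d1 d2 \<T> \<and> P \<in> PP \<and> X \<in> Vh_bd J \<and> \<kappa> \<in> Vh J \<and>
     (\<forall>\<xi>\<in>U_FE R d1 d2 \<T>. \<forall>q\<in>PP. \<forall>\<zeta>\<in>Vh J. \<forall>\<eta>\<in>Vh_bd J.
        momentum_eq R \<T> Q \<gamma> \<Delta>t g \<rho> \<rho>old \<mu> Xm Um U P \<kappa> \<xi> \<and>
        incompressibility_eq R U q \<and>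
        kinematic_eq \<Delta>t Xm U X \<zeta> \<and>
        curvature_eq J Xm X \<kappa> \<eta>)"

end

theory Submission
  imports Defs
begin

text \<open>Write \<open>V = r U\<close> for the weighted velocity at the new time level. By exactness of Simpson's rule the
  change of volume is \<open>2 pi\<close> times the pairing of the displacement with \<open>f_half\<close>, which
  the kinematic equation tested with 1 turns into the flux of \<open>V\<close> through the old curve.

  That flux vanishes. \<open>V\<close> is tangential to the boundary of the domain, hence satisfies the
  divergence theorem against smooth functions without boundary terms; in particular \<open>div V\<close> has
  integral 0 over the domain, and the phase function in the pressure space makes its integral zero
  over each of the two phases. Testing with a smoothed signed count of the crossings of the curve by
  a horizontal ray, whose gradient is a smoothed surface measure times the normal, writes the flux
  as the limit of integrals of \<open>div V\<close> against functions that become constant on each phase. This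
  does not require the curve to be simple.\<close>

subsection \<open>Segments and integrals over slices\<close>

text \<open>The obstacle is that the phases are known only as connected components of the complement
  of the curve. Nothing is available about the regularity of their boundaries, so Gauss's theorem is
  not at hand on a phase, and the mesh need not follow the curve. The gradient of the crossing count
  is concentrated on the curve by construction, and on a phase the count becomes constant merely
  because the phase is connected and misses the curve. Which constant it becomes does not matter,
  since \<open>div V\<close> has mean zero there. The smoothing is one-sided because the ends of the
  curve lie on the axis, where a symmetric kernel would leave end terms inside the domain. The
  factor \<open>r\<close> in \<open>V\<close> makes the field tangential on the axis, on which the
  velocity space imposes no pointwise condition. On the volume side, \<open>f_half\<close> is the
  Simpson mean of the weighted normals along the linear interpolation between the two curves; it is
  exact because the weighted normal is quadratic in the interpolation parameter.\<close>

lemma segment_union_Un: "segment_union A \<Longrightarrow> segment_union B \<Longrightarrow> segment_union (A \<union> B)"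
  unfolding segment_union_def by (metis Union_Un_distrib finite_Un Un_iff)

lemma segment_union_UN:
  "finite I \<Longrightarrow> (\<And>i. i \<in> I \<Longrightarrow> segment_union (A i)) \<Longrightarrow> segment_union (\<Union>i\<in>I. A i)"
proof (induction I rule: finite_induct)
  case empty
  show ?case unfolding segment_union_def by (rule exI[of _ "{}"]) auto
next
  case (insert i I)
  then show ?case using segment_union_Un by simp
qed

lemma segment_union_segment: "a \<noteq> b \<Longrightarrow> segment_union (closed_segment a b)"
proof -
  assume "a \<noteq> b"
  then have "\<forall>s\<in>{closed_segment a b}. \<exists>x y. x \<noteq> y \<and> s = closed_segment x y"
    by (intro ballI exI[of _ a] exI[of _ b]) simp
  then show ?thesis
    unfolding segment_union_def by (intro exI[of _ "{closed_segment a b}"]) simp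
qed

lemma segment_union_induct [consumes 1, case_names empty segment]:
  assumes "segment_union D" "P {}"
    and "\<And>a b A. a \<noteq> b \<Longrightarrow> P A \<Longrightarrow> P (closed_segment a b \<union> A)"
  shows "P D"
proof -
  obtain F where F: "finite F" "\<forall>s\<in>F. \<exists>a b. a \<noteq> b \<and> s = closed_segment a b" "D = \<Union>F"
    using assms(1) unfolding segment_union_def by blast
  have "P (\<Union>F)" using F(1,2)
    by (induction F rule: finite_induct) (use assms(2,3) in \<open>auto\<close>)
  then show ?thesis using F(3) by simp
qed

lemma segment_union_compact: "segment_union D \<Longrightarrow> compact D"
  by (induction D rule: segment_union_induct) auto

lemma segment_union_closed: "segment_union D \<Longrightarrow> closed D"
  by (simp add: compact_imp_closed segment_union_compact)

lemma negligible_closed_segment: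
  fixes a b :: point
  shows "negligible (closed_segment a b)"
proof -
  \<comment> \<open>For \<open>a = b\<close> the vector \<open>perp (b - a)\<close> would be 0, and
    any nonzero vector serves as a normal.\<close>
  define n where "n = (if a = b then (1, 0) else perp (b - a))"
  have n0: "n \<noteq> 0"
    unfolding n_def perp_def by (auto simp: prod_eq_iff)
  have "x \<bullet> n = a \<bullet> n" if x: "x \<in> closed_segment a b" for x
  proof (cases "a = b")
    case True then show ?thesis using x by simp
  next
    case False
    obtain u where u: "x = (1 - u) *\<^sub>R a + u *\<^sub>R b" using x by (auto simp: in_segment)
    have "n = (snd b - snd a, - (fst b - fst a))" using False by (simp add: n_def perp_def)
    then show ?thesis unfolding u
      by (simp add: inner_prod_def algebra_simps)
  qed
  then have "closed_segment a b \<subseteq> {x. n \<bullet> x = a \<bullet> n}"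
    by (metis (mono_tags) inner_commute mem_Collect_eq subset_eq)
  moreover have "negligible {x. n \<bullet> x = a \<bullet> n}"
    using n0 by (simp add: negligible_hyperplane)
  ultimately show ?thesis using negligible_subset by blast
qed

lemma segment_union_negligible: "segment_union D \<Longrightarrow> negligible D"
  by (induction D rule: segment_union_induct) (auto simp: negligible_closed_segment)

lemma segment_union_swap: "segment_union D \<Longrightarrow> segment_union (prod.swap ` D)"
proof (induction D rule: segment_union_induct)
  case empty then show ?case unfolding segment_union_def by (intro exI[of _ "{}"]) auto
next
  case (segment a b A)
  have lin: "linear (prod.swap :: point \<Rightarrow> point)"
    by (intro linearI) (auto simp: prod_eq_iff)
  have "prod.swap ` closed_segment a b = closed_segment (prod.swap a) (prod.swap b)"
    using closed_segment_linear_image[OF lin] by auto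
  moreover have "prod.swap a \<noteq> prod.swap b" using segment(1) by (metis swap_swap)
  ultimately have "segment_union (prod.swap ` closed_segment a b)"
    by (metis segment_union_segment)
  then show ?case unfolding image_Un by (rule segment_union_Un) (rule segment(2))
qed

text \<open>A horizontal line meets a non-horizontal segment in at most one point, and a horizontal
  segment is missed once its height is excluded. The fundamental theorem of calculus can therefore
  be applied on almost every line with finitely many exceptional points.\<close>

lemma segment_union_slices:
  assumes "segment_union D"
  obtains Z where "finite Z" "\<And>z. z \<notin> Z \<Longrightarrow> finite {r. (r, z) \<in> D}"
proof -
  have "\<exists>Z. finite Z \<and> (\<forall>z. z \<notin> Z \<longrightarrow> finite {r. (r, z) \<in> D})" using assms
  proof (induction D rule: segment_union_induct)
    case empty then show ?case by (intro exI[of _ "{}"]) auto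
  next
    case (segment a b A)
    then obtain Z where Z: "finite Z" "\<And>z. z \<notin> Z \<Longrightarrow> finite {r. (r, z) \<in> A}" by blast
    have fin: "finite {r. (r, z) \<in> closed_segment a b}" if z: "z \<notin> {snd a}" for z
    proof (cases "snd a = snd b")
      case True
      then have "{r. (r, z) \<in> closed_segment a b} = {}"
        using z by (auto simp: in_segment prod_eq_iff algebra_simps)
      then show ?thesis by (metis finite.emptyI)
    next
      case False
      have "{r. (r, z) \<in> closed_segment a b} \<subseteq>
          {fst a + ((z - snd a) / (snd b - snd a)) * (fst b - fst a)}"
      proof safe
        fix r assume "(r, z) \<in> closed_segment a b"
        then obtain u where u: "r = (1 - u) * fst a + u * fst b" "z = (1 - u) * snd a + u * snd b"
          by (auto simp: in_segment prod_eq_iff)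
        have "(z - snd a) / (snd b - snd a) = u" using False u(2) by (simp add: field_simps)
        then show "r = fst a + ((z - snd a) / (snd b - snd a)) * (fst b - fst a)"
          using u(1) by (simp add: algebra_simps)
      qed
      then show ?thesis by (meson finite.emptyI finite_insert finite_subset)
    qed
    have "{r. (r, z) \<in> closed_segment a b \<union> A} =
        {r. (r, z) \<in> closed_segment a b} \<union> {r. (r, z) \<in> A}" for z by auto
    then have "\<forall>z. z \<notin> insert (snd a) Z \<longrightarrow> finite {r. (r, z) \<in> closed_segment a b \<union> A}"
      using Z(2) fin by auto
    then show ?case using Z(1) by (meson finite_insert)
  qed
  then show ?thesis using that by blast
qed

text \<open>Working with \<open>lborel\<close> on open sets gives measurability from continuity and
  keeps the product structure needed for Fubini's theorem. The passage from \<open>lebesgue\<close>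
  is made only for the integrals of the scheme.\<close>

lemma set_integrable_bounded_continuous:
  fixes f :: "'a::euclidean_space \<Rightarrow> 'b::euclidean_space"
  assumes "open S" "bounded S" "continuous_on S f" "\<And>x. x \<in> S \<Longrightarrow> norm (f x) \<le> C"
  shows "set_integrable lborel S f"
  unfolding set_integrable_def
proof (rule Bochner_Integration.integrable_bound)
  have "S \<in> sets lborel" using assms(1) by simp
  moreover have "emeasure lborel S < \<infinity>" using assms(2) by (rule emeasure_bounded_finite)
  ultimately show "integrable lborel (\<lambda>x. indicator S x *\<^sub>R C)"
    using integrable_indicator[of S lborel] by (intro integrable_scaleR_left) auto
  show "(\<lambda>x. indicator S x *\<^sub>R f x) \<in> borel_measurable lborel"
    using borel_measurable_continuous_on_indicator[OF _ assms(3)] assms(1) by simp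
  show "AE x in lborel. norm (indicator S x *\<^sub>R f x) \<le> norm (indicator S x *\<^sub>R C)"
  proof (rule AE_I2)
    fix x show "norm (indicator S x *\<^sub>R f x) \<le> norm (indicator S x *\<^sub>R C)"
    proof (cases "x \<in> S")
      case True
      then show ?thesis using assms(4)[of x] by simp
    qed simp
  qed
qed

text \<open>On almost every horizontal line the integral of \<open>g\<close> is a difference of two
  values of \<open>G\<close> far out, both 0. Continuity of \<open>G\<close> across \<open>E\<close>
  excludes jumps there, so kinks of \<open>G\<close>, such as those at element edges, contribute
  nothing.\<close>

lemma integral_partial_r_eq_0:
  fixes G g :: "point \<Rightarrow> real"
  assumes E: "segment_union E" and G: "continuous_on UNIV G"
    and supp: "\<And>x. norm x \<ge> B \<Longrightarrow> G x = 0" "\<And>x. norm x \<ge> B \<Longrightarrow> x \<notin> E \<Longrightarrow> g x = 0"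
    and deriv: "\<And>x. x \<notin> E \<Longrightarrow> ((\<lambda>s. G (s, snd x)) has_real_derivative g x) (at (fst x))"
    and g: "continuous_on (- E) g" "\<And>x. x \<notin> E \<Longrightarrow> \<bar>g x\<bar> \<le> C"
  shows "set_integrable lborel (- E) g" "(LINT x:- E|lborel. g x) = 0"
proof -
  have oE: "open (- E)" using segment_union_closed[OF E] by auto
  define f where "f = (\<lambda>x. indicator (- E) x *\<^sub>R g x)"
  have fint: "set_integrable lborel (ball 0 B \<inter> - E) g"
    by (rule set_integrable_bounded_continuous[where C=C])
      (use oE g in \<open>auto intro: continuous_on_subset\<close>)
  have feq: "indicator (ball 0 B \<inter> - E) x *\<^sub>R g x = f x" for x
  proof (cases "x \<in> ball 0 B")
    case False
    then have "B \<le> norm x" by simp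
    then have "x \<in> E \<or> g x = 0" using supp(2) by blast
    then show ?thesis using False by (auto simp: f_def)
  qed (simp add: f_def indicator_def)
  have fi: "integrable lborel f"
    using fint unfolding set_integrable_def feq .
  then show "set_integrable lborel (- E) g" unfolding set_integrable_def f_def .
  obtain Z where Z: "finite Z" "\<And>z. z \<notin> Z \<Longrightarrow> finite {r. (r, z) \<in> E}"
    using segment_union_slices[OF E] by blast
  \<comment> \<open>\<open>B\<close> may be negative, while the interval from \<open>- K\<close> to
    \<open>K\<close> has to be nonempty.\<close>
  define K where "K = \<bar>B\<bar>"
  have inner: "(\<integral>r. f (r, z) \<partial>lborel) = 0"
    if z: "z \<notin> Z" and int: "integrable lborel (\<lambda>r. f (r, z))" for z
  proof -
    \<comment> \<open>This form of the fundamental theorem takes a finite exceptional set, here the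
      slice of \<open>E\<close>, and only continuity of \<open>G\<close> at its points.\<close>
    have FTC: "((\<lambda>r. f (r, z)) has_integral (G (K, z) - G (- K, z))) {- K .. K}"
    proof (rule fundamental_theorem_of_calculus_interior_strong[OF Z(2)[OF z]])
      show "- K \<le> K" by (simp add: K_def)
      show "continuous_on {- K..K} (\<lambda>r. G (r, z))"
        by (intro continuous_on_compose2[OF G]) (auto intro!: continuous_intros)
      fix r assume "r \<in> {- K<..<K} - {r. (r, z) \<in> E}"
      then have "(r, z) \<notin> E" by auto
      then show "((\<lambda>r. G (r, z)) has_vector_derivative f (r, z)) (at r)"
        using deriv[of "(r, z)"]
        by (simp add: f_def has_real_derivative_iff_has_vector_derivative)
    qed
    have nK: "norm (r, z) \<ge> B" if "\<bar>r\<bar> \<ge> K" for r :: real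
      using that norm_fst_le[of r z] abs_ge_self[of B] unfolding K_def real_norm_def by linarith
    have "G (K, z) = 0" "G (- K, z) = 0"
      by (rule supp(1)[OF nK], simp only: K_def abs_minus_cancel abs_idempotent order_refl)+
    then have h0: "((\<lambda>r. f (r, z)) has_integral 0) {- K .. K}"
      using FTC by simp
    have "((\<lambda>r. if r \<in> {-K..K} then f (r, z) else 0) has_integral 0) UNIV"
      unfolding has_integral_restrict_UNIV by (rule h0)
    moreover have "(\<lambda>r. if r \<in> {-K..K} then f (r, z) else 0) = (\<lambda>r. f (r, z))"
    proof
      fix r
      have "f (r, z) = 0" if "r \<notin> {-K..K}"
      proof -
        have "norm (r, z) \<ge> B" by (rule nK) (use that in auto)
        then have "(r, z) \<in> E \<or> g (r, z) = 0" using supp(2) by blast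
        then show ?thesis by (auto simp: f_def)
      qed
      then show "(if r \<in> {-K..K} then f (r, z) else 0) = f (r, z)" by auto
    qed
    ultimately have "((\<lambda>r. f (r, z)) has_integral 0) UNIV" by simp
    moreover have "((\<lambda>r. f (r, z)) has_integral (\<integral>r. f (r, z) \<partial>lborel)) UNIV"
      using int by (rule has_integral_integral_lborel)
    ultimately show ?thesis by (metis has_integral_unique)
  qed
  have fi': "integrable (lborel \<Otimes>\<^sub>M lborel) (case_prod (\<lambda>r z. f (r, z)))"
    using fi unfolding lborel_prod by simp
  \<comment> \<open>The inner integral is known to vanish where the slice is integrable and meets
    \<open>E\<close> finitely often; both hold for almost every height.\<close>
  have "AE z in lborel. z \<notin> Z"
    by (rule AE_not_in[OF finite_imp_null_set_lborel[OF Z(1)]])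
  then have "AE z in lborel. (\<integral>r. f (r, z) \<partial>lborel) = 0"
    using lborel_pair.AE_integrable_snd[OF fi'] by eventually_elim (rule inner)
  then have "(\<integral>z. (\<integral>r. f (r, z) \<partial>lborel) \<partial>lborel) = 0"
    by (intro integral_eq_zero_AE) 
  then have "integral\<^sup>L lborel f = 0"
    using lborel_pair.integral_snd[OF fi'] unfolding lborel_prod by simp
  then show "(LINT x:- E|lborel. g x) = 0"
    unfolding set_lebesgue_integral_def f_def .
qed

text \<open>Exchanging the coordinates reduces this to \<open>integral_partial_r_eq_0\<close> for
  the reflected set, and the product measure is invariant under the exchange.\<close>

lemma integral_partial_z_eq_0:
  fixes G g :: "point \<Rightarrow> real"
  assumes E: "segment_union E" and G: "continuous_on UNIV G"
    and supp: "\<And>x. norm x \<ge> B \<Longrightarrow> G x = 0" "\<And>x. norm x \<ge> B \<Longrightarrow> x \<notin> E \<Longrightarrow> g x = 0"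
    and deriv: "\<And>x. x \<notin> E \<Longrightarrow> ((\<lambda>s. G (fst x, s)) has_real_derivative g x) (at (snd x))"
    and g: "continuous_on (- E) g" "\<And>x. x \<notin> E \<Longrightarrow> \<bar>g x\<bar> \<le> C"
  shows "set_integrable lborel (- E) g" "(LINT x:- E|lborel. g x) = 0"
proof -
  define E' where "E' = prod.swap ` E"
  have inE': "x \<in> E' \<longleftrightarrow> prod.swap x \<in> E" for x
    unfolding E'_def by (metis imageE imageI swap_swap)
  have nsw: "norm (prod.swap x) = norm x" for x :: point
    by (cases x) (simp add: norm_Pair add.commute)
  have csw: "continuous_on A (prod.swap :: point \<Rightarrow> point)" for A
    by (rule continuous_on_swap)
  have E'': "segment_union E'" unfolding E'_def using E by (rule segment_union_swap)
  have oE: "open (- E)" using segment_union_closed[OF E] by auto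
  note * = integral_partial_r_eq_0[OF E'', of "G \<circ> prod.swap" B "g \<circ> prod.swap" C]
  have prems: "continuous_on UNIV (G \<circ> prod.swap)"
    "\<And>x. B \<le> norm x \<Longrightarrow> (G \<circ> prod.swap) x = 0"
    "\<And>x. B \<le> norm x \<Longrightarrow> x \<notin> E' \<Longrightarrow> (g \<circ> prod.swap) x = 0"
    "\<And>x. x \<notin> E' \<Longrightarrow> ((\<lambda>s. (G \<circ> prod.swap) (s, snd x)) has_real_derivative (g \<circ> prod.swap) x) (at (fst x))"
    "continuous_on (- E') (g \<circ> prod.swap)"
    "\<And>x. x \<notin> E' \<Longrightarrow> \<bar>(g \<circ> prod.swap) x\<bar> \<le> C"
  proof -
    show "continuous_on UNIV (G \<circ> prod.swap)"
      by (intro continuous_on_compose csw continuous_on_subset[OF G]) auto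
    show "continuous_on (- E') (g \<circ> prod.swap)"
      by (intro continuous_on_compose csw continuous_on_subset[OF g(1)]) (auto simp: inE')
    fix x
    show "x \<notin> E' \<Longrightarrow> ((\<lambda>s. (G \<circ> prod.swap) (s, snd x)) has_real_derivative (g \<circ> prod.swap) x) (at (fst x))"
      using deriv[of "prod.swap x"] by (auto simp: inE')
    show "B \<le> norm x \<Longrightarrow> (G \<circ> prod.swap) x = 0"
      using supp(1)[of "prod.swap x"] nsw[of x] by (metis comp_apply)
    show "B \<le> norm x \<Longrightarrow> x \<notin> E' \<Longrightarrow> (g \<circ> prod.swap) x = 0"
      using supp(2)[of "prod.swap x"] nsw[of x] inE'[of x] by (metis comp_apply)
    show "x \<notin> E' \<Longrightarrow> \<bar>(g \<circ> prod.swap) x\<bar> \<le> C"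
      using g(2)[of "prod.swap x"] inE'[of x] by (metis comp_apply)
  qed
  define f where "f = (\<lambda>x. indicator (- E) x *\<^sub>R g x)"
  have fsw: "(\<lambda>x. indicator (- E') x *\<^sub>R (g \<circ> prod.swap) x) = (\<lambda>(r, z). f (z, r))"
    by (auto simp: f_def fun_eq_iff indicator_def inE')
  have fmeas: "f \<in> borel_measurable (lborel \<Otimes>\<^sub>M lborel)"
    using borel_measurable_continuous_on_indicator[OF _ g(1)] oE unfolding f_def lborel_prod by simp
  have int: "integrable (lborel \<Otimes>\<^sub>M lborel) (\<lambda>(r, z). f (z, r))"
    using *(1)[OF prems] unfolding set_integrable_def fsw lborel_prod .
  then have "integrable (lborel \<Otimes>\<^sub>M lborel) f"
    using lborel_pair.integrable_product_swap_iff by blast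
  then show "set_integrable lborel (- E) g"
    unfolding set_integrable_def f_def lborel_prod .
  have "integral\<^sup>L (lborel \<Otimes>\<^sub>M lborel) f = 0"
    using lborel_pair.integral_product_swap[OF fmeas] *(2)[OF prems]
    unfolding set_lebesgue_integral_def fsw lborel_prod by simp
  then show "(LINT x:- E|lborel. g x) = 0"
    unfolding set_lebesgue_integral_def f_def lborel_prod .
qed

subsection \<open>The distance to a segment\<close>

text \<open>Meant for functions given by different polynomials on the two sides of a point;
  agreement of value and derivative at \<open>a\<close> glues the one-sided derivatives.\<close>

lemma has_real_derivative_If_le:
  fixes f g :: "real \<Rightarrow> real"
  assumes "\<And>t. t \<le> a \<Longrightarrow> (f has_real_derivative f' t) (at t)"
    and "\<And>t. t \<ge> a \<Longrightarrow> (g has_real_derivative g' t) (at t)"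
    and "f a = g a" "f' a = g' a"
  shows "((\<lambda>t. if t \<le> a then f t else g t) has_real_derivative (if t \<le> a then f' t else g' t)) (at t)"
proof -
  have cl: "closure {..a} \<inter> closure {a<..} = {a}" by auto
  have "((\<lambda>t. if t \<in> {..a} then f t else g t) has_vector_derivative
      (if t \<in> {..a} then f' t else g' t)) (at t within UNIV)"
  proof (rule has_vector_derivative_If_within_closures[where T = "{a<..}"])
    show "UNIV = {..a} \<union> {a<..}" by auto
    show "t \<in> {..a} \<union> {a<..}" by auto
    show "t \<in> {..a} \<union> closure {..a} \<inter> closure {a<..} \<Longrightarrow>
      (f has_vector_derivative f' t) (at t within {..a} \<union> closure {..a} \<inter> closure {a<..})"
      unfolding cl has_real_derivative_iff_has_vector_derivative[symmetric]
      by (rule has_field_derivative_at_within, rule assms(1)) auto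
    show "t \<in> {a<..} \<union> closure {..a} \<inter> closure {a<..} \<Longrightarrow>
      (g has_vector_derivative g' t) (at t within {a<..} \<union> closure {..a} \<inter> closure {a<..})"
      unfolding cl has_real_derivative_iff_has_vector_derivative[symmetric]
      by (rule has_field_derivative_at_within, rule assms(2)) auto
    show "t \<in> closure {..a} \<Longrightarrow> t \<in> closure {a<..} \<Longrightarrow> f t = g t"
      using assms(3) by (simp add: antisym)
    show "t \<in> closure {..a} \<Longrightarrow> t \<in> closure {a<..} \<Longrightarrow> f' t = g' t"
      using assms(4) by (simp add: antisym)
  qed
  then show ?thesis
    by (simp add: has_real_derivative_iff_has_vector_derivative)
qed

text \<open>Squaring makes the positive part continuously differentiable at 0. Cut-offs built from
  it have a gradient at every point, so the product rule applies everywhere.\<close>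

definition ramp2 :: "real \<Rightarrow> real" where "ramp2 t = (max 0 t)\<^sup>2"

lemma ramp2_has_real_derivative: "(ramp2 has_real_derivative 2 * max 0 t) (at t)"
proof -
  have "((\<lambda>t. if t \<le> 0 then 0 else t\<^sup>2) has_real_derivative (if t \<le> 0 then 0 else 2 * t)) (at t)"
    by (rule has_real_derivative_If_le) (auto intro!: derivative_eq_intros)
  moreover have "(\<lambda>t. if t \<le> 0 then 0 else t\<^sup>2) = ramp2"
    by (auto simp: ramp2_def max_def)
  ultimately show ?thesis by (auto simp: max_def split: if_splits)
qed

lemma ramp2_simps: "t \<le> 0 \<Longrightarrow> ramp2 t = 0" "0 \<le> ramp2 t" "t \<le> 1 \<Longrightarrow> ramp2 t \<le> 1" "ramp2 1 = 1"
  by (auto simp: ramp2_def max_def power_le_one)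

lemma continuous_on_ramp2 [continuous_intros]:
  "continuous_on A f \<Longrightarrow> continuous_on A (\<lambda>x. ramp2 (f x))"
  unfolding ramp2_def by (intro continuous_intros)

lemma has_derivative_ramp2:
  assumes "(f has_derivative (\<lambda>h. h \<bullet> v)) (at x)"
  shows "((\<lambda>x. ramp2 (f x)) has_derivative (\<lambda>h. h \<bullet> ((2 * max 0 (f x)) *\<^sub>R v))) (at x)"
  using has_derivative_compose[OF assms, of ramp2 "\<lambda>h. (2 * max 0 (f x)) * h"]
    ramp2_has_real_derivative[of "f x"]
  by (simp add: has_field_derivative_def)

lemma perp_simps: "norm (perp u) = norm u" "u \<bullet> perp u = 0" "perp u \<bullet> u = 0"
  "perp (c *\<^sub>R u) = c *\<^sub>R perp u" "perp u \<bullet> perp v = u \<bullet> v" "perp (u + v) = perp u + perp v"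
  by (cases u; cases v; auto simp: perp_def norm_Pair add.commute)+

lemma orthonormal_decomposition:
  fixes x :: point
  assumes "norm u = 1"
  shows "x = (x \<bullet> u) *\<^sub>R u + (x \<bullet> perp u) *\<^sub>R perp u"
proof -
  obtain a b where u: "u = (a, b)" by (cases u)
  obtain y z where x: "x = (y, z)" by (cases x)
  have ab: "a * a + b * b = 1"
    using assms by (simp add: u norm_Pair power2_eq_square real_sqrt_eq_1_iff)
  have "y = (y * a + z * b) * a + (y * b - z * a) * b"
    using ab by algebra
  moreover have "z = (y * a + z * b) * b - (y * b - z * a) * a"
    using ab by algebra
  ultimately show ?thesis by (simp add: x u perp_def prod_eq_iff)
qed

lemma norm_orthonormal_decomposition:
  fixes x :: point
  assumes "norm u = 1"
  shows "(norm x)\<^sup>2 = (x \<bullet> u)\<^sup>2 + (x \<bullet> perp u)\<^sup>2"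
proof -
  have "x \<bullet> x = x \<bullet> ((x \<bullet> u) *\<^sub>R u + (x \<bullet> perp u) *\<^sub>R perp u)"
    using orthonormal_decomposition[OF assms, of x] by simp
  then show ?thesis
    by (simp only: inner_add_right inner_scaleR_right power2_norm_eq_inner) (simp add: power2_eq_square)
qed

text \<open>The squared distance to the segment from \<open>p\<close> to \<open>q\<close>, in a form that exhibits it as
  continuously differentiable.\<close>

definition seg_dist2 :: "point \<Rightarrow> point \<Rightarrow> point \<Rightarrow> real" where
  "seg_dist2 p q x = ((x - p) \<bullet> perp (sgn (q - p)))\<^sup>2
     + ramp2 ((p - x) \<bullet> sgn (q - p)) + ramp2 ((x - q) \<bullet> sgn (q - p))"

definition seg_dist2_grad :: "point \<Rightarrow> point \<Rightarrow> point \<Rightarrow> point" where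
  "seg_dist2_grad p q x = (2 * ((x - p) \<bullet> perp (sgn (q - p)))) *\<^sub>R perp (sgn (q - p))
     - (2 * max 0 ((p - x) \<bullet> sgn (q - p))) *\<^sub>R sgn (q - p)
     + (2 * max 0 ((x - q) \<bullet> sgn (q - p))) *\<^sub>R sgn (q - p)"

text \<open>With d the distance to the segment, this is 1 - (1 - d^2 / \<delta>^2)^2 for d <
  \<delta> and 1 beyond. It vanishes on the segment and reaches the value 1 with zero
  gradient.\<close>

definition cutoff :: "real \<Rightarrow> point \<Rightarrow> point \<Rightarrow> point \<Rightarrow> real" where
  "cutoff \<delta> p q x = 1 - ramp2 (1 - seg_dist2 p q x / \<delta>\<^sup>2)"

definition cutoff_grad :: "real \<Rightarrow> point \<Rightarrow> point \<Rightarrow> point \<Rightarrow> point" where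
  "cutoff_grad \<delta> p q x = (2 * max 0 (1 - seg_dist2 p q x / \<delta>\<^sup>2) / \<delta>\<^sup>2) *\<^sub>R seg_dist2_grad p q x"

lemma seg_dist2_has_derivative:
  "(seg_dist2 p q has_derivative (\<lambda>h. h \<bullet> seg_dist2_grad p q x)) (at x)"
proof -
  have 1: "((\<lambda>x. ((x - p) \<bullet> v)\<^sup>2) has_derivative (\<lambda>h. h \<bullet> ((2 * ((x - p) \<bullet> v)) *\<^sub>R v))) (at x)" for v
    by (auto intro!: derivative_eq_intros simp: algebra_simps inner_diff_left)
  have 2: "((\<lambda>x. (p - x) \<bullet> v) has_derivative (\<lambda>h. h \<bullet> (- v))) (at x)"
    "((\<lambda>x. (x - q) \<bullet> v) has_derivative (\<lambda>h. h \<bullet> v)) (at x)" for v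
    by (auto intro!: derivative_eq_intros)
  have "((\<lambda>x. ((x - p) \<bullet> perp (sgn (q - p)))\<^sup>2
     + ramp2 ((p - x) \<bullet> sgn (q - p)) + ramp2 ((x - q) \<bullet> sgn (q - p))) has_derivative
     (\<lambda>h. h \<bullet> ((2 * ((x - p) \<bullet> perp (sgn (q - p)))) *\<^sub>R perp (sgn (q - p)))
       + h \<bullet> ((2 * max 0 ((p - x) \<bullet> sgn (q - p))) *\<^sub>R - sgn (q - p))
       + h \<bullet> ((2 * max 0 ((x - q) \<bullet> sgn (q - p))) *\<^sub>R sgn (q - p)))) (at x)"
    by (intro has_derivative_add 1 has_derivative_ramp2 2)
  then show ?thesis
    unfolding seg_dist2_def[abs_def] seg_dist2_grad_def
    by (simp add: inner_add_right inner_diff_right)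
qed

lemma cutoff_has_derivative:
  "(cutoff \<delta> p q has_derivative (\<lambda>h. h \<bullet> cutoff_grad \<delta> p q x)) (at x)"
proof -
  have "((\<lambda>x. 1 - seg_dist2 p q x / \<delta>\<^sup>2) has_derivative (\<lambda>h. h \<bullet> ((- 1 / \<delta>\<^sup>2) *\<^sub>R seg_dist2_grad p q x))) (at x)"
    unfolding divide_inverse
    by (rule has_derivative_eq_rhs, rule has_derivative_diff[OF has_derivative_const
          has_derivative_mult_left[OF seg_dist2_has_derivative]]) (simp add: mult.commute)
  from has_derivative_ramp2[OF this]
  have "((\<lambda>x. 1 - ramp2 (1 - seg_dist2 p q x / \<delta>\<^sup>2)) has_derivative
    (\<lambda>h. 0 - h \<bullet> ((2 * max 0 (1 - seg_dist2 p q x / \<delta>\<^sup>2)) *\<^sub>R ((- 1 / \<delta>\<^sup>2) *\<^sub>R seg_dist2_grad p q x)))) (at x)"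
    by (intro has_derivative_diff has_derivative_const)
  then show ?thesis
    unfolding cutoff_def[abs_def] cutoff_grad_def by simp
qed

lemma continuous_on_seg_dist2: "continuous_on A (seg_dist2 p q)"
  unfolding seg_dist2_def[abs_def] by (intro continuous_intros)

lemma continuous_on_cutoff_grad: "continuous_on A (cutoff_grad \<delta> p q)"
  unfolding cutoff_grad_def[abs_def] seg_dist2_grad_def
  by (cases "\<delta> = 0") (auto intro!: continuous_intros continuous_on_seg_dist2)

lemma seg_dist2_nonneg: "0 \<le> seg_dist2 p q x"
  unfolding seg_dist2_def by (simp add: ramp2_simps)

lemma cutoff_bounds: "0 \<le> cutoff \<delta> p q x" "cutoff \<delta> p q x \<le> 1"
  unfolding cutoff_def using seg_dist2_nonneg[of p q x] by (simp_all add: ramp2_simps)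

lemma seg_param:
  assumes "p \<noteq> q"
  shows "y \<in> closed_segment p q \<longleftrightarrow> (\<exists>t. 0 \<le> t \<and> t \<le> norm (q - p) \<and> y = p + t *\<^sub>R sgn (q - p))"
proof -
  define L where "L = norm (q - p)"
  have L: "L > 0" using assms by (simp add: L_def)
  have q: "q = p + L *\<^sub>R sgn (q - p)" using L by (simp add: L_def sgn_div_norm)
  show ?thesis unfolding L_def[symmetric]
  proof
    assume "y \<in> closed_segment p q"
    then obtain u where u: "0 \<le> u" "u \<le> 1" "y = p + u *\<^sub>R (q - p)"
      by (auto simp: in_segment algebra_simps)
    have "y = p + (u * L) *\<^sub>R sgn (q - p)"
      using u(3) q by (metis add_diff_cancel_left' scaleR_scaleR)
    then show "\<exists>t. 0 \<le> t \<and> t \<le> L \<and> y = p + t *\<^sub>R sgn (q - p)"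
      using u L by (intro exI[of _ "u * L"]) (auto simp: mult_left_le_one_le)
  next
    assume "\<exists>t. 0 \<le> t \<and> t \<le> L \<and> y = p + t *\<^sub>R sgn (q - p)"
    then obtain t where t: "0 \<le> t" "t \<le> L" "y = p + t *\<^sub>R sgn (q - p)" by blast
    have "y = p + (t / L) *\<^sub>R (q - p)"
      using t(3) by (simp add: L_def sgn_div_norm divide_inverse)
    then have "y = (1 - t / L) *\<^sub>R p + (t / L) *\<^sub>R q" by (simp add: algebra_simps)
    then show "y \<in> closed_segment p q"
      using t L by (auto simp: in_segment intro!: exI[of _ "t / L"])
  qed
qed

lemma seg_dist2_cases:
  assumes "p \<noteq> q" "seg_dist2 p q x < \<delta>\<^sup>2" "\<delta> > 0"
  obtains "norm (x - p) < \<delta>" | "norm (x - q) < \<delta>"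
  | y where "y \<in> closed_segment p q" "norm (x - y) < \<delta>"
      "seg_dist2_grad p q x = (2 * ((x - p) \<bullet> perp (sgn (q - p)))) *\<^sub>R perp (sgn (q - p))"
      "\<bar>(x - p) \<bullet> perp (sgn (q - p))\<bar> < \<delta>"
proof -
  define u where "u = sgn (q - p)"
  have u1: "norm u = 1" using assms(1) by (simp add: u_def norm_sgn)
  have q: "q = p + norm (q - p) *\<^sub>R u" using assms(1) by (simp add: u_def sgn_div_norm)
  have uu: "u \<bullet> u = 1" using u1 by (simp add: norm_eq_1)
  have qu: "q \<bullet> u = p \<bullet> u + norm (q - p)"
    by (subst (1) q) (simp add: inner_add_left uu)
  have qn: "q \<bullet> perp u = p \<bullet> perp u"
    by (subst (1) q) (simp add: inner_add_left perp_simps)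
  have d: "seg_dist2 p q x = ((x - p) \<bullet> perp u)\<^sup>2 + ramp2 ((p - x) \<bullet> u) + ramp2 ((x - q) \<bullet> u)"
    by (simp add: seg_dist2_def u_def)
  consider "(x - p) \<bullet> u < 0" | "(x - q) \<bullet> u > 0" | "(x - p) \<bullet> u \<ge> 0" "(x - q) \<bullet> u \<le> 0"
    by linarith
  then show ?thesis
  proof cases
    case 1
    then have r: "ramp2 ((p - x) \<bullet> u) = ((x - p) \<bullet> u)\<^sup>2"
      by (simp add: ramp2_def inner_diff_left max_def power2_commute)
    have "(norm (x - p))\<^sup>2 \<le> seg_dist2 p q x"
      unfolding norm_orthonormal_decomposition[OF u1, of "x - p"] d r by (simp add: ramp2_simps)
    then have "norm (x - p) < \<delta>"
      using assms(2,3) by (intro power2_less_imp_less[of _ \<delta>]) auto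
    then show ?thesis by (rule that)
  next
    case 2
    then have r: "ramp2 ((x - q) \<bullet> u) = ((x - q) \<bullet> u)\<^sup>2"
      by (simp add: ramp2_def max_def)
    have "(x - q) \<bullet> perp u = (x - p) \<bullet> perp u" by (simp add: inner_diff_left qn)
    then have "(norm (x - q))\<^sup>2 \<le> seg_dist2 p q x"
      unfolding norm_orthonormal_decomposition[OF u1, of "x - q"] d r by (simp add: ramp2_simps)
    then have "norm (x - q) < \<delta>"
      using assms(2,3) by (intro power2_less_imp_less[of _ \<delta>]) auto
    then show ?thesis by (rule that)
  next
    case 3
    \<comment> \<open>The foot of the perpendicular from \<open>x\<close>.\<close>
    define y where "y = p + ((x - p) \<bullet> u) *\<^sub>R u"
    have "(x - p) \<bullet> u \<le> norm (q - p)" using 3(2) by (simp add: inner_diff_left qu)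
    then have y: "y \<in> closed_segment p q"
      using 3(1) unfolding seg_param[OF assms(1)] y_def u_def by blast
    have xy: "x - y = ((x - p) \<bullet> perp u) *\<^sub>R perp u"
      using orthonormal_decomposition[OF u1, of "x - p"] unfolding y_def
      by (metis add_diff_cancel_left' diff_diff_eq)
    have m: "max 0 ((p - x) \<bullet> u) = 0" "max 0 ((x - q) \<bullet> u) = 0"
      using 3 by (auto simp: inner_diff_left max_def)
    have "((x - p) \<bullet> perp u)\<^sup>2 < \<delta>\<^sup>2"
      using assms(2) unfolding d by (simp add: ramp2_def m)
    then have a: "\<bar>(x - p) \<bullet> perp u\<bar> < \<delta>"
      using assms(3) abs_square_less_1 by (metis abs_of_pos power2_less_imp_less power2_abs abs_ge_zero less_imp_le)
    have n: "norm (x - y) < \<delta>" using a by (simp add: xy perp_simps u1)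
    have g: "seg_dist2_grad p q x = (2 * ((x - p) \<bullet> perp u)) *\<^sub>R perp u"
      unfolding seg_dist2_grad_def u_def[symmetric] m by simp
    show ?thesis by (rule that(3)[OF y n g[unfolded u_def] a[unfolded u_def]])
  qed
qed

text \<open>A point off the segment has positive distance \<open>e\<close> to it, because the
  segment is closed; \<open>seg_dist2_cases\<close> at scale \<open>e\<close> would produce a point
  of the segment closer than that.\<close>

lemma seg_dist2_eq_0_iff:
  assumes "p \<noteq> q"
  shows "seg_dist2 p q x = 0 \<longleftrightarrow> x \<in> closed_segment p q"
proof
  assume 0: "seg_dist2 p q x = 0"
  show "x \<in> closed_segment p q"
  proof (rule ccontr)
    assume "x \<notin> closed_segment p q"
    moreover have "closed (closed_segment p q)" by simp
    ultimately obtain e where e: "e > 0" "\<forall>y\<in>closed_segment p q. e \<le> dist x y"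
      using separate_point_closed by blast
    have "seg_dist2 p q x < e\<^sup>2" using 0 e(1) by simp
    then obtain y where "y \<in> closed_segment p q" "norm (x - y) < e"
      using seg_dist2_cases[OF assms _ e(1)] ends_in_segment by metis
    then show False using e(2) by (metis dist_norm not_less)
  qed
next
  define u where "u = sgn (q - p)"
  have u1: "norm u = 1" using assms by (simp add: u_def norm_sgn)
  have uu: "u \<bullet> u = 1" using u1 by (simp add: norm_eq_1)
  have q: "q = p + norm (q - p) *\<^sub>R u" using assms by (simp add: u_def sgn_div_norm)
  have qu: "q \<bullet> u = p \<bullet> u + norm (q - p)"
    by (subst (1) q) (simp add: inner_add_left uu)
  assume "x \<in> closed_segment p q"
  then obtain t where t: "0 \<le> t" "t \<le> norm (q - p)" "x = p + t *\<^sub>R u"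
    unfolding seg_param[OF assms] u_def by blast
  have "(p - x) \<bullet> u = - t" "(x - q) \<bullet> u = t - norm (q - p)" "(x - p) \<bullet> perp u = 0"
    using qu by (auto simp: t(3) inner_diff_left inner_add_left uu perp_simps)
  then show "seg_dist2 p q x = 0"
    unfolding seg_dist2_def u_def[symmetric] using t by (simp add: ramp2_simps)
qed

lemma cutoff_on_segment: "p \<noteq> q \<Longrightarrow> x \<in> closed_segment p q \<Longrightarrow> cutoff \<delta> p q x = 0"
  unfolding cutoff_def using seg_dist2_eq_0_iff[of p q x] by (simp add: ramp2_simps)

lemma cutoff_tendsto_1:
  assumes "p \<noteq> q" "x \<notin> closed_segment p q"
  shows "((\<lambda>\<delta>. cutoff \<delta> p q x) \<longlongrightarrow> 1) (at_right 0)"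
proof -
  define d where "d = seg_dist2 p q x"
  have d: "d > 0"
    using seg_dist2_eq_0_iff[OF assms(1), of x] assms(2) seg_dist2_nonneg[of p q x]
    unfolding d_def by linarith
  \<comment> \<open>For \<delta> below the distance to the segment the cut-off already equals 1, so
    the limit is attained.\<close>
  have "eventually (\<lambda>\<delta>. \<delta> \<in> {0<..<sqrt d}) (at_right 0)"
    using d by (intro eventually_at_right_real) simp
  then have "eventually (\<lambda>\<delta>. cutoff \<delta> p q x = 1) (at_right 0)"
  proof eventually_elim
    case (elim \<delta>)
    then have "\<delta>\<^sup>2 \<le> (sqrt d)\<^sup>2" by (intro power_mono) auto
    then have "1 \<le> d / \<delta>\<^sup>2" using elim d by simp
    then show ?case unfolding cutoff_def d_def by (simp add: ramp2_simps)
  qed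
  then show ?thesis by (rule tendsto_eventually)
qed

text \<open>Inside the layer each of the three distances in \<open>seg_dist2_grad\<close> is below
  \<delta> and enters with a factor 2, so that gradient is at most 6 \<delta>. The outer factor is
  at most \<open>2 / \<delta>\<^sup>2\<close>.\<close>

lemma norm_cutoff_grad_le:
  assumes "p \<noteq> q" "\<delta> > 0"
  shows "norm (cutoff_grad \<delta> p q x) \<le> 12 / \<delta>"
proof (cases "seg_dist2 p q x < \<delta>\<^sup>2")
  case False
  then have "1 \<le> seg_dist2 p q x / \<delta>\<^sup>2" using assms(2) by simp
  then show ?thesis using assms(2) by (simp add: cutoff_grad_def max_def)
next
  case True
  define u where "u = sgn (q - p)"
  have u1: "norm u = 1" using assms by (simp add: u_def norm_sgn)
  define a b c where "a = (x - p) \<bullet> perp u" "b = max 0 ((p - x) \<bullet> u)" "c = max 0 ((x - q) \<bullet> u)"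
  have d: "seg_dist2 p q x = a\<^sup>2 + b\<^sup>2 + c\<^sup>2"
    by (simp add: seg_dist2_def u_def a_b_c_def ramp2_def)
  have "\<bar>a\<bar> < \<delta>" "\<bar>b\<bar> < \<delta>" "\<bar>c\<bar> < \<delta>"
    by (rule power2_less_imp_less; use True d assms(2) in \<open>simp\<close>;
        use zero_le_power2[of a] zero_le_power2[of b] zero_le_power2[of c] in linarith)+
  moreover have "norm (seg_dist2_grad p q x) \<le> 2 * \<bar>a\<bar> + 2 * \<bar>b\<bar> + 2 * \<bar>c\<bar>"
  proof -
    have g: "seg_dist2_grad p q x = (2 * a) *\<^sub>R perp u - (2 * b) *\<^sub>R u + (2 * c) *\<^sub>R u"
      by (simp add: seg_dist2_grad_def a_b_c_def u_def)
    have "norm (seg_dist2_grad p q x) \<le> norm ((2 * a) *\<^sub>R perp u) + norm ((2 * b) *\<^sub>R u) + norm ((2 * c) *\<^sub>R u)"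
      unfolding g
      using norm_triangle_ineq[of "(2 * a) *\<^sub>R perp u - (2 * b) *\<^sub>R u" "(2 * c) *\<^sub>R u"]
        norm_triangle_ineq4[of "(2 * a) *\<^sub>R perp u" "(2 * b) *\<^sub>R u"] by linarith
    then show ?thesis by (simp add: perp_simps u1)
  qed
  ultimately have 1: "norm (seg_dist2_grad p q x) \<le> 6 * \<delta>" by linarith
  have "norm (cutoff_grad \<delta> p q x) =
      (2 * max 0 (1 - seg_dist2 p q x / \<delta>\<^sup>2) / \<delta>\<^sup>2) * norm (seg_dist2_grad p q x)"
    by (simp add: cutoff_grad_def)
  also have "\<dots> \<le> (2 * 1 / \<delta>\<^sup>2) * (6 * \<delta>)"
    using 1 assms(2) seg_dist2_nonneg[of p q x]
    by (intro mult_mono divide_right_mono mult_left_mono) auto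
  also have "\<dots> = 12 / \<delta>" using assms(2) by (simp add: power2_eq_square field_simps)
  finally show ?thesis .
qed

section \<open>Area of a thin layer around a segment\<close>

lemma measure_ball_le:
  fixes c :: point
  assumes "r \<ge> 0"
  shows "measure lborel (ball c r) \<le> 4 * r\<^sup>2"
proof -
  obtain a b where c: "c = (a, b)" by (cases c)
  have "ball c r \<subseteq> cbox (a - r, b - r) (a + r, b + r)"
  proof
    fix x assume x: "x \<in> ball c r"
    have "\<bar>fst x - a\<bar> \<le> dist c x" "\<bar>snd x - b\<bar> \<le> dist c x"
      using dist_fst_le[of c x] dist_snd_le[of c x] by (auto simp: c dist_real_def abs_minus_commute)
    then show "x \<in> cbox (a - r, b - r) (a + r, b + r)"
      using x by (cases x) (auto simp: cbox_Pair_eq)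
  qed
  then have "measure lborel (ball c r) \<le> measure lborel (cbox (a - r, b - r) (a + r, b + r))"
    by (intro measure_mono_fmeasurable)
      (auto simp: fmeasurable_def emeasure_bounded_finite[unfolded infinity_ennreal_def])
  also have "\<dots> = measure lborel (cbox (a - r) (a + r)) * measure lborel (cbox (b - r) (b + r))"
    by (rule content_Pair)
  also have "\<dots> = 4 * r\<^sup>2" using assms by (simp add: power2_eq_square)
  finally show ?thesis .
qed

lemma open_seg_layer: "open {x. seg_dist2 p q x < c}"
  by (intro open_Collect_less continuous_on_seg_dist2 continuous_on_const)

text \<open>The nodes divide the segment into \<open>K\<close> parts of length at most \<delta>. A
  point of the layer is within \<delta> of some \<open>y\<close> on the segment, and
  \<open>y\<close> is within \<delta> of a node, whence the radius.\<close>

lemma seg_layer_covering: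
  assumes "p \<noteq> q" "\<delta> > 0"
  defines "K \<equiv> nat \<lceil>norm (q - p) / \<delta>\<rceil>"
  shows "{x. seg_dist2 p q x < \<delta>\<^sup>2} \<subseteq> (\<Union>k\<in>{..K}. ball (p + (real k / real K) *\<^sub>R (q - p)) (2 * \<delta>))"
proof
  fix x assume "x \<in> {x. seg_dist2 p q x < \<delta>\<^sup>2}"
  then obtain y where y: "y \<in> closed_segment p q" "norm (x - y) < \<delta>"
    using seg_dist2_cases[OF assms(1) _ assms(2)] ends_in_segment
    by (metis mem_Collect_eq)
  from y(1) obtain u where u: "0 \<le> u" "u \<le> 1" "y = p + u *\<^sub>R (q - p)"
    by (auto simp: in_segment algebra_simps)
  define L where "L = norm (q - p)"
  have L: "L > 0" using assms(1) by (simp add: L_def)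
  have KL: "L / \<delta> \<le> real K" unfolding K_def L_def by (rule of_nat_ceiling)
  then have K0: "real K > 0" using L assms(2) by (smt (verit) divide_pos_pos)
  \<comment> \<open>Rounding down selects the node at the end nearer to \<open>p\<close> of the part
    that contains \<open>y\<close>.\<close>
  define k where "k = nat \<lfloor>u * real K\<rfloor>"
  have k1: "real k \<le> u * real K" "u * real K < real k + 1"
    unfolding k_def using u(1) K0 by (auto simp: of_nat_nat floor_correct)
  have "u * real K \<le> 1 * real K" using u(2) K0 by (intro mult_right_mono) auto
  then have "real k \<le> real K" using k1(1) by simp
  then have kK: "k \<in> {..K}" by simp
  have "\<bar>u - real k / real K\<bar> \<le> 1 / real K"
  proof -
    have "real k / real K \<le> u" "u \<le> (real k + 1) / real K"
      using k1 K0 by (simp_all add: pos_divide_le_eq pos_le_divide_eq)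
    then show ?thesis by (simp add: add_divide_distrib)
  qed
  then have "\<bar>u - real k / real K\<bar> * L \<le> (1 / real K) * L"
    using L by (intro mult_right_mono) auto
  also have "\<dots> \<le> \<delta>" using KL K0 assms(2) by (simp add: field_simps)
  finally have "norm (y - (p + (real k / real K) *\<^sub>R (q - p))) \<le> \<delta>"
    unfolding u(3) L_def by (metis add_diff_cancel_left norm_scaleR scaleR_left_diff_distrib)
  then have "norm (x - (p + (real k / real K) *\<^sub>R (q - p))) < 2 * \<delta>"
    using y(2) dist_triangle[of x "p + (real k / real K) *\<^sub>R (q - p)" y] unfolding dist_norm by linarith
  then show "x \<in> (\<Union>k\<in>{..K}. ball (p + (real k / real K) *\<^sub>R (q - p)) (2 * \<delta>))"
    using kK by (auto simp: dist_norm norm_minus_commute)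
qed

text \<open>At most \<open>norm (q - p) / \<delta> + 2\<close> discs of area at most 16 \<delta>^2
  cover the layer. Since \<delta> \<le> 1, the quadratic term 32 \<delta>^2 is absorbed into a
  linear one. An area O(\<delta>) balances a gradient of size 1 / \<delta>.\<close>

lemma measure_seg_layer_le:
  assumes "p \<noteq> q" "0 < \<delta>" "\<delta> \<le> 1"
  shows "{x. seg_dist2 p q x < \<delta>\<^sup>2} \<in> fmeasurable lborel"
    "measure lborel {x. seg_dist2 p q x < \<delta>\<^sup>2} \<le> (16 * norm (q - p) + 32) * \<delta>"
proof -
  define L where "L = norm (q - p)"
  define K where "K = nat \<lceil>L / \<delta>\<rceil>"
  define B where "B = (\<lambda>k. ball (p + (real k / real K) *\<^sub>R (q - p)) (2 * \<delta>))"
  have sub: "{x. seg_dist2 p q x < \<delta>\<^sup>2} \<subseteq> (\<Union>k\<in>{..K}. B k)"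
    using seg_layer_covering[OF assms(1,2)] unfolding B_def K_def L_def .
  have Bf: "B k \<in> fmeasurable lborel" for k
    by (simp add: B_def fmeasurable_def bounded_ball emeasure_bounded_finite[unfolded infinity_ennreal_def])
  have Uf: "(\<Union>k\<in>{..K}. B k) \<in> fmeasurable lborel"
    by (intro fmeasurable.finite_UN Bf) auto
  have ms: "{x. seg_dist2 p q x < \<delta>\<^sup>2} \<in> sets lborel"
    using open_seg_layer by simp
  show "{x. seg_dist2 p q x < \<delta>\<^sup>2} \<in> fmeasurable lborel"
    by (rule fmeasurableI2[OF Uf sub ms])
  have "measure lborel {x. seg_dist2 p q x < \<delta>\<^sup>2} \<le> measure lborel (\<Union>k\<in>{..K}. B k)"
    by (rule measure_mono_fmeasurable[OF sub ms Uf])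
  also have "\<dots> \<le> (\<Sum>k\<in>{..K}. measure lborel (B k))"
    by (rule measure_UNION_le) (simp_all add: B_def)
  also have "\<dots> \<le> (\<Sum>k\<in>{..K}. 4 * (2 * \<delta>)\<^sup>2)"
    unfolding B_def by (intro sum_mono measure_ball_le) (use assms in simp)
  also have "\<dots> = (real K + 1) * (16 * \<delta>\<^sup>2)" by (simp add: power2_eq_square)
  also have "\<dots> \<le> (L / \<delta> + 2) * (16 * \<delta>\<^sup>2)"
  proof (rule mult_right_mono)
    have "0 \<le> L / \<delta>" using assms by (simp add: L_def)
    then have "real K < L / \<delta> + 1" unfolding K_def by linarith
    then show "real K + 1 \<le> L / \<delta> + 2" by simp
  qed simp
  also have "\<dots> = 16 * L * \<delta> + 32 * \<delta> * \<delta>" using assms by (simp add: field_simps power2_eq_square)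
  also have "\<dots> \<le> 16 * L * \<delta> + 32 * \<delta> * 1" using assms by (intro add_left_mono mult_left_mono) auto
  also have "\<dots> = (16 * L + 32) * \<delta>" by (simp add: algebra_simps)
  finally show "measure lborel {x. seg_dist2 p q x < \<delta>\<^sup>2} \<le> (16 * norm (q - p) + 32) * \<delta>"
    unfolding L_def .
qed

text \<open>Beside the segment the gradient is normal to it, so \<open>F x\<close> may be replaced
  by \<open>F x - F y\<close> with a nearby \<open>y\<close> at which \<open>F\<close> is
  tangential; this gains the modulus of continuity \<omega>. Around the end points the gradient
  turns, tangentiality gives nothing, and the crude bound by \<open>C\<close> is kept on two small
  discs.\<close>

lemma boundary_layer_pointwise:
  fixes F :: "point \<Rightarrow> point"
  assumes pq: "p \<noteq> q" and \<delta>: "\<delta> > 0"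
    and bound: "norm (F x) \<le> C"
    and near: "\<And>y. y \<in> closed_segment p q \<Longrightarrow> norm (x - y) < \<delta> \<Longrightarrow> norm (F x - F y) \<le> \<omega>"
    and tan: "\<And>y. y \<in> closed_segment p q \<Longrightarrow> F y \<bullet> perp (q - p) = 0"
  shows "\<bar>F x \<bullet> cutoff_grad \<delta> p q x\<bar> \<le> (4 * \<omega> / \<delta>) * indicator {x. seg_dist2 p q x < \<delta>\<^sup>2} x
     + (12 * C / \<delta>) * (indicator (ball p \<delta>) x + indicator (ball q \<delta>) x)"
proof (cases "seg_dist2 p q x < \<delta>\<^sup>2")
  case False
  then have "1 \<le> seg_dist2 p q x / \<delta>\<^sup>2" using \<delta> by simp
  then have "cutoff_grad \<delta> p q x = 0" by (simp add: cutoff_grad_def max_def)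
  moreover have "0 \<le> C" using bound norm_ge_zero order_trans by blast
  ultimately show ?thesis using False \<delta> by simp
next
  case True
  have C0: "0 \<le> C" using bound norm_ge_zero[of "F x"] by linarith
  have nb: "\<bar>F x \<bullet> cutoff_grad \<delta> p q x\<bar> \<le> 12 * C / \<delta>"
  proof -
    have "\<bar>F x \<bullet> cutoff_grad \<delta> p q x\<bar> \<le> norm (F x) * norm (cutoff_grad \<delta> p q x)"
      by (rule Cauchy_Schwarz_ineq2)
    also have "\<dots> \<le> C * (12 / \<delta>)"
      by (intro mult_mono bound norm_cutoff_grad_le[OF pq \<delta>] C0) auto
    finally show ?thesis by (simp add: mult.commute)
  qed
  \<comment> \<open>Since \<open>x\<close> lies in the layer, some \<open>y\<close> on the segment
    is within \<delta> of it, and there \<open>near\<close> bounds a norm by \<omega>.\<close>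
  have w0: "0 \<le> \<omega>" 
  proof -
    obtain y where "y \<in> closed_segment p q" "norm (x - y) < \<delta>"
      using seg_dist2_cases[OF pq True \<delta>] ends_in_segment by metis
    then show ?thesis using near[of y] norm_ge_zero[of "F x - F y"] by linarith
  qed
  have i0: "0 \<le> (4 * \<omega> / \<delta>) * indicator {x. seg_dist2 p q x < \<delta>\<^sup>2} x"
    "0 \<le> 12 * C / \<delta>" using w0 \<delta> C0 by auto
  show ?thesis
  proof (rule seg_dist2_cases[OF pq True \<delta>])
    assume "norm (x - p) < \<delta>"
    then have "x \<in> ball p \<delta>" by (simp add: dist_norm norm_minus_commute)
    then have "(12 * C / \<delta>) * 1 \<le> (12 * C / \<delta>) * (indicator (ball p \<delta>) x + indicator (ball q \<delta>) x)"
      by (intro mult_left_mono i0) simp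
    then show ?thesis using nb i0 by linarith
  next
    assume "norm (x - q) < \<delta>"
    then have "x \<in> ball q \<delta>" by (simp add: dist_norm norm_minus_commute)
    then have "(12 * C / \<delta>) * 1 \<le> (12 * C / \<delta>) * (indicator (ball p \<delta>) x + indicator (ball q \<delta>) x)"
      by (intro mult_left_mono i0) simp
    then show ?thesis using nb i0 by linarith
  next
    fix y
    define n where "n = perp (sgn (q - p))"
    define a where "a = (x - p) \<bullet> n"
    assume y: "y \<in> closed_segment p q" "norm (x - y) < \<delta>"
      and g: "seg_dist2_grad p q x = (2 * ((x - p) \<bullet> perp (sgn (q - p)))) *\<^sub>R perp (sgn (q - p))"
      and a: "\<bar>(x - p) \<bullet> perp (sgn (q - p))\<bar> < \<delta>"
    have n1: "norm n = 1" using pq by (simp add: n_def perp_simps norm_sgn)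
    have "F y \<bullet> n = 0"
      using tan[OF y(1)] by (simp add: n_def sgn_div_norm perp_simps)
    then have "F x \<bullet> n = (F x - F y) \<bullet> n" by (simp add: inner_diff_left)
    then have "\<bar>F x \<bullet> n\<bar> \<le> norm (F x - F y) * norm n"
      by (metis Cauchy_Schwarz_ineq2)
    then have Fn: "\<bar>F x \<bullet> n\<bar> \<le> \<omega>" using near[OF y] n1 by simp
    define m where "m = max 0 (1 - seg_dist2 p q x / \<delta>\<^sup>2)"
    have m: "0 \<le> m" "m \<le> 1" using seg_dist2_nonneg[of p q x] by (auto simp: m_def)
    \<comment> \<open>The constant 4 is the product of the factor 2 from the derivative of the outer
      ramp and the factor 2 from that of the squared normal distance.\<close>
    have "F x \<bullet> cutoff_grad \<delta> p q x = (4 / \<delta>\<^sup>2) * (m * (a * (F x \<bullet> n)))"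
      unfolding cutoff_grad_def g n_def[symmetric] a_def m_def by simp
    then have "\<bar>F x \<bullet> cutoff_grad \<delta> p q x\<bar> = (4 / \<delta>\<^sup>2) * (m * (\<bar>a\<bar> * \<bar>F x \<bullet> n\<bar>))"
      using m(1) by (simp add: abs_mult)
    also have "\<dots> \<le> (4 / \<delta>\<^sup>2) * (1 * (\<delta> * \<omega>))"
      using a Fn m \<delta> unfolding a_def n_def
      by (intro mult_left_mono mult_mono) auto
    also have "\<dots> = (4 * \<omega> / \<delta>) * indicator {x. seg_dist2 p q x < \<delta>\<^sup>2} x"
      using True \<delta> by (simp add: power2_eq_square field_simps)
    also have "\<dots> \<le> \<dots> + (12 * C / \<delta>) * (indicator (ball p \<delta>) x + indicator (ball q \<delta>) x)"
    proof -
      have "0 \<le> (12 * C / \<delta>) * (indicat_real (ball p \<delta>) x + indicat_real (ball q \<delta>) x)"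
        by (intro mult_nonneg_nonneg i0(2) add_nonneg_nonneg indicator_pos_le)
      then show ?thesis by linarith
    qed
    finally show ?thesis .
  qed
qed

text \<open>The layer has area O(\<delta>) and the integrand beside the segment is at most 4
  \<omega> / \<delta>, which contributes O(\<omega>). The end discs have area O(\<delta>^2) against
  a bound of order 1 / \<delta>. Uniform continuity on the compact set \<open>T\<close> makes
  \<omega> arbitrarily small as \<delta> decreases.\<close>

lemma boundary_layer_integral_tendsto_0:
  fixes F :: "point \<Rightarrow> point"
  assumes pq: "p \<noteq> q" and S: "open S" "S \<subseteq> T" and T: "compact T" "closed_segment p q \<subseteq> T"
    and F: "continuous_on T F"
    and tan: "\<And>y. y \<in> closed_segment p q \<Longrightarrow> F y \<bullet> perp (q - p) = 0"
  shows "((\<lambda>\<delta>. LINT x:S|lborel. \<bar>F x \<bullet> cutoff_grad \<delta> p q x\<bar>) \<longlongrightarrow> 0) (at_right 0)"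
proof -
  have bS: "bounded S" using S(2) T(1) bounded_subset compact_imp_bounded by blast
  obtain C where C: "C > 0" "\<And>x. x \<in> T \<Longrightarrow> norm (F x) \<le> C"
    using compact_imp_bounded[OF compact_continuous_image[OF F T(1)]]
    unfolding bounded_pos by auto
  define A where "A = 16 * norm (q - p) + 32"
  have A: "A > 0" unfolding A_def by (smt (verit) norm_ge_zero)
  have integrable: "set_integrable lborel S (\<lambda>x. \<bar>F x \<bullet> cutoff_grad \<delta> p q x\<bar>)" if \<delta>: "\<delta> > 0" for \<delta>
  proof (rule set_integrable_bounded_continuous[OF S(1) bS, where C = "C * (12 / \<delta>)"])
    show "continuous_on S (\<lambda>x. \<bar>F x \<bullet> cutoff_grad \<delta> p q x\<bar>)"
      by (intro continuous_intros continuous_on_subset[OF F S(2)] continuous_on_cutoff_grad)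
    fix x assume "x \<in> S"
    then have "norm (F x) \<le> C" using C(2) S(2) by blast
    then have "norm (F x) * norm (cutoff_grad \<delta> p q x) \<le> C * (12 / \<delta>)"
      using C(1) by (intro mult_mono norm_cutoff_grad_le[OF pq \<delta>]) auto
    then show "norm \<bar>F x \<bullet> cutoff_grad \<delta> p q x\<bar> \<le> C * (12 / \<delta>)"
      using Cauchy_Schwarz_ineq2[of "F x" "cutoff_grad \<delta> p q x"] by simp
  qed
  have small: "\<exists>d>0. \<forall>\<delta>. 0 < \<delta> \<and> \<delta> < d \<longrightarrow>
      \<bar>LINT x:S|lborel. \<bar>F x \<bullet> cutoff_grad \<delta> p q x\<bar>\<bar> < \<eta>" if \<eta>: "\<eta> > 0" for \<eta>
  proof -
    \<comment> \<open>Chosen so that the layer contributes at most \<open>4 * \<omega> * A\<close>,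
      that is \<eta> / 4.\<close>
    define \<omega> where "\<omega> = \<eta> / (16 * A)"
    have \<omega>: "\<omega> > 0" using \<eta> A by (simp add: \<omega>_def)
    obtain e where e: "e > 0" "\<And>x y. x \<in> T \<Longrightarrow> y \<in> T \<Longrightarrow> dist y x < e \<Longrightarrow> dist (F y) (F x) < \<omega>"
      using compact_uniformly_continuous[OF F T(1)] \<omega> unfolding uniformly_continuous_on_def by metis
    \<comment> \<open>The bound 1 serves the area of the layer and \<open>e\<close> the modulus of
      continuity; the last term keeps the contribution 96 C \<delta> of the end discs below \<eta> /
      4.\<close>
    define d where "d = min 1 (min e (\<eta> / (400 * C)))"
    have d: "d > 0" using e \<eta> C by (simp add: d_def)
    show ?thesis
    proof (intro exI[of _ d] conjI d allI impI)
      fix \<delta> assume "0 < \<delta> \<and> \<delta> < d"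
      then have \<delta>: "0 < \<delta>" "\<delta> \<le> 1" "\<delta> < e" "\<delta> < \<eta> / (400 * C)" by (auto simp: d_def)
      define N where "N = {x. seg_dist2 p q x < \<delta>\<^sup>2}"
      define h where "h = (\<lambda>x. (4 * \<omega> / \<delta>) * indicator N x
        + (12 * C / \<delta>) * (indicator (ball p \<delta>) x + indicator (ball q \<delta>) x) :: real)"
      have fm: "N \<in> fmeasurable lborel" "ball p \<delta> \<in> fmeasurable lborel" "ball q \<delta> \<in> fmeasurable lborel"
        using measure_seg_layer_le[OF pq \<delta>(1,2)]
        by (auto simp: N_def fmeasurable_def bounded_ball emeasure_bounded_finite[unfolded infinity_ennreal_def])
      have ii: "integrable lborel (indicator N :: point \<Rightarrow> real)"
        "integrable lborel (indicator (ball p \<delta>) :: point \<Rightarrow> real)"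
        "integrable lborel (indicator (ball q \<delta>) :: point \<Rightarrow> real)"
        using fm by (auto simp: fmeasurable_def)
      have hint: "integrable lborel h" unfolding h_def using ii by auto
      have hI: "integral\<^sup>L lborel h = (4 * \<omega> / \<delta>) * measure lborel N
          + (12 * C / \<delta>) * (measure lborel (ball p \<delta>) + measure lborel (ball q \<delta>))"
        unfolding h_def using ii by simp
      have h0: "0 \<le> h x" for x using \<omega> \<delta>(1) C(1) by (simp add: h_def)
      have "\<bar>LINT x:S|lborel. \<bar>F x \<bullet> cutoff_grad \<delta> p q x\<bar>\<bar> = (LINT x:S|lborel. \<bar>F x \<bullet> cutoff_grad \<delta> p q x\<bar>)"
        unfolding set_lebesgue_integral_def by (intro abs_of_nonneg integral_nonneg_AE) auto
      also have "\<dots> \<le> integral\<^sup>L lborel h"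
        unfolding set_lebesgue_integral_def
      proof (rule integral_mono)
        show "integrable lborel (\<lambda>x. indicat_real S x *\<^sub>R \<bar>F x \<bullet> cutoff_grad \<delta> p q x\<bar>)"
          using integrable[OF \<delta>(1)] unfolding set_integrable_def .
        show "integrable lborel h" by (rule hint)
        fix x
        show "indicat_real S x *\<^sub>R \<bar>F x \<bullet> cutoff_grad \<delta> p q x\<bar> \<le> h x"
        proof (cases "x \<in> S")
          case True
          have "\<bar>F x \<bullet> cutoff_grad \<delta> p q x\<bar> \<le> h x"
            unfolding h_def N_def
          proof (rule boundary_layer_pointwise[OF pq \<delta>(1)])
            show "norm (F x) \<le> C" using C(2) True S(2) by blast
            fix y assume y: "y \<in> closed_segment p q"
            show "F y \<bullet> perp (q - p) = 0" by (rule tan[OF y])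
            assume "norm (x - y) < \<delta>"
            then have "dist x y < e" using \<delta>(3) by (simp add: dist_norm)
            moreover have "y \<in> T" "x \<in> T" using y T(2) True S(2) by auto
            ultimately have "dist (F x) (F y) < \<omega>" using e(2) by blast
            then show "norm (F x - F y) \<le> \<omega>" by (simp add: dist_norm)
          qed
          then show ?thesis using True by simp
        qed (use h0 in simp)
      qed
      also have "\<dots> \<le> (4 * \<omega> / \<delta>) * (A * \<delta>) + (12 * C / \<delta>) * (4 * \<delta>\<^sup>2 + 4 * \<delta>\<^sup>2)"
        unfolding hI N_def A_def using \<omega> \<delta>(1,2) C(1)
        by (intro add_mono mult_left_mono measure_seg_layer_le[OF pq] measure_ball_le) auto
      also have "\<dots> = 4 * \<omega> * A + 96 * C * \<delta>" using \<delta>(1) by (simp add: power2_eq_square)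
      also have "\<dots> = \<eta> / 4 + 96 * C * \<delta>" using A by (simp add: \<omega>_def)
      also have "\<dots> < \<eta>" using \<delta>(4) C(1) \<eta> by (simp add: field_simps)
      finally show "\<bar>LINT x:S|lborel. \<bar>F x \<bullet> cutoff_grad \<delta> p q x\<bar>\<bar> < \<eta>" .
    qed
  qed
  show ?thesis
    unfolding tendsto_iff eventually_at_right_field dist_real_def
  proof (intro allI impI)
    fix \<eta> :: real assume "\<eta> > 0"
    from small[OF this] obtain d where "d > 0" "\<forall>\<delta>. 0 < \<delta> \<and> \<delta> < d \<longrightarrow>
      \<bar>LINT x:S|lborel. \<bar>F x \<bullet> cutoff_grad \<delta> p q x\<bar>\<bar> < \<eta>" by blast
    then show "\<exists>b>0. \<forall>y>0. y < b \<longrightarrow> \<bar>(LINT x:S|lborel. \<bar>F x \<bullet> cutoff_grad y p q x\<bar>) - 0\<bar> < \<eta>"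
      by (intro exI[of _ d]) simp
  qed
qed

subsection \<open>The divergence theorem for tangential fields\<close>

lemma abs_component_le_norm:
  fixes v :: point
  shows abs_fst_le_norm: "\<bar>fst v\<bar> \<le> norm v" and abs_snd_le_norm: "\<bar>snd v\<bar> \<le> norm v"
  using norm_fst_le[of "fst v" "snd v"] norm_snd_le[of "snd v" "fst v"] by auto

lemma has_derivative_inner_slices:
  fixes f :: "point \<Rightarrow> real"
  assumes "(f has_derivative (\<lambda>h. h \<bullet> v)) (at x)"
  shows "((\<lambda>s. f (s, snd x)) has_real_derivative fst v) (at (fst x))"
    "((\<lambda>s. f (fst x, s)) has_real_derivative snd v) (at (snd x))"
proof -
  have 1: "((\<lambda>s. (s, snd x)) has_derivative (\<lambda>h. (h, 0))) (at (fst x))"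
    "((\<lambda>s. (fst x, s)) has_derivative (\<lambda>h. (0, h))) (at (snd x))"
    by (auto intro!: derivative_eq_intros)
  have 2: "(f has_derivative (\<lambda>h. h \<bullet> v)) (at (fst x, snd x))" using assms by simp
  from has_derivative_compose[OF 1(1) 2] has_derivative_compose[OF 1(2) 2]
  show "((\<lambda>s. f (s, snd x)) has_real_derivative fst v) (at (fst x))"
    "((\<lambda>s. f (fst x, s)) has_real_derivative snd v) (at (snd x))"
    by (simp_all add: has_field_derivative_def inner_prod_def)
      (simp_all add: mult_commute_abs)
qed

lemma eventually_slices_in_open:
  fixes x :: point
  assumes "open T" "x \<in> T"
  shows "\<forall>\<^sub>F s in nhds (fst x). (s, snd x) \<in> T" "\<forall>\<^sub>F s in nhds (snd x). (fst x, s) \<in> T"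
proof -
  have "isCont (\<lambda>s. (s, snd x)) (fst x)" "isCont (\<lambda>s. (fst x, s)) (snd x)"
    by (auto intro!: continuous_intros)
  then show "\<forall>\<^sub>F s in nhds (fst x). (s, snd x) \<in> T" "\<forall>\<^sub>F s in nhds (snd x). (fst x, s) \<in> T"
    using assms by (auto simp: continuous_within eventually_nhds_conv_at dest!: topological_tendstoD)
qed

lemma set_integral_sum:
  fixes f :: "'i \<Rightarrow> 'a \<Rightarrow> 'b::{banach, second_countable_topology}"
  assumes "\<And>i. i \<in> I \<Longrightarrow> set_integrable M A (f i)"
  shows "set_integrable M A (\<lambda>x. \<Sum>i\<in>I. f i x)"
    "(LINT x:A|M. \<Sum>i\<in>I. f i x) = (\<Sum>i\<in>I. LINT x:A|M. f i x)"
  using assms unfolding set_integrable_def set_lebesgue_integral_def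
  by (simp_all add: scaleR_sum_right)

lemma DERIV_transform_eventually:
  "(f has_real_derivative d) (at x) \<Longrightarrow> \<forall>\<^sub>F s in nhds x. f s = g s \<Longrightarrow> (g has_real_derivative d) (at x)"
  using DERIV_cong_ev[OF refl _ refl] by metis

text \<open>The field is cut off near the boundary. The cut-off field vanishes outside the domain, so that
  the integral of each of its partial derivatives is zero, and the gradient of the cut-off function,
  of size \<open>1 / \<delta>\<close> in a layer of area \<open>O(\<delta>)\<close>, is nearly orthogonal to the field.\<close>

lemma divergence_tangential_eq_0:
  fixes F :: "point \<Rightarrow> point" and f1 f2 :: "point \<Rightarrow> real"
  assumes R: "open R" "bounded R" and E: "segment_union E" "frontier R \<subseteq> E"
    and PQ: "finite PQ" "\<And>p q. (p, q) \<in> PQ \<Longrightarrow> p \<noteq> q" "frontier R = (\<Union>(p, q)\<in>PQ. closed_segment p q)"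
    and F: "continuous_on (closure R) F"
    and f1: "\<And>x. x \<in> R - E \<Longrightarrow> ((\<lambda>s. fst (F (s, snd x))) has_real_derivative f1 x) (at (fst x))"
    and f2: "\<And>x. x \<in> R - E \<Longrightarrow> ((\<lambda>s. snd (F (fst x, s))) has_real_derivative f2 x) (at (snd x))"
    and cf: "continuous_on (R - E) f1" "continuous_on (R - E) f2"
    and bf: "\<And>x. x \<in> R - E \<Longrightarrow> \<bar>f1 x\<bar> \<le> C" "\<And>x. x \<in> R - E \<Longrightarrow> \<bar>f2 x\<bar> \<le> C"
    and tan: "\<And>p q y. (p, q) \<in> PQ \<Longrightarrow> y \<in> closed_segment p q \<Longrightarrow> F y \<bullet> perp (q - p) = 0"
  shows "(LINT x:R - E|lborel. f1 x + f2 x) = 0"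
proof -
  define S where "S = R - E"
  have oS: "open S" unfolding S_def using R(1) segment_union_closed[OF E(1)] by (rule open_Diff)
  have bS: "bounded S" unfolding S_def using R(2) by (rule bounded_subset) auto
  have cR: "compact (closure R)" using R(2) by simp
  have SR: "S \<subseteq> closure R" unfolding S_def using closure_subset by blast
  obtain B where B: "B > 0" "\<And>x. x \<in> closure R \<Longrightarrow> norm x < B"
    using compact_imp_bounded[OF cR] unfolding bounded_pos_less by blast
  obtain CF where CF: "CF > 0" "\<And>x. x \<in> closure R \<Longrightarrow> norm (F x) \<le> CF"
    using compact_imp_bounded[OF compact_continuous_image[OF F cR]]
    unfolding bounded_pos by auto
  have seg_sub: "closed_segment (fst i) (snd i) \<subseteq> frontier R" if "i \<in> PQ" for i
    using UN_upper[OF that, of "\<lambda>(p, q). closed_segment p q"] unfolding PQ(3)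
    by (simp add: case_prod_beta)
  \<comment> \<open>The product vanishes on all boundary segments at once, corners and overlaps
    included, and stays continuously differentiable.\<close>
  define chi where "chi = (\<lambda>\<delta> x. \<Prod>(p, q)\<in>PQ. cutoff \<delta> p q x)"
  define dchi where "dchi = (\<lambda>\<delta> x. \<Sum>i\<in>PQ. (\<Prod>(p, q)\<in>PQ - {i}. cutoff \<delta> p q x) *\<^sub>R cutoff_grad \<delta> (fst i) (snd i) x)"
  have chi01: "0 \<le> chi \<delta> x" "chi \<delta> x \<le> 1" for \<delta> x
    unfolding chi_def by (auto intro!: prod_nonneg prod_le_1 simp: cutoff_bounds)
  have chi0: "chi \<delta> x = 0" if "x \<in> frontier R" for \<delta> x
  proof -
    from that obtain p q where pq: "(p, q) \<in> PQ" "x \<in> closed_segment p q" using PQ(3) by auto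
    then have "cutoff \<delta> p q x = 0" using cutoff_on_segment PQ(2) by blast
    then show ?thesis unfolding chi_def using pq(1) PQ(1)
      by (intro prod_zero) force+
  qed
  have chid: "(chi \<delta> has_derivative (\<lambda>h. h \<bullet> dchi \<delta> x)) (at x)" for \<delta> x
  proof -
    have "((\<lambda>x. \<Prod>i\<in>PQ. cutoff \<delta> (fst i) (snd i) x) has_derivative
      (\<lambda>h. \<Sum>i\<in>PQ. (h \<bullet> cutoff_grad \<delta> (fst i) (snd i) x) * (\<Prod>j\<in>PQ - {i}. cutoff \<delta> (fst j) (snd j) x))) (at x)"
      by (rule has_derivative_prod) (rule cutoff_has_derivative)
    then show ?thesis unfolding chi_def[abs_def] dchi_def
      by (simp add: case_prod_beta inner_sum_right mult.commute)
  qed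
  have cchi: "continuous_on A (chi \<delta>)" for A \<delta>
    by (rule continuous_at_imp_continuous_on) (use chid has_derivative_continuous in blast)
  have cdchi: "continuous_on A (dchi \<delta>)" for A \<delta>
  proof -
    have "continuous_on A (cutoff \<delta> p q)" for p q
      by (rule continuous_at_imp_continuous_on) (use cutoff_has_derivative has_derivative_continuous in blast)
    then show ?thesis unfolding dchi_def[abs_def] case_prod_beta
      by (intro continuous_intros continuous_on_cutoff_grad)
  qed
  have bdchi: "norm (dchi \<delta> x) \<le> real (card PQ) * (12 / \<delta>)" if "\<delta> > 0" for \<delta> x
  proof -
    have "norm (dchi \<delta> x) \<le> (\<Sum>i\<in>PQ. norm ((\<Prod>(p, q)\<in>PQ - {i}. cutoff \<delta> p q x) *\<^sub>R cutoff_grad \<delta> (fst i) (snd i) x))"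
      unfolding dchi_def by (rule norm_sum)
    also have "\<dots> \<le> (\<Sum>i\<in>PQ. 12 / \<delta>)"
    proof (rule sum_mono)
      fix i assume i: "i \<in> PQ"
      have "0 \<le> (\<Prod>(p, q)\<in>PQ - {i}. cutoff \<delta> p q x)" "(\<Prod>(p, q)\<in>PQ - {i}. cutoff \<delta> p q x) \<le> 1"
        by (auto intro!: prod_nonneg prod_le_1 simp: cutoff_bounds)
      moreover have "norm (cutoff_grad \<delta> (fst i) (snd i) x) \<le> 12 / \<delta>"
        using i PQ(2) that by (intro norm_cutoff_grad_le) auto
      ultimately have "\<bar>\<Prod>(p, q)\<in>PQ - {i}. cutoff \<delta> p q x\<bar> * norm (cutoff_grad \<delta> (fst i) (snd i) x) \<le> 1 * (12 / \<delta>)"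
        by (intro mult_mono) auto
      then show "norm ((\<Prod>(p, q)\<in>PQ - {i}. cutoff \<delta> p q x) *\<^sub>R cutoff_grad \<delta> (fst i) (snd i) x) \<le> 12 / \<delta>"
        by simp
    qed
    finally show ?thesis by simp
  qed
  \<comment> \<open>The components are treated separately, because only the two partial derivatives
    that enter the divergence are assumed to exist.\<close>
  have part: "(LINT x:S|lborel. chi \<delta> x * f1 x + fst (dchi \<delta> x) * fst (F x)) = 0
    \<and> (LINT x:S|lborel. chi \<delta> x * f2 x + snd (dchi \<delta> x) * snd (F x)) = 0"
    if \<delta>: "\<delta> > 0" for \<delta>
  proof -
    \<comment> \<open>Extension by zero is continuous across the frontier because \<open>chi\<close>
      vanishes there. A possible jump of the partial derivatives lies on \<open>frontier R\<close>,
      which is part of \<open>E\<close>.\<close>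
    define G where "G = (\<lambda>x. if x \<in> closure R then chi \<delta> x *\<^sub>R F x else 0)"
    define g1 where "g1 = (\<lambda>x. if x \<in> R then chi \<delta> x * f1 x + fst (dchi \<delta> x) * fst (F x) else 0)"
    define g2 where "g2 = (\<lambda>x. if x \<in> R then chi \<delta> x * f2 x + snd (dchi \<delta> x) * snd (F x) else 0)"
    have G: "continuous_on UNIV G"
    proof -
      have "continuous_on (closure R \<union> - R) G" unfolding G_def
      proof (rule continuous_on_cases)
        show "\<forall>x. x \<in> closure R \<and> x \<notin> closure R \<or> x \<in> - R \<and> x \<in> closure R \<longrightarrow> chi \<delta> x *\<^sub>R F x = 0"
          using chi0 R(1) by (auto simp: frontier_def interior_open)
      qed (use R(1) in \<open>auto intro!: continuous_intros cchi F\<close>)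
      moreover have "closure R \<union> - R = UNIV" using closure_subset by blast
      ultimately show ?thesis by simp
    qed
    have off: "x \<in> S \<or> x \<in> - closure R" if "x \<notin> E" for x
      using that E(2) R(1) unfolding S_def frontier_def by (auto simp: interior_open)
    have out: "x \<notin> R" "x \<notin> closure R" if "norm x \<ge> B" for x
      using B(2)[of x] that closure_subset[of R] by auto
    have opn: "open (- closure R)" by auto
    have d1: "((\<lambda>s. fst (G (s, snd x))) has_real_derivative g1 x) (at (fst x))"
      and d2: "((\<lambda>s. snd (G (fst x, s))) has_real_derivative g2 x) (at (snd x))" if x: "x \<notin> E" for x
      using off[OF x]
    proof (safe)
      assume xS: "x \<in> S"
      then have xR: "x \<in> R" by (simp add: S_def)
      note e = eventually_slices_in_open[OF R(1) xR]
      have "((\<lambda>s. chi \<delta> (s, snd x) * fst (F (s, snd x))) has_real_derivative g1 x) (at (fst x))"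
        using DERIV_mult[OF has_derivative_inner_slices(1)[OF chid[of \<delta> x]] f1[of x]] xS xR
        by (simp add: S_def g1_def algebra_simps)
      moreover have "\<forall>\<^sub>F s in nhds (fst x). chi \<delta> (s, snd x) * fst (F (s, snd x)) = fst (G (s, snd x))"
        using e(1) by eventually_elim (use closure_subset in \<open>auto simp: G_def\<close>)
      ultimately show "((\<lambda>s. fst (G (s, snd x))) has_real_derivative g1 x) (at (fst x))"
        by (rule DERIV_transform_eventually)
      have "((\<lambda>s. chi \<delta> (fst x, s) * snd (F (fst x, s))) has_real_derivative g2 x) (at (snd x))"
        using DERIV_mult[OF has_derivative_inner_slices(2)[OF chid[of \<delta> x]] f2[of x]] xS xR
        by (simp add: S_def g2_def algebra_simps)
      moreover have "\<forall>\<^sub>F s in nhds (snd x). chi \<delta> (fst x, s) * snd (F (fst x, s)) = snd (G (fst x, s))"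
        using e(2) by eventually_elim (use closure_subset in \<open>auto simp: G_def\<close>)
      ultimately show "((\<lambda>s. snd (G (fst x, s))) has_real_derivative g2 x) (at (snd x))"
        by (rule DERIV_transform_eventually)
    next
      assume "x \<notin> closure R"
      then have xR: "x \<in> - closure R" by simp
      note e = eventually_slices_in_open[OF opn xR]
      have g0: "g1 x = 0" "g2 x = 0" using xR closure_subset[of R] by (auto simp: g1_def g2_def)
      have "\<forall>\<^sub>F s in nhds (fst x). 0 = fst (G (s, snd x))"
        using e(1) by eventually_elim (auto simp: G_def)
      then show "((\<lambda>s. fst (G (s, snd x))) has_real_derivative g1 x) (at (fst x))"
        unfolding g0 by (rule DERIV_transform_eventually[OF DERIV_const])
      have "\<forall>\<^sub>F s in nhds (snd x). 0 = snd (G (fst x, s))"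
        using e(2) by eventually_elim (auto simp: G_def)
      then show "((\<lambda>s. snd (G (fst x, s))) has_real_derivative g2 x) (at (snd x))"
        unfolding g0 by (rule DERIV_transform_eventually[OF DERIV_const])
    qed
    have cg: "continuous_on (- E) g1" "continuous_on (- E) g2"
    proof -
      have "- E \<subseteq> S \<union> - closure R" using off by blast
      moreover have "continuous_on (S \<union> - closure R) g1"
      proof (rule continuous_on_open_Un[OF oS opn])
        show "continuous_on S g1"
          by (rule continuous_on_eq[where f = "\<lambda>x. chi \<delta> x * f1 x + fst (dchi \<delta> x) * fst (F x)"])
            (auto intro!: continuous_intros cchi cdchi cf continuous_on_subset[OF F SR[unfolded S_def]] simp: g1_def S_def)
        show "continuous_on (- closure R) g1"
          by (rule continuous_on_eq[where f = "\<lambda>x. 0"]) (use closure_subset in \<open>auto simp: g1_def\<close>)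
      qed
      moreover have "continuous_on (S \<union> - closure R) g2"
      proof (rule continuous_on_open_Un[OF oS opn])
        show "continuous_on S g2"
          by (rule continuous_on_eq[where f = "\<lambda>x. chi \<delta> x * f2 x + snd (dchi \<delta> x) * snd (F x)"])
            (auto intro!: continuous_intros cchi cdchi cf continuous_on_subset[OF F SR[unfolded S_def]] simp: g2_def S_def)
        show "continuous_on (- closure R) g2"
          by (rule continuous_on_eq[where f = "\<lambda>x. 0"]) (use closure_subset in \<open>auto simp: g2_def\<close>)
      qed
      ultimately show "continuous_on (- E) g1" "continuous_on (- E) g2"
        by (auto intro: continuous_on_subset)
    qed
    define C' where "C' = \<bar>C\<bar> + real (card PQ) * (12 / \<delta>) * CF"
    have C'0: "0 \<le> C'" using \<delta> CF(1) by (simp add: C'_def)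
    have bg0: "\<bar>chi \<delta> x * a + b * c\<bar> \<le> C'"
      if "\<bar>a\<bar> \<le> C" "\<bar>b\<bar> \<le> norm (dchi \<delta> x)" "\<bar>c\<bar> \<le> norm (F x)" "x \<in> closure R" for x a b c
    proof -
      have "\<bar>chi \<delta> x * a + b * c\<bar> \<le> \<bar>chi \<delta> x\<bar> * \<bar>a\<bar> + \<bar>b\<bar> * \<bar>c\<bar>"
        by (metis abs_mult abs_triangle_ineq)
      also have "\<dots> \<le> 1 * \<bar>C\<bar> + (real (card PQ) * (12 / \<delta>)) * CF"
        using that chi01 bdchi[OF \<delta>, of x] CF(2)[of x]
        by (intro add_mono mult_mono) (auto intro: order_trans)
      finally show ?thesis by (simp add: C'_def)
    qed
    have bg: "\<bar>g1 x\<bar> \<le> C'" "\<bar>g2 x\<bar> \<le> C'" if x: "x \<notin> E" for x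
    proof -
      consider "x \<in> R - E" "x \<in> closure R" | "x \<notin> R"
        using x closure_subset[of R] by auto
      then have "\<bar>g1 x\<bar> \<le> C' \<and> \<bar>g2 x\<bar> \<le> C'"
      proof cases
        case 1
        then show ?thesis
          using bg0[OF bf(1)[OF 1(1)] abs_fst_le_norm abs_fst_le_norm 1(2)] bg0[OF bf(2)[OF 1(1)] abs_snd_le_norm abs_snd_le_norm 1(2)]
          by (simp add: g1_def g2_def)
      next
        case 2
        then show ?thesis using C'0 by (simp add: g1_def g2_def)
      qed
      then show "\<bar>g1 x\<bar> \<le> C'" "\<bar>g2 x\<bar> \<le> C'" by auto
    qed
    have G12: "continuous_on UNIV (\<lambda>x. fst (G x))" "continuous_on UNIV (\<lambda>x. snd (G x))"
      using G by (auto intro: continuous_intros)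
    have "(LINT x:- E|lborel. g1 x) = 0"
      by (rule integral_partial_r_eq_0(2)[OF E(1) G12(1) _ _ d1 cg(1) bg(1)])
        (use out in \<open>auto simp: G_def g1_def\<close>)
    moreover have "(LINT x:- E|lborel. g2 x) = 0"
      by (rule integral_partial_z_eq_0(2)[OF E(1) G12(2) _ _ d2 cg(2) bg(2)])
        (use out in \<open>auto simp: G_def g2_def\<close>)
    moreover have "(LINT x:- E|lborel. g1 x) = (LINT x:S|lborel. chi \<delta> x * f1 x + fst (dchi \<delta> x) * fst (F x))"
      "(LINT x:- E|lborel. g2 x) = (LINT x:S|lborel. chi \<delta> x * f2 x + snd (dchi \<delta> x) * snd (F x))"
      unfolding set_lebesgue_integral_def g1_def g2_def S_def
      by (auto intro!: Bochner_Integration.integral_cong simp: indicator_def)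
    ultimately show ?thesis by simp
  qed
  have int1: "set_integrable lborel S (\<lambda>x. chi \<delta> x * f x)"
    if "continuous_on S f" "\<And>x. x \<in> S \<Longrightarrow> \<bar>f x\<bar> \<le> K" for f K \<delta>
  proof (rule set_integrable_bounded_continuous[OF oS bS, where C = K])
    show "continuous_on S (\<lambda>x. chi \<delta> x * f x)" by (intro continuous_intros cchi that)
    fix x assume "x \<in> S"
    then have "\<bar>chi \<delta> x\<bar> * \<bar>f x\<bar> \<le> 1 * K" using that(2) chi01 by (intro mult_mono) auto
    then show "norm (chi \<delta> x * f x) \<le> K" by (simp add: abs_mult)
  qed
  have int2: "set_integrable lborel S (\<lambda>x. \<bar>F x \<bullet> cutoff_grad \<delta> p q x\<bar>)"
    if "\<delta> > 0" "p \<noteq> q" for \<delta> p q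
  proof (rule set_integrable_bounded_continuous[OF oS bS, where C = "CF * (12 / \<delta>)"])
    show "continuous_on S (\<lambda>x. \<bar>F x \<bullet> cutoff_grad \<delta> p q x\<bar>)"
      by (intro continuous_intros continuous_on_subset[OF F SR] continuous_on_cutoff_grad)
    fix x assume "x \<in> S"
    then have "norm (F x) \<le> CF" using CF(2) SR by blast
    then have "norm (F x) * norm (cutoff_grad \<delta> p q x) \<le> CF * (12 / \<delta>)"
      using CF(1) by (intro mult_mono norm_cutoff_grad_le that) auto
    then show "norm \<bar>F x \<bullet> cutoff_grad \<delta> p q x\<bar> \<le> CF * (12 / \<delta>)"
      using Cauchy_Schwarz_ineq2[of "F x" "cutoff_grad \<delta> p q x"] by simp
  qed
  have int3: "set_integrable lborel S (\<lambda>x. a (dchi \<delta> x) * a (F x))"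
    if "\<delta> > 0" "a = fst \<or> a = snd" for \<delta> and a :: "point \<Rightarrow> real"
  proof (rule set_integrable_bounded_continuous[OF oS bS, where C = "real (card PQ) * (12 / \<delta>) * CF"])
    show "continuous_on S (\<lambda>x. a (dchi \<delta> x) * a (F x))"
      using that(2) by (auto intro!: continuous_intros cdchi continuous_on_subset[OF F SR])
    fix x assume "x \<in> S"
    have *: "\<bar>a v\<bar> \<le> norm v" for v
      using that(2) norm_fst_le[of "fst v" "snd v"] norm_snd_le[of "snd v" "fst v"] by auto
    have "\<bar>a (dchi \<delta> x)\<bar> * \<bar>a (F x)\<bar> \<le> (real (card PQ) * (12 / \<delta>)) * CF"
      using order_trans[OF * bdchi[OF that(1), of x]] order_trans[OF * CF(2), of x] \<open>x \<in> S\<close> SR CF(1) that(1)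
      by (intro mult_mono) auto
    then show "norm (a (dchi \<delta> x) * a (F x)) \<le> real (card PQ) * (12 / \<delta>) * CF"
      by (simp add: abs_mult)
  qed
  have bsum: "\<bar>f1 x + f2 x\<bar> \<le> 2 * C" if "x \<in> S" for x
    using bf[of x] that by (auto simp: S_def)
  have cS: "continuous_on S f1" "continuous_on S f2" using cf by (auto simp: S_def)
  have bS12: "\<bar>f1 x\<bar> \<le> C" "\<bar>f2 x\<bar> \<le> C" if "x \<in> S" for x using bf that by (auto simp: S_def)
  \<comment> \<open>By \<open>part\<close> this equals minus the integral of
    \<open>F x \<bullet> dchi \<delta> x\<close>, which the boundary layer estimate
    controls.\<close>
  define I where "I = (\<lambda>\<delta>. LINT x:S|lborel. chi \<delta> x * (f1 x + f2 x))"
  have Ile: "\<bar>I \<delta>\<bar> \<le> (\<Sum>i\<in>PQ. LINT x:S|lborel. \<bar>F x \<bullet> cutoff_grad \<delta> (fst i) (snd i) x\<bar>)" if \<delta>: "\<delta> > 0" for \<delta>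
  proof -
    have i1: "set_integrable lborel S (\<lambda>x. chi \<delta> x * f1 x)" by (rule int1[OF cS(1) bS12(1)])
    have i2: "set_integrable lborel S (\<lambda>x. chi \<delta> x * f2 x)" by (rule int1[OF cS(2) bS12(2)])
    have i3: "set_integrable lborel S (\<lambda>x. fst (dchi \<delta> x) * fst (F x))" by (rule int3[OF \<delta>]) simp
    have i4: "set_integrable lborel S (\<lambda>x. snd (dchi \<delta> x) * snd (F x))" by (rule int3[OF \<delta>]) simp
    have i34: "set_integrable lborel S (\<lambda>x. F x \<bullet> dchi \<delta> x)"
      using set_integral_add(1)[OF i3 i4] by (simp add: inner_prod_def mult.commute)
    have "I \<delta> = (LINT x:S|lborel. chi \<delta> x * f1 x) + (LINT x:S|lborel. chi \<delta> x * f2 x)"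
      unfolding I_def using set_integral_add(2)[OF i1 i2] by (simp add: distrib_left)
    moreover have "(LINT x:S|lborel. F x \<bullet> dchi \<delta> x)
        = (LINT x:S|lborel. fst (dchi \<delta> x) * fst (F x)) + (LINT x:S|lborel. snd (dchi \<delta> x) * snd (F x))"
      using set_integral_add(2)[OF i3 i4] by (simp add: inner_prod_def mult.commute)
    ultimately have "I \<delta> = - (LINT x:S|lborel. F x \<bullet> dchi \<delta> x)"
      using part[OF \<delta>] set_integral_add(2)[OF i1 i3] set_integral_add(2)[OF i2 i4] by simp
    then have "\<bar>I \<delta>\<bar> \<le> (LINT x:S|lborel. \<bar>F x \<bullet> dchi \<delta> x\<bar>)"
      using set_integral_norm_bound[OF i34] by simp
    also have "\<dots> \<le> (LINT x:S|lborel. \<Sum>i\<in>PQ. \<bar>F x \<bullet> cutoff_grad \<delta> (fst i) (snd i) x\<bar>)"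
    proof (rule set_integral_mono)
      show "set_integrable lborel S (\<lambda>x. \<bar>F x \<bullet> dchi \<delta> x\<bar>)" using set_integrable_abs[OF i34] .
      show "set_integrable lborel S (\<lambda>x. \<Sum>i\<in>PQ. \<bar>F x \<bullet> cutoff_grad \<delta> (fst i) (snd i) x\<bar>)"
        using PQ by (intro set_integral_sum(1) int2[OF \<delta>]) auto
      fix x
      have "\<bar>F x \<bullet> dchi \<delta> x\<bar> \<le> (\<Sum>i\<in>PQ. \<bar>(\<Prod>(p, q)\<in>PQ - {i}. cutoff \<delta> p q x) * (F x \<bullet> cutoff_grad \<delta> (fst i) (snd i) x)\<bar>)"
        unfolding dchi_def inner_sum_right inner_scaleR_right by (rule sum_abs)
      also have "\<dots> \<le> (\<Sum>i\<in>PQ. 1 * \<bar>F x \<bullet> cutoff_grad \<delta> (fst i) (snd i) x\<bar>)"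
      \<comment> \<open>The remaining cut-off factors lie between 0 and 1 and are dropped, which
        leaves one boundary layer per segment.\<close>
      proof (rule sum_mono)
        fix i assume i: "i \<in> PQ"
        have "0 \<le> (\<Prod>(p, q)\<in>PQ - {i}. cutoff \<delta> p q x)" "(\<Prod>(p, q)\<in>PQ - {i}. cutoff \<delta> p q x) \<le> 1"
          by (auto intro!: prod_nonneg prod_le_1 simp: cutoff_bounds)
        then show "\<bar>(\<Prod>(p, q)\<in>PQ - {i}. cutoff \<delta> p q x) * (F x \<bullet> cutoff_grad \<delta> (fst i) (snd i) x)\<bar>
          \<le> 1 * \<bar>F x \<bullet> cutoff_grad \<delta> (fst i) (snd i) x\<bar>"
          unfolding abs_mult by (intro mult_right_mono) auto
      qed
      finally show "\<bar>F x \<bullet> dchi \<delta> x\<bar> \<le> (\<Sum>i\<in>PQ. \<bar>F x \<bullet> cutoff_grad \<delta> (fst i) (snd i) x\<bar>)" by simp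
    qed
    also have "\<dots> = (\<Sum>i\<in>PQ. LINT x:S|lborel. \<bar>F x \<bullet> cutoff_grad \<delta> (fst i) (snd i) x\<bar>)"
      using PQ by (intro set_integral_sum(2) int2[OF \<delta>]) auto
    finally show ?thesis .
  qed
  have I0: "(I \<longlongrightarrow> 0) (at_right 0)"
  proof (rule Lim_null_comparison)
    show "\<forall>\<^sub>F \<delta> in at_right 0. norm (I \<delta>) \<le> (\<Sum>i\<in>PQ. LINT x:S|lborel. \<bar>F x \<bullet> cutoff_grad \<delta> (fst i) (snd i) x\<bar>)"
      using eventually_at_right_less[of "0::real"] by eventually_elim (use Ile in simp)
    have "((\<lambda>\<delta>. LINT x:S|lborel. \<bar>F x \<bullet> cutoff_grad \<delta> (fst i) (snd i) x\<bar>) \<longlongrightarrow> 0) (at_right 0)" if "i \<in> PQ" for i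
    proof (rule boundary_layer_integral_tendsto_0[OF _ oS SR cR _ F])
      show "fst i \<noteq> snd i" using PQ(2)[of "fst i" "snd i"] that by simp
      show "closed_segment (fst i) (snd i) \<subseteq> closure R"
      proof -
        show ?thesis using seg_sub[OF that] by (auto simp: frontier_def)
      qed
      show "F y \<bullet> perp (snd i - fst i) = 0" if "y \<in> closed_segment (fst i) (snd i)" for y
        using tan[of "fst i" "snd i" y] that \<open>i \<in> PQ\<close> by simp
    qed
    then show "((\<lambda>\<delta>. \<Sum>i\<in>PQ. LINT x:S|lborel. \<bar>F x \<bullet> cutoff_grad \<delta> (fst i) (snd i) x\<bar>) \<longlongrightarrow> 0) (at_right 0)"
      by (intro tendsto_null_sum) auto
  qed
  \<comment> \<open>Dominated convergence is applied along a sequence, hence the restriction of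
    \<delta> to 1, 1/2, 1/3 and so on.\<close>
  define dl where "dl = (\<lambda>n. inverse (real (Suc n)))"
  have dl: "filterlim dl (at_right 0) sequentially"
    unfolding filterlim_at dl_def using LIMSEQ_inverse_real_of_nat by auto
  have I1: "(\<lambda>n. I (dl n)) \<longlonglongrightarrow> (LINT x:S|lborel. f1 x + f2 x)"
    unfolding I_def set_lebesgue_integral_def
  proof (rule integral_dominated_convergence)
    have "set_integrable lborel S (\<lambda>x. 2 * C)"
      by (rule set_integrable_bounded_continuous[OF oS bS, where C = "\<bar>2 * C\<bar>"]) auto
    then show "integrable lborel (\<lambda>x. indicator S x *\<^sub>R (2 * C))" unfolding set_integrable_def .
    have c12: "continuous_on S (\<lambda>x. f1 x + f2 x)" by (intro continuous_intros cS)
    show "(\<lambda>x. indicat_real S x *\<^sub>R (f1 x + f2 x)) \<in> borel_measurable lborel"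
      using borel_measurable_continuous_on_indicator[OF _ c12] oS by simp
    show "(\<lambda>x. indicat_real S x *\<^sub>R (chi (dl n) x * (f1 x + f2 x))) \<in> borel_measurable lborel" for n
      using borel_measurable_continuous_on_indicator[OF _ continuous_on_mult[OF cchi c12]] oS by simp
    show "AE x in lborel. (\<lambda>n. indicat_real S x *\<^sub>R (chi (dl n) x * (f1 x + f2 x)))
        \<longlonglongrightarrow> indicat_real S x *\<^sub>R (f1 x + f2 x)"
    proof (rule AE_I2)
      fix x
      show "(\<lambda>n. indicat_real S x *\<^sub>R (chi (dl n) x * (f1 x + f2 x)))
        \<longlonglongrightarrow> indicat_real S x *\<^sub>R (f1 x + f2 x)"
      proof (cases "x \<in> S")
        case True
        have "((\<lambda>\<delta>. chi \<delta> x) \<longlongrightarrow> (\<Prod>(p, q)\<in>PQ. 1)) (at_right 0)"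
          unfolding chi_def case_prod_beta
        proof (rule tendsto_prod)
          fix i assume i: "i \<in> PQ"
          have "x \<notin> frontier R" using True E(2) by (auto simp: S_def)
          then have "x \<notin> closed_segment (fst i) (snd i)" using seg_sub[OF i] by blast
          then show "((\<lambda>\<delta>. cutoff \<delta> (fst i) (snd i) x) \<longlongrightarrow> 1) (at_right 0)"
            using PQ(2)[of "fst i" "snd i"] i by (intro cutoff_tendsto_1) auto
        qed
        then have "(\<lambda>n. chi (dl n) x) \<longlonglongrightarrow> 1"
          using filterlim_compose[OF _ dl] by fastforce
        then have "(\<lambda>n. chi (dl n) x * (f1 x + f2 x)) \<longlonglongrightarrow> 1 * (f1 x + f2 x)"
          by (intro tendsto_mult tendsto_const)
        then show ?thesis using True by simp
      qed simp
    qed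
    show "AE x in lborel. norm (indicat_real S x *\<^sub>R (chi (dl n) x * (f1 x + f2 x))) \<le> indicat_real S x *\<^sub>R (2 * C)" for n
    proof (rule AE_I2)
      fix x
      show "norm (indicat_real S x *\<^sub>R (chi (dl n) x * (f1 x + f2 x))) \<le> indicat_real S x *\<^sub>R (2 * C)"
      proof (cases "x \<in> S")
        case True
        have "\<bar>chi (dl n) x\<bar> * \<bar>f1 x + f2 x\<bar> \<le> 1 * (2 * C)"
          using bsum[OF True] chi01 by (intro mult_mono) auto
        then show ?thesis using True by (simp add: abs_mult)
      qed simp
    qed
  qed
  have "(\<lambda>n. I (dl n)) \<longlonglongrightarrow> 0"
    by (rule filterlim_compose[OF I0 dl])
  then show ?thesis
    using LIMSEQ_unique[OF I1] by (simp add: S_def)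
qed

subsection \<open>Boundary normals and finite element functions\<close>

text \<open>A segment has no isolated points, so a continuous function that is nonzero at
  \<open>x\<close> would be nonzero at infinitely many points of it. This carries the tangency
  condition to corners, where no outer normal exists.\<close>

lemma segment_continuous_zero_off_finite:
  fixes h :: "point \<Rightarrow> real"
  assumes "p \<noteq> q" "continuous_on (closed_segment p q) h" "finite B"
    and 0: "\<And>y. y \<in> closed_segment p q - B \<Longrightarrow> h y = 0"
    and x: "x \<in> closed_segment p q"
  shows "h x = 0"
proof (rule ccontr)
  assume "h x \<noteq> 0"
  then have "\<forall>\<^sub>F y in at x within closed_segment p q. h y \<noteq> 0"
    using assms(2) x by (auto simp: continuous_on_def intro: tendsto_imp_eventually_ne)
  then obtain U where U: "open U" "x \<in> U" "\<And>y. y \<in> U \<Longrightarrow> y \<noteq> x \<Longrightarrow> y \<in> closed_segment p q \<Longrightarrow> h y \<noteq> 0"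
    unfolding eventually_at_topological by auto
  have "U \<inter> closed_segment p q \<subseteq> insert x B" using U(3) 0 by blast
  then have fin: "finite (U \<inter> closed_segment p q)"
    using assms(3) finite_subset by blast
  have "closed_segment p q \<noteq> {x}"
    using assms(1) ends_in_segment by (metis singletonD)
  then have "x islimpt closed_segment p q"
    using x connected_segment(1)[of p q] by (intro connected_imp_perfect) auto
  then show False
    using fin U(1,2) unfolding islimpt_eq_acc_point by blast
qed

lemma closed_segment_param:
  assumes "y \<in> closed_segment p q"
  obtains t where "0 \<le> t" "t \<le> 1" "y = p + t *\<^sub>R (q - p)"
proof -
  obtain t where "0 \<le> t" "t \<le> 1" "y = (1 - t) *\<^sub>R p + t *\<^sub>R q"
    using assms unfolding in_segment by blast
  then show ?thesis by (intro that[of t]) (simp_all add: algebra_simps)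
qed

text \<open>The difference of two common points is a multiple of both directions, hence 0 when these
  are not parallel.\<close>

lemma nonparallel_segments_finite_inter:
  fixes p q p' q' :: point
  assumes "(q' - p') \<bullet> perp (q - p) \<noteq> 0"
  shows "finite (closed_segment p' q' \<inter> closed_segment p q)"
proof -
  have "w = v" if "w \<in> closed_segment p' q' \<inter> closed_segment p q" "v \<in> closed_segment p' q' \<inter> closed_segment p q" for w v
  proof -
    from that obtain s t s' t' where
      w: "w = p' + s *\<^sub>R (q' - p')" "w = p + t *\<^sub>R (q - p)"
      and v: "v = p' + s' *\<^sub>R (q' - p')" "v = p + t' *\<^sub>R (q - p)"
      using closed_segment_param by (metis IntD1 IntD2)
    have "(w - v) = (s - s') *\<^sub>R (q' - p')" by (simp add: w(1) v(1) scaleR_left_diff_distrib)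
    moreover have "(w - v) = (t - t') *\<^sub>R (q - p)" by (simp add: w(2) v(2) scaleR_left_diff_distrib)
    then have "(w - v) \<bullet> perp (q - p) = 0" by (simp add: perp_simps)
    ultimately have "(s - s') * ((q' - p') \<bullet> perp (q - p)) = 0" by simp
    then have "s = s'" using assms by simp
    then show "w = v" by (simp add: w v)
  qed
  then have "\<exists>w. closed_segment p' q' \<inter> closed_segment p q \<subseteq> {w}" by blast
  then show ?thesis using finite_subset by blast
qed

text \<open>Near a point off \<open>B\<close> the frontier is exactly a piece of the line through
  \<open>p\<close> and \<open>q\<close>. The two open half discs beside it are connected and miss
  the frontier, so each lies inside \<open>R\<close> or outside. Both inside would make the point
  interior to \<open>closure R\<close>, hence a point of \<open>R\<close>; both outside would remove
  it from \<open>closure R\<close>. So exactly one is inside, and it determines the sign of the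
  normal.\<close>

lemma outer_normal_boundary_segment:
  assumes R: "open R" "interior (closure R) = R"
    and PQ: "finite PQ" "\<And>p q. (p, q) \<in> PQ \<Longrightarrow> p \<noteq> q" "frontier R = (\<Union>(p, q)\<in>PQ. closed_segment p q)"
    and pq: "(p, q) \<in> PQ"
  obtains B where "finite B" "\<And>y. y \<in> closed_segment p q - B \<Longrightarrow>
      outer_normal R y (perp (sgn (q - p))) \<or> outer_normal R y (- perp (sgn (q - p)))"
proof -
  define u where "u = sgn (q - p)"
  define n where "n = perp u"
  define L where "L = norm (q - p)"
  have p_q: "p \<noteq> q" using PQ(2) pq by blast
  have L: "L > 0" using p_q by (simp add: L_def)
  have u1: "norm u = 1" and n1: "norm n = 1"
    using p_q by (simp_all add: u_def n_def perp_simps norm_sgn)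
  have uu: "u \<bullet> u = 1" using u1 by (simp add: norm_eq_1)
  have qp: "q - p = L *\<^sub>R u" using p_q by (simp add: u_def L_def sgn_div_norm)
  \<comment> \<open>Excluded are the end points of all boundary segments and the crossings with
    segments of another direction. A parallel segment through a remaining point lies on the same
    line.\<close>
  define B where "B = (\<Union>i\<in>PQ. {fst i, snd i}) \<union>
    (\<Union>i\<in>{i \<in> PQ. (snd i - fst i) \<bullet> perp (q - p) \<noteq> 0}. closed_segment (fst i) (snd i) \<inter> closed_segment p q)"
  have "finite B"
  proof -
    have "finite (\<Union>i\<in>{i \<in> PQ. (snd i - fst i) \<bullet> perp (q - p) \<noteq> 0}. closed_segment (fst i) (snd i) \<inter> closed_segment p q)"
      using PQ(1) by (intro finite_UN_I finite_Collect_conjI nonparallel_segments_finite_inter) (simp_all add: Collect_mem_eq)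
    then show ?thesis unfolding B_def using PQ(1) by blast
  qed
  moreover have "outer_normal R y n \<or> outer_normal R y (- n)" if y: "y \<in> closed_segment p q - B" for y
  proof -
    have seg_sub: "closed_segment (fst i) (snd i) \<subseteq> frontier R" if "i \<in> PQ" for i
      using UN_upper[OF that, of "\<lambda>(p, q). closed_segment p q"] unfolding PQ(3)
      by (simp add: case_prod_beta)
    have yf: "y \<in> frontier R" using seg_sub[OF pq] y by auto
    have yR: "y \<notin> R" "y \<in> closure R" using yf R(1) by (auto simp: frontier_def interior_open)
    \<comment> \<open>A boundary segment either keeps a positive distance from \<open>y\<close> or
      contains \<open>y\<close>; in the second case it is parallel to \<open>q - p\<close>, as
      \<open>y\<close> is not in \<open>B\<close>.\<close>
    have line: "\<forall>\<^sub>F w in nhds y. w \<in> closed_segment (fst i) (snd i) \<longrightarrow> (w - y) \<bullet> n = 0" if i: "i \<in> PQ" for i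
    proof (cases "y \<in> closed_segment (fst i) (snd i)")
      case False
      have "open (- closed_segment (fst i) (snd i))" by (simp add: open_Compl)
      then have "\<forall>\<^sub>F w in nhds y. w \<in> - closed_segment (fst i) (snd i)"
        using False by (intro eventually_nhds_in_open) auto
      then show ?thesis by eventually_elim simp
    next
      case True
      then have "(snd i - fst i) \<bullet> perp (q - p) = 0" using i y unfolding B_def by blast
      then have par: "(snd i - fst i) \<bullet> n = 0" using L by (simp add: qp n_def perp_simps)
      obtain t where t: "y = fst i + t *\<^sub>R (snd i - fst i)"
        using closed_segment_param[OF True] by blast
      have "(w - y) \<bullet> n = 0" if w: "w \<in> closed_segment (fst i) (snd i)" for w
      proof -
        obtain s where s: "w = fst i + s *\<^sub>R (snd i - fst i)"
          using closed_segment_param[OF w] by blast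
        have "w - y = (s - t) *\<^sub>R (snd i - fst i)" by (simp add: s t scaleR_left_diff_distrib)
        then show ?thesis using par by simp
      qed
      then show ?thesis by (intro always_eventually) auto
    qed
    have "\<forall>\<^sub>F w in nhds y. \<forall>i\<in>PQ. w \<in> closed_segment (fst i) (snd i) \<longrightarrow> (w - y) \<bullet> n = 0"
      by (rule eventually_ball_finite[OF PQ(1)]) (use line in blast)
    then obtain e1 where e1: "e1 > 0"
      "\<And>w i. dist w y < e1 \<Longrightarrow> i \<in> PQ \<Longrightarrow> w \<in> closed_segment (fst i) (snd i) \<Longrightarrow> (w - y) \<bullet> n = 0"
      unfolding eventually_nhds_metric by blast
    obtain t where t: "0 \<le> t" "t \<le> L" "y = p + t *\<^sub>R u"
      using y unfolding u_def L_def seg_param[OF p_q] Diff_iff by blast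
    have "y \<noteq> p" "y \<noteq> q" using y pq unfolding B_def by force+
    then have "t \<noteq> 0" "t \<noteq> L" using t qp by (auto simp: algebra_simps)
    then have t': "0 < t" "t < L" using t by auto
    \<comment> \<open>Within this radius all boundary segments stay on the line through
      \<open>y\<close>, and points of that line stay between \<open>p\<close> and
      \<open>q\<close>.\<close>
    define e where "e = min e1 (min t (L - t))"
    have e: "e > 0" using e1(1) t' by (simp add: e_def)
    have fr: "w \<in> frontier R \<longleftrightarrow> (w - y) \<bullet> n = 0" if w: "w \<in> ball y e" for w
    proof
      assume "w \<in> frontier R"
      then obtain i where "i \<in> PQ" "w \<in> closed_segment (fst i) (snd i)" unfolding PQ(3) by auto
      then show "(w - y) \<bullet> n = 0" using e1(2)[of w i] w by (simp add: e_def dist_commute)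
    next
      assume 0: "(w - y) \<bullet> n = 0"
      define s where "s = (w - y) \<bullet> u"
      have "w - y = s *\<^sub>R u"
        using orthonormal_decomposition[OF u1, of "w - y"] 0 unfolding s_def n_def by simp
      then have ww: "w = p + (t + s) *\<^sub>R u" using t(3) by (simp add: algebra_simps)
      have "\<bar>s\<bar> \<le> norm (w - y)" unfolding s_def using Cauchy_Schwarz_ineq2[of "w - y" u] u1 by simp
      then have "\<bar>s\<bar> < e" using w by (simp add: dist_norm norm_minus_commute)
      then have "0 \<le> t + s" "t + s \<le> L" by (auto simp: e_def)
      then have "w \<in> closed_segment p q"
        unfolding seg_param[OF p_q] u_def[symmetric] L_def[symmetric] using ww by blast
      then show "w \<in> frontier R" using seg_sub[OF pq] by auto
    qed
    define H where "H = (\<lambda>c::real. ball y e \<inter> {w. (c *\<^sub>R n) \<bullet> w > (c *\<^sub>R n) \<bullet> y})"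
    have side: "H c \<subseteq> R \<or> H c \<inter> R = {}" if "c \<noteq> 0" for c
    proof (rule ccontr)
      assume neg: "\<not> (H c \<subseteq> R \<or> H c \<inter> R = {})"
      have "connected (H c)" unfolding H_def
        by (intro convex_connected convex_Int convex_ball convex_halfspace_gt)
      then have "H c \<inter> frontier R \<noteq> {}" using neg by (intro connected_Int_frontier) auto
      then obtain w where w: "w \<in> ball y e" "(c *\<^sub>R n) \<bullet> w > (c *\<^sub>R n) \<bullet> y" "w \<in> frontier R"
        unfolding H_def by blast
      have "(w - y) \<bullet> n = 0" using fr w(1,3) by blast
      then have "w \<bullet> n = y \<bullet> n" by (simp add: inner_diff_left)
      then have "n \<bullet> w = n \<bullet> y" by (simp only: inner_commute)
      then show False using w(2) by simp
    qed
    have Hp: "w \<in> H 1 \<longleftrightarrow> (w - y) \<bullet> n > 0" and Hm: "w \<in> H (- 1) \<longleftrightarrow> (w - y) \<bullet> n < 0" if "w \<in> ball y e" for w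
      using that by (auto simp: H_def inner_diff_left inner_commute[of n])
    have nR: "w \<notin> R" if "w \<in> ball y e" "(w - y) \<bullet> n = 0" for w
      using fr[OF that(1)] that(2) R(1) by (auto simp: frontier_def interior_open)
    consider "H 1 \<subseteq> R" "H (-1) \<subseteq> R" | "H 1 \<inter> R = {}" "H (-1) \<inter> R = {}"
      | "H 1 \<subseteq> R" "H (-1) \<inter> R = {}" | "H 1 \<inter> R = {}" "H (-1) \<subseteq> R"
      using side[of 1] side[of "-1"] by auto
    then show ?thesis
    proof cases
      case 1
      have "ball y e \<subseteq> closure R"
      proof
        fix w assume w: "w \<in> ball y e"
        consider "(w - y) \<bullet> n > 0" | "(w - y) \<bullet> n < 0" | "(w - y) \<bullet> n = 0" by linarith
        then show "w \<in> closure R"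
        proof cases
          case 3
          then have "w \<in> frontier R" using fr[OF w] by blast
          then show ?thesis by (simp add: frontier_def)
        qed (use 1 Hp[OF w] Hm[OF w] closure_subset[of R] in blast)+
      qed
      then have "y \<in> interior (closure R)" using e by (meson centre_in_ball interiorI open_ball)
      then show ?thesis using R(2) yR(1) by simp
    next
      case 2
      have "ball y e \<inter> R = {}"
      proof (rule ccontr)
        assume "ball y e \<inter> R \<noteq> {}"
        then obtain w where w: "w \<in> ball y e" "w \<in> R" by blast
        consider "(w - y) \<bullet> n > 0" | "(w - y) \<bullet> n < 0" | "(w - y) \<bullet> n = 0" by linarith
        then show False
          using 2 Hp[OF w(1)] Hm[OF w(1)] nR[OF w(1)] w(2) by cases blast+
      qed
      then have "y \<notin> closure R"
        using e by (meson centre_in_ball disjoint_iff open_Int_closure_eq_empty open_ball)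
      then show ?thesis using yR(2) by simp
    next
      case 3
      have "\<forall>w\<in>ball y e. w \<in> R \<longleftrightarrow> (w - y) \<bullet> (- n) < 0"
      proof
        fix w assume w: "w \<in> ball y e"
        show "w \<in> R \<longleftrightarrow> (w - y) \<bullet> (- n) < 0"
          using 3 Hp[OF w] Hm[OF w] nR[OF w] by (cases "(w - y) \<bullet> n" "0::real" rule: linorder_cases) auto
      qed
      then have "outer_normal R y (- n)" unfolding outer_normal_def using e n1 by auto
      then show ?thesis by blast
    next
      case 4
      have "\<forall>w\<in>ball y e. w \<in> R \<longleftrightarrow> (w - y) \<bullet> n < 0"
      proof
        fix w assume w: "w \<in> ball y e"
        show "w \<in> R \<longleftrightarrow> (w - y) \<bullet> n < 0"
          using 4 Hp[OF w] Hm[OF w] nR[OF w] by (cases "(w - y) \<bullet> n" "0::real" rule: linorder_cases) auto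
      qed
      then have "outer_normal R y n" unfolding outer_normal_def using e n1 by auto
      then show ?thesis by blast
    qed
  qed
  ultimately show ?thesis using that unfolding n_def u_def by blast
qed

section \<open>Finite element functions on the open elements\<close>

lemma segment_union_frontier_simplex:
  fixes K :: "point set"
  assumes "2 simplex K"
  shows "segment_union (frontier K)"
proof -
  obtain C where C: "\<not> affine_dependent C" "card C = 3" "K = convex hull C"
    using assms unfolding simplex_def by force
  then obtain a b c where abc: "C = {a, b, c}" "a \<noteq> b" "a \<noteq> c" "b \<noteq> c"
    unfolding card_3_iff by blast
  have "frontier K = closed_segment a b \<union> closed_segment b c \<union> closed_segment c a"
    unfolding C(3) abc(1) by (rule frontier_of_triangle) simp
  then show ?thesis using abc by (simp add: segment_union_Un segment_union_segment)
qed

lemma mesh_skeleton: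
  assumes "regular_partition R \<T>" "segment_union (frontier R)"
  defines "E \<equiv> frontier R \<union> (\<Union>K\<in>\<T>. frontier K)"
  shows "segment_union E" "\<And>x. x \<in> R - E \<Longrightarrow> \<exists>K\<in>\<T>. x \<in> interior K"
proof -
  have fin: "finite \<T>" using assms(1) by (simp add: regular_partition_def triangulation_def)
  show "segment_union E" unfolding E_def
    using assms(1)
    by (intro segment_union_Un[OF assms(2) segment_union_UN[OF fin]] segment_union_frontier_simplex)
      (simp add: regular_partition_def)
  fix x assume x: "x \<in> R - E"
  then have "x \<in> \<Union>\<T>" using assms(1) closure_subset unfolding regular_partition_def by blast
  then obtain K where K: "K \<in> \<T>" "x \<in> K" by blast
  have "x \<notin> frontier K" using x K(1) unfolding E_def by blast
  then show "\<exists>K\<in>\<T>. x \<in> interior K"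
    using K closure_subset[of K] unfolding frontier_def by blast
qed

text \<open>For \<open>i = 0\<close> the truncated exponent \<open>i - 1\<close> is 0, which is
  harmless because the factor \<open>real i\<close> vanishes; likewise for \<open>j\<close> in
  \<open>poly2_z\<close>.\<close>

definition poly2_r :: "nat \<Rightarrow> (nat \<Rightarrow> nat \<Rightarrow> real) \<Rightarrow> point \<Rightarrow> real" where
  "poly2_r k c x = (\<Sum>i\<le>k. \<Sum>j\<le>k - i. c i j * (real i * fst x ^ (i - 1)) * snd x ^ j)"

definition poly2_z :: "nat \<Rightarrow> (nat \<Rightarrow> nat \<Rightarrow> real) \<Rightarrow> point \<Rightarrow> real" where
  "poly2_z k c x = (\<Sum>i\<le>k. \<Sum>j\<le>k - i. c i j * fst x ^ i * (real j * snd x ^ (j - 1)))"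

lemma poly2_partials:
  "((\<lambda>s. poly2 k c (s, snd x)) has_real_derivative poly2_r k c x) (at (fst x))"
  "((\<lambda>s. poly2 k c (fst x, s)) has_real_derivative poly2_z k c x) (at (snd x))"
  unfolding poly2_def poly2_r_def poly2_z_def
  by (auto intro!: derivative_eq_intros sum.cong simp: mult_ac)

lemma poly2_partials_continuous:
  "continuous_on A (poly2_r k c)" "continuous_on A (poly2_z k c)"
  unfolding poly2_r_def[abs_def] poly2_z_def[abs_def] by (intro continuous_intros)+

text \<open>On a short slice through an interior point of an element, \<open>u\<close> coincides
  with the polynomial of that element, so its classical partial derivatives are those of the
  polynomial. These are continuous on a compact triangle, and the triangles are finitely many, which
  gives a common bound.\<close>

lemma S_FE_partials:
  assumes mesh: "regular_partition R \<T>" and u: "u \<in> S_FE R \<T> k" and S: "open S"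
    "\<forall>x\<in>S. \<exists>K\<in>\<T>. x \<in> interior K"
  shows "\<And>x. x \<in> S \<Longrightarrow> ((\<lambda>s. u (s, snd x)) has_real_derivative d_r u x) (at (fst x))"
    "\<And>x. x \<in> S \<Longrightarrow> ((\<lambda>s. u (fst x, s)) has_real_derivative d_z u x) (at (snd x))"
    "continuous_on S (d_r u)" "continuous_on S (d_z u)"
    "\<exists>C. \<forall>x\<in>S. \<bar>d_r u x\<bar> \<le> C \<and> \<bar>d_z u x\<bar> \<le> C"
proof -
  have fin: "finite \<T>" using mesh by (simp add: regular_partition_def triangulation_def)
  obtain c where c: "\<And>K x. K \<in> \<T> \<Longrightarrow> x \<in> K \<Longrightarrow> u x = poly2 k (c K) x"
    using u unfolding S_FE_def mem_Collect_eq by metis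
  have der: "((\<lambda>s. u (s, snd x)) has_real_derivative poly2_r k (c K) x) (at (fst x))
      \<and> ((\<lambda>s. u (fst x, s)) has_real_derivative poly2_z k (c K) x) (at (snd x))"
    if K: "K \<in> \<T>" "x \<in> interior K" for K x
  proof
    note e = eventually_slices_in_open[OF open_interior K(2)]
    have "\<forall>\<^sub>F s in nhds (fst x). poly2 k (c K) (s, snd x) = u (s, snd x)"
      using e(1) by eventually_elim (metis c K(1) interior_subset subsetD)
    then show "((\<lambda>s. u (s, snd x)) has_real_derivative poly2_r k (c K) x) (at (fst x))"
      by (rule DERIV_transform_eventually[OF poly2_partials(1)])
    have "\<forall>\<^sub>F s in nhds (snd x). poly2 k (c K) (fst x, s) = u (fst x, s)"
      using e(2) by eventually_elim (metis c K(1) interior_subset subsetD)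
    then show "((\<lambda>s. u (fst x, s)) has_real_derivative poly2_z k (c K) x) (at (snd x))"
      by (rule DERIV_transform_eventually[OF poly2_partials(2)])
  qed
  have eq: "d_r u x = poly2_r k (c K) x" "d_z u x = poly2_z k (c K) x"
    if K: "K \<in> \<T>" "x \<in> interior K" for K x
    unfolding d_r_def d_z_def using der[OF K]
    by (auto intro!: vector_derivative_at simp: has_real_derivative_iff_has_vector_derivative)
  show "((\<lambda>s. u (s, snd x)) has_real_derivative d_r u x) (at (fst x))"
    "((\<lambda>s. u (fst x, s)) has_real_derivative d_z u x) (at (snd x))" if xS: "x \<in> S" for x
  proof -
    obtain K where K: "K \<in> \<T>" "x \<in> interior K" using S(2) xS by blast
    show "((\<lambda>s. u (s, snd x)) has_real_derivative d_r u x) (at (fst x))"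
      "((\<lambda>s. u (fst x, s)) has_real_derivative d_z u x) (at (snd x))"
      using der[OF K] eq[OF K] by auto
  qed
  have c1: "continuous_on (interior K) (d_r u)" "continuous_on (interior K) (d_z u)" if "K \<in> \<T>" for K
  proof -
    show "continuous_on (interior K) (d_r u)"
      by (rule continuous_on_eq[OF poly2_partials_continuous(1)]) (simp add: eq(1)[OF that])
    show "continuous_on (interior K) (d_z u)"
      by (rule continuous_on_eq[OF poly2_partials_continuous(2)]) (simp add: eq(2)[OF that])
  qed
  have sub: "S \<subseteq> \<Union>(interior ` \<T>)" using S(2) by blast
  have "continuous_on (\<Union>(interior ` \<T>)) (d_r u)" "continuous_on (\<Union>(interior ` \<T>)) (d_z u)"
    using c1 by (auto intro!: continuous_on_open_Union)
  then show "continuous_on S (d_r u)" "continuous_on S (d_z u)"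
    using sub continuous_on_subset by blast+
  have "\<forall>K\<in>\<T>. \<exists>C. \<forall>x\<in>interior K. \<bar>d_r u x\<bar> \<le> C \<and> \<bar>d_z u x\<bar> \<le> C"
  proof
    fix K assume K: "K \<in> \<T>"
    then have "compact K"
      using mesh unfolding regular_partition_def simplex_def
      by (metis (no_types, lifting) aff_independent_finite finite_imp_compact_convex_hull)
    then have "bounded (poly2_r k (c K) ` K)" "bounded (poly2_z k (c K) ` K)"
      by (auto intro!: compact_imp_bounded compact_continuous_image poly2_partials_continuous)
    then obtain a b where ab: "\<And>x. x \<in> K \<Longrightarrow> \<bar>poly2_r k (c K) x\<bar> \<le> a" "\<And>x. x \<in> K \<Longrightarrow> \<bar>poly2_z k (c K) x\<bar> \<le> b"
      unfolding bounded_iff by (metis image_eqI real_norm_def)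
    show "\<exists>C. \<forall>x\<in>interior K. \<bar>d_r u x\<bar> \<le> C \<and> \<bar>d_z u x\<bar> \<le> C"
    proof (intro exI[of _ "max a b"] ballI)
      fix x assume x: "x \<in> interior K"
      then have "x \<in> K" using interior_subset by blast
      from ab(1)[OF this] ab(2)[OF this]
      show "\<bar>d_r u x\<bar> \<le> max a b \<and> \<bar>d_z u x\<bar> \<le> max a b"
        using eq[OF K x] by auto
    qed
  qed
  then obtain Cf where Cf: "\<And>K x. K \<in> \<T> \<Longrightarrow> x \<in> interior K \<Longrightarrow> \<bar>d_r u x\<bar> \<le> Cf K \<and> \<bar>d_z u x\<bar> \<le> Cf K"
    by metis
  show "\<exists>C. \<forall>x\<in>S. \<bar>d_r u x\<bar> \<le> C \<and> \<bar>d_z u x\<bar> \<le> C"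
  \<comment> \<open>The sum serves as a bound for all elements in place of a maximum.\<close>
  proof (intro exI[of _ "\<Sum>K\<in>\<T>. \<bar>Cf K\<bar>"] ballI)
    fix x assume "x \<in> S"
    then obtain K where K: "K \<in> \<T>" "x \<in> interior K" using S(2) by blast
    have "Cf K \<le> \<bar>Cf K\<bar>" by simp
    also have "\<dots> \<le> (\<Sum>K\<in>\<T>. \<bar>Cf K\<bar>)" using K(1) fin by (intro member_le_sum) auto
    finally show "\<bar>d_r u x\<bar> \<le> (\<Sum>K\<in>\<T>. \<bar>Cf K\<bar>) \<and> \<bar>d_z u x\<bar> \<le> (\<Sum>K\<in>\<T>. \<bar>Cf K\<bar>)"
      using Cf[OF K] by linarith
  qed
qed

text \<open>On \<open>d1\<close> the velocity vanishes, on \<open>d2\<close> its normal component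
  does, and on the axis the factor \<open>fst y\<close> does. The condition on \<open>d2\<close>
  speaks only of points with an outer normal; continuity covers the finitely many other points of
  the segment.\<close>

lemma velocity_tangential:
  assumes R: "open R" "interior (closure R) = R"
    and bd: "frontier R = d1 \<union> d2 \<union> axis_boundary R"
    and PQ: "finite PQ" "\<And>p q. (p, q) \<in> PQ \<Longrightarrow> p \<noteq> q" "frontier R = (\<Union>(p, q)\<in>PQ. closed_segment p q)"
    and U: "U \<in> velocity_space R d1 d2"
    and pq: "(p, q) \<in> PQ" and y: "y \<in> closed_segment p q"
  shows "(fst y *\<^sub>R U y) \<bullet> perp (q - p) = 0"
proof -
  have p_q: "p \<noteq> q" using PQ(2) pq by blast
  have sub: "closed_segment p q \<subseteq> frontier R"
    using UN_upper[OF pq, of "\<lambda>(p, q). closed_segment p q"] unfolding PQ(3) by simp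
  obtain B where B: "finite B" "\<And>y. y \<in> closed_segment p q - B \<Longrightarrow>
      outer_normal R y (perp (sgn (q - p))) \<or> outer_normal R y (- perp (sgn (q - p)))"
    using outer_normal_boundary_segment[OF R PQ pq] by blast
  have cU: "continuous_on (closed_segment p q) U"
    using U sub unfolding velocity_space_def frontier_def by (auto intro: continuous_on_subset)
  show ?thesis
  proof (rule segment_continuous_zero_off_finite[OF p_q _ B(1) _ y])
    show "continuous_on (closed_segment p q) (\<lambda>y. (fst y *\<^sub>R U y) \<bullet> perp (q - p))"
      by (intro continuous_intros cU)
    fix y assume y: "y \<in> closed_segment p q - B"
    then have "y \<in> d1 \<union> d2 \<union> axis_boundary R" using sub bd by blast
    then consider "y \<in> d1" | "y \<in> d2" | "fst y = 0" unfolding axis_boundary_def by blast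
    then show "(fst y *\<^sub>R U y) \<bullet> perp (q - p) = 0"
    proof cases
      case 1
      then have "U y = 0" using U unfolding velocity_space_def by blast
      then show ?thesis by simp
    next
      case 2
      then have "\<And>n. outer_normal R y n \<Longrightarrow> U y \<bullet> n = 0" using U unfolding velocity_space_def by blast
      then have "U y \<bullet> perp (sgn (q - p)) = 0" using B(2)[OF y] by (metis inner_minus_right neg_equal_0_iff_equal)
      then have "U y \<bullet> perp (q - p) = 0" using p_q by (simp add: sgn_div_norm perp_simps)
      then show ?thesis by simp
    qed simp
  qed
qed

definition mesh_interior :: "point set \<Rightarrow> point set set \<Rightarrow> point set" where
  "mesh_interior R \<T> = R - (frontier R \<union> (\<Union>K\<in>\<T>. frontier K))"

text \<open>The product rule for the divergence of \<open>r U\<close>, in terms of scalar components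
  because the finite element lemmas concern scalar functions.\<close>

definition div_rU :: "(point \<Rightarrow> point) \<Rightarrow> point \<Rightarrow> real" where
  "div_rU U x = fst (U x) + fst x * (d_r (fst \<circ> U) x + d_z (snd \<circ> U) x)"

lemma mesh_interior_simps:
  assumes "regular_partition R \<T>" "polygonal_domain R"
  shows "open (mesh_interior R \<T>)" "mesh_interior R \<T> \<subseteq> R" "negligible (R - mesh_interior R \<T>)"
    "\<forall>x\<in>mesh_interior R \<T>. \<exists>K\<in>\<T>. x \<in> interior K"
proof -
  have f: "segment_union (frontier R)" using assms(2) by (simp add: polygonal_domain_def)
  note E = mesh_skeleton[OF assms(1) f]
  show "open (mesh_interior R \<T>)" unfolding mesh_interior_def
    using assms(2) segment_union_closed[OF E(1)] by (intro open_Diff) (auto simp: polygonal_domain_def)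
  show "mesh_interior R \<T> \<subseteq> R" unfolding mesh_interior_def by blast
  show "negligible (R - mesh_interior R \<T>)"
    by (rule negligible_subset[OF segment_union_negligible[OF E(1)]]) (auto simp: mesh_interior_def)
  show "\<forall>x\<in>mesh_interior R \<T>. \<exists>K\<in>\<T>. x \<in> interior K"
    using E(2) unfolding mesh_interior_def by (rule ballI)
qed

text \<open>The product of \<phi> with the tangential field \<open>r U\<close> is again tangential,
  so its divergence integrates to 0, and expanding that divergence gives the last claim. The
  function \<phi> need not vanish near the boundary; in particular constants are admissible.\<close>

lemma weak_divergence:
  assumes R: "polygonal_domain R" and bd: "frontier R = d1 \<union> d2 \<union> axis_boundary R"
    and mesh: "regular_partition R \<T>" and U: "U \<in> U_FE R d1 d2 \<T>"
  defines "S \<equiv> mesh_interior R \<T>"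
  shows "continuous_on S (div_rU U)" "\<exists>C. \<forall>x\<in>S. \<bar>div_rU U x\<bar> \<le> C"
    "\<And>x. x \<in> S \<Longrightarrow> div_c (\<lambda>x. fst x *\<^sub>R U x) x = div_rU U x"
    "\<And>\<phi> \<phi>'. (\<And>x. (\<phi> has_derivative (\<lambda>h. h \<bullet> \<phi>' x)) (at x)) \<Longrightarrow> continuous_on UNIV \<phi>' \<Longrightarrow>
      (LINT x:S|lborel. \<phi> x * div_rU U x + (fst x *\<^sub>R U x) \<bullet> \<phi>' x) = 0"
proof -
  have oR: "open R" "bounded R" "interior (closure R) = R" and fR: "segment_union (frontier R)"
    using R by (auto simp: polygonal_domain_def)
  note S = mesh_interior_simps[OF mesh R, folded S_def]
  have u: "fst \<circ> U \<in> S_FE R \<T> 2" "snd \<circ> U \<in> S_FE R \<T> 2" and Uv: "U \<in> velocity_space R d1 d2"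
    using U by (auto simp: U_FE_def S_FE_vec_def)
  have cU: "continuous_on (closure R) U" using Uv by (simp add: velocity_space_def)
  have SR: "S \<subseteq> closure R" using S(2) closure_subset by blast
  have cR: "compact (closure R)" using oR by simp
  note P1 = S_FE_partials[OF mesh u(1) S(1,4)]
  note P2 = S_FE_partials[OF mesh u(2) S(1,4)]
  show cD: "continuous_on S (div_rU U)"
    unfolding div_rU_def[abs_def]
    by (intro continuous_intros continuous_on_subset[OF cU SR] P1 P2)
  obtain BR where BR: "\<And>x. x \<in> closure R \<Longrightarrow> norm x \<le> BR"
    using compact_imp_bounded[OF cR] unfolding bounded_iff by blast
  obtain BU where BU: "\<And>x. x \<in> closure R \<Longrightarrow> norm (U x) \<le> BU"
    using compact_imp_bounded[OF compact_continuous_image[OF cU cR]] unfolding bounded_iff by blast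
  obtain C1 where C1: "\<And>x. x \<in> S \<Longrightarrow> \<bar>d_r (fst \<circ> U) x\<bar> \<le> C1" using P1(5) by blast
  obtain C2 where C2: "\<And>x. x \<in> S \<Longrightarrow> \<bar>d_z (snd \<circ> U) x\<bar> \<le> C2" using P2(5) by blast
  define f1 where "f1 = (\<lambda>x. fst (U x) + fst x * d_r (fst \<circ> U) x)"
  define f2 where "f2 = (\<lambda>x. fst x * d_z (snd \<circ> U) x)"
  have D: "div_rU U x = f1 x + f2 x" for x
    by (simp add: div_rU_def f1_def f2_def algebra_simps)
  define CC where "CC = BU + BR * (\<bar>C1\<bar> + \<bar>C2\<bar>)"
  have b12: "\<bar>f1 x\<bar> \<le> CC" "\<bar>f2 x\<bar> \<le> CC" if x: "x \<in> S" for x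
  proof -
    have xR: "x \<in> closure R" using x SR by blast
    have u0: "\<bar>fst (U x)\<bar> \<le> BU" "0 \<le> BU" and r0: "\<bar>fst x\<bar> \<le> BR" "0 \<le> BR"
      using abs_fst_le_norm[of "U x"] BU[OF xR] abs_fst_le_norm[of x] BR[OF xR] norm_ge_zero[of x] norm_ge_zero[of "U x"] by linarith+
    have "\<bar>f1 x\<bar> \<le> \<bar>fst (U x)\<bar> + \<bar>fst x\<bar> * \<bar>d_r (fst \<circ> U) x\<bar>"
      unfolding f1_def by (metis abs_mult abs_triangle_ineq)
    also have "\<dots> \<le> BU + BR * (\<bar>C1\<bar> + \<bar>C2\<bar>)"
      using u0 r0 C1[OF x] by (intro add_mono mult_mono) auto
    finally show "\<bar>f1 x\<bar> \<le> CC" by (simp add: CC_def)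
    have "\<bar>f2 x\<bar> \<le> BR * (\<bar>C1\<bar> + \<bar>C2\<bar>)"
      unfolding f2_def abs_mult using r0 C2[OF x] by (intro mult_mono) auto
    then show "\<bar>f2 x\<bar> \<le> CC" using u0 by (simp add: CC_def)
  qed
  show "\<exists>C. \<forall>x\<in>S. \<bar>div_rU U x\<bar> \<le> C"
  proof (intro exI[of _ "CC + CC"] ballI)
    fix x assume "x \<in> S"
    from b12[OF this] show "\<bar>div_rU U x\<bar> \<le> CC + CC" unfolding D by linarith
  qed
  have d1: "((\<lambda>s. s * fst (U (s, snd x))) has_real_derivative f1 x) (at (fst x))"
    and d2: "((\<lambda>s. fst x * snd (U (fst x, s))) has_real_derivative f2 x) (at (snd x))"
    if x: "x \<in> S" for x
  proof -
    have "((\<lambda>s. s * fst (U (s, snd x))) has_real_derivative (1 * (fst \<circ> U) (fst x, snd x) + d_r (fst \<circ> U) x * fst x)) (at (fst x))"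
      using DERIV_mult[OF DERIV_ident P1(1)[OF x]] by simp
    then show "((\<lambda>s. s * fst (U (s, snd x))) has_real_derivative f1 x) (at (fst x))"
      by (simp add: f1_def mult.commute)
    show "((\<lambda>s. fst x * snd (U (fst x, s))) has_real_derivative f2 x) (at (snd x))"
      using DERIV_cmult[OF P2(2)[OF x], of "fst x"] by (simp add: f2_def)
  qed
  show "div_c (\<lambda>x. fst x *\<^sub>R U x) x = div_rU U x" if x: "x \<in> S" for x
  proof -
    \<comment> \<open>Only one component of \<open>d_r\<close> enters the divergence, but the
      \<open>vector_derivative\<close> of a pair is evaluated from the derivatives of both
      components.\<close>
    have "((\<lambda>s. s * snd (U (s, snd x))) has_real_derivative (1 * (snd \<circ> U) (fst x, snd x) + d_r (snd \<circ> U) x * fst x)) (at (fst x))"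
      using DERIV_mult[OF DERIV_ident P2(1)[OF x]] by simp
    with d1[OF x] have "((\<lambda>s. (s * fst (U (s, snd x)), s * snd (U (s, snd x)))) has_vector_derivative
        (f1 x, 1 * (snd \<circ> U) (fst x, snd x) + d_r (snd \<circ> U) x * fst x)) (at (fst x))"
      unfolding has_real_derivative_iff_has_vector_derivative by (rule has_vector_derivative_Pair)
    then have "d_r (\<lambda>x. fst x *\<^sub>R U x) x = (f1 x, 1 * (snd \<circ> U) (fst x, snd x) + d_r (snd \<circ> U) x * fst x)"
      unfolding d_r_def by (intro vector_derivative_at) (simp add: scaleR_prod_def)
    moreover have "((\<lambda>s. fst x * fst (U (fst x, s))) has_real_derivative (fst x * d_z (fst \<circ> U) x)) (at (snd x))"
      using DERIV_cmult[OF P1(2)[OF x], of "fst x"] by simp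
    with d2[OF x] have "((\<lambda>s. (fst x * fst (U (fst x, s)), fst x * snd (U (fst x, s)))) has_vector_derivative
        (fst x * d_z (fst \<circ> U) x, f2 x)) (at (snd x))"
      unfolding has_real_derivative_iff_has_vector_derivative by (intro has_vector_derivative_Pair)
    then have "d_z (\<lambda>x. fst x *\<^sub>R U x) x = (fst x * d_z (fst \<circ> U) x, f2 x)"
      unfolding d_z_def by (intro vector_derivative_at) (simp add: scaleR_prod_def)
    ultimately show ?thesis by (simp add: div_c_def D)
  qed
  fix \<phi> :: "point \<Rightarrow> real" and \<phi>' :: "point \<Rightarrow> point"
  assume phi: "\<And>x. (\<phi> has_derivative (\<lambda>h. h \<bullet> \<phi>' x)) (at x)" and cphi': "continuous_on UNIV \<phi>'"
  have cphi: "continuous_on A \<phi>" for A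
    by (rule continuous_at_imp_continuous_on) (use phi has_derivative_continuous in blast)
  have cphi'': "continuous_on A \<phi>'" for A using cphi' continuous_on_subset by blast
  obtain Bp where Bp: "\<And>x. x \<in> closure R \<Longrightarrow> \<bar>\<phi> x\<bar> \<le> Bp"
    using compact_imp_bounded[OF compact_continuous_image[OF cphi cR]] unfolding bounded_iff
    by (metis image_eqI real_norm_def)
  obtain Bq where Bq: "\<And>x. x \<in> closure R \<Longrightarrow> norm (\<phi>' x) \<le> Bq"
    using compact_imp_bounded[OF compact_continuous_image[OF cphi'' cR]] unfolding bounded_iff by blast
  obtain F where F: "finite F" "\<forall>s\<in>F. \<exists>a b. a \<noteq> b \<and> s = closed_segment a b" "frontier R = \<Union>F"
    using fR unfolding segment_union_def by blast
  then obtain a b where ab: "\<And>s. s \<in> F \<Longrightarrow> a s \<noteq> b s \<and> s = closed_segment (a s) (b s)" by metis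
  define PQ where "PQ = (\<lambda>s. (a s, b s)) ` F"
  have PQ: "finite PQ" "\<And>p q. (p, q) \<in> PQ \<Longrightarrow> p \<noteq> q" "frontier R = (\<Union>(p, q)\<in>PQ. closed_segment p q)"
  proof -
    show "finite PQ" using F(1) by (simp add: PQ_def)
    show "p \<noteq> q" if "(p, q) \<in> PQ" for p q using that ab unfolding PQ_def by (metis (no_types, lifting) imageE prod.inject)
    have "(\<Union>s\<in>F. closed_segment (a s) (b s)) = (\<Union>s\<in>F. s)"
      by (rule SUP_cong) (use ab in metis)+
    then show "frontier R = (\<Union>(p, q)\<in>PQ. closed_segment p q)" by (simp add: F(3) PQ_def)
  qed
  define G where "G = (\<lambda>x. \<phi> x *\<^sub>R fst x *\<^sub>R U x)"
  define g1 where "g1 = (\<lambda>x. fst (\<phi>' x) * (fst x * fst (U x)) + f1 x * \<phi> x)"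
  define g2 where "g2 = (\<lambda>x. snd (\<phi>' x) * (fst x * snd (U x)) + f2 x * \<phi> x)"
  define E where "E = frontier R \<union> (\<Union>K\<in>\<T>. frontier K)"
  define C where "C = Bq * (BR * BU) + CC * Bp"
  have bg: "\<bar>g1 x\<bar> \<le> C" "\<bar>g2 x\<bar> \<le> C" if x: "x \<in> S" for x
  proof -
    have xR: "x \<in> closure R" using x SR by blast
    have r: "\<bar>fst x\<bar> \<le> BR" using abs_fst_le_norm[of x] BR[OF xR] by linarith
    have v: "\<bar>fst (U x)\<bar> \<le> BU" "\<bar>snd (U x)\<bar> \<le> BU" using abs_component_le_norm[of "U x"] BU[OF xR] by linarith+
    have w: "\<bar>fst (\<phi>' x)\<bar> \<le> Bq" "\<bar>snd (\<phi>' x)\<bar> \<le> Bq" using abs_component_le_norm[of "\<phi>' x"] Bq[OF xR] by linarith+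
    have p: "\<bar>\<phi> x\<bar> \<le> Bp" using Bp[OF xR] .
    have key: "\<bar>a * (fst x * b) + c * \<phi> x\<bar> \<le> C" if "\<bar>a\<bar> \<le> Bq" "\<bar>b\<bar> \<le> BU" "\<bar>c\<bar> \<le> CC" for a b c
    proof -
      have "\<bar>a * (fst x * b) + c * \<phi> x\<bar> \<le> \<bar>a\<bar> * (\<bar>fst x\<bar> * \<bar>b\<bar>) + \<bar>c\<bar> * \<bar>\<phi> x\<bar>"
        by (metis abs_mult abs_triangle_ineq)
      also have "\<dots> \<le> C"
        unfolding C_def using that r p abs_ge_zero[of a] abs_ge_zero[of b] abs_ge_zero[of c]
        by (intro add_mono mult_mono) (auto intro: order_trans[OF abs_ge_zero])
      finally show ?thesis .
    qed
    show "\<bar>g1 x\<bar> \<le> C" "\<bar>g2 x\<bar> \<le> C"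
      unfolding g1_def g2_def using key v w b12[OF x] by auto
  qed
  have SE: "S = R - E" by (simp add: S_def mesh_interior_def E_def)
  have "(LINT x:R - E|lborel. g1 x + g2 x) = 0"
  proof (rule divergence_tangential_eq_0[OF oR(1,2) _ _ PQ])
    show "segment_union E" unfolding E_def by (rule mesh_skeleton(1)[OF mesh fR])
    show "frontier R \<subseteq> E" by (simp add: E_def)
    show "continuous_on (closure R) G"
      unfolding G_def by (intro continuous_intros cU cphi)
    show "((\<lambda>s. fst (G (s, snd x))) has_real_derivative g1 x) (at (fst x))" if "x \<in> R - E" for x
      using DERIV_mult[OF has_derivative_inner_slices(1)[OF phi[of x]] d1[of x]] that
      by (simp add: G_def g1_def SE mult.assoc)
    show "((\<lambda>s. snd (G (fst x, s))) has_real_derivative g2 x) (at (snd x))" if "x \<in> R - E" for x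
      using DERIV_mult[OF has_derivative_inner_slices(2)[OF phi[of x]] d2[of x]] that
      by (simp add: G_def g2_def SE mult.assoc)
    show "continuous_on (R - E) g1" "continuous_on (R - E) g2"
      unfolding g1_def g2_def f1_def f2_def SE[symmetric]
      by (intro continuous_intros cphi cphi'' continuous_on_subset[OF cU SR] P1 P2)+
    show "\<bar>g1 x\<bar> \<le> C" "\<bar>g2 x\<bar> \<le> C" if "x \<in> R - E" for x
      using bg that by (auto simp: SE)
    show "G y \<bullet> perp (q - p) = 0" if "(p, q) \<in> PQ" "y \<in> closed_segment p q" for p q y
      using velocity_tangential[OF oR(1,3) bd PQ Uv that] by (simp add: G_def)
  qed
  moreover have "g1 x + g2 x = \<phi> x * div_rU U x + (fst x *\<^sub>R U x) \<bullet> \<phi>' x" for x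
    by (simp add: g1_def g2_def D inner_prod_def algebra_simps)
  ultimately show "(LINT x:S|lborel. \<phi> x * div_rU U x + (fst x *\<^sub>R U x) \<bullet> \<phi>' x) = 0"
    by (simp add: SE)
qed

subsection \<open>Smoothed crossing numbers\<close>

text \<open>The quintic is the primitive of 30 t^2 (1 - t)^2, and 30 normalises the integral over
  the unit interval to 1. The double zeros at 0 and 1 make \<open>bump\<close> continuously
  differentiable, as required for its derivative to enter the gradient of the smoothed crossing
  count.\<close>

definition smoothstep :: "real \<Rightarrow> real" where
  "smoothstep t = (if t \<le> 0 then 0 else if t \<le> 1 then 10 * t ^ 3 - 15 * t ^ 4 + 6 * t ^ 5 else 1)"

definition bump :: "real \<Rightarrow> real" where
  "bump t = (if t \<le> 0 then 0 else if t \<le> 1 then 30 * t\<^sup>2 * (1 - t)\<^sup>2 else 0)"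

definition bump_deriv :: "real \<Rightarrow> real" where
  "bump_deriv t = (if t \<le> 0 then 0 else if t \<le> 1 then 60 * t * (1 - t) * (1 - 2 * t) else 0)"

lemma smoothstep_has_derivative: "(smoothstep has_real_derivative bump t) (at t)"
  unfolding smoothstep_def[abs_def] bump_def
  by (intro has_real_derivative_If_le)
    (auto intro!: derivative_eq_intros has_real_derivative_If_le simp: power2_eq_square algebra_simps eval_nat_numeral)

lemma bump_has_derivative: "(bump has_real_derivative bump_deriv t) (at t)"
  unfolding bump_deriv_def bump_def[abs_def]
  by (intro has_real_derivative_If_le)
    (auto intro!: derivative_eq_intros has_real_derivative_If_le simp: power2_eq_square algebra_simps eval_nat_numeral)

lemma continuous_on_bump: "continuous_on A bump"
  by (rule continuous_at_imp_continuous_on) (use bump_has_derivative DERIV_isCont in blast)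

lemma continuous_on_smoothstep: "continuous_on A smoothstep"
  by (rule continuous_at_imp_continuous_on) (use smoothstep_has_derivative DERIV_isCont in blast)

lemma continuous_on_bump_deriv: "continuous_on A bump_deriv"
proof -
  \<comment> \<open>Clamping the argument to the unit interval replaces the case distinction by a
    visibly continuous formula; the cubic vanishes at both ends.\<close>
  have "bump_deriv = (\<lambda>t. 60 * max 0 (min 1 t) * (1 - max 0 (min 1 t)) * (1 - 2 * max 0 (min 1 t)))"
    by (auto simp: bump_deriv_def fun_eq_iff max_def min_def)
  then show ?thesis by (rule ssubst) (intro continuous_intros)
qed

lemma bump_nonneg: "0 \<le> bump t"
  by (simp add: bump_def)

lemma bump_nonzeroD: "bump t \<noteq> 0 \<Longrightarrow> 0 < t \<and> t < 1"
  by (auto simp: bump_def split: if_splits)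

lemma smoothstep_mono:
  assumes "s \<le> t"
  shows "smoothstep s \<le> smoothstep t"
proof (rule DERIV_nonneg_imp_nondecreasing[OF assms])
  fix x show "\<exists>y. (smoothstep has_real_derivative y) (at x) \<and> 0 \<le> y"
    using smoothstep_has_derivative bump_nonneg by blast
qed

lemma smoothstep_bounds: "0 \<le> smoothstep t" "smoothstep t \<le> 1"
proof -
  have "smoothstep (min 0 t) \<le> smoothstep t" "smoothstep t \<le> smoothstep (max 2 t)"
    by (auto intro: smoothstep_mono)
  then show "0 \<le> smoothstep t" "smoothstep t \<le> 1" by (auto simp: smoothstep_def max_def min_def split: if_splits)
qed

lemma smoothstep_le_0: "t \<le> 0 \<Longrightarrow> smoothstep t = 0"
  by (simp add: smoothstep_def)

text \<open>An approximate identity: for \<epsilon> > 0 it is nonnegative, has total mass 1 and is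
  supported in the square with both coordinates between 0 and \<epsilon>.\<close>

definition kern :: "real \<Rightarrow> point \<Rightarrow> real" where
  "kern \<epsilon> y = bump (fst y / \<epsilon>) * bump (snd y / \<epsilon>) / \<epsilon>\<^sup>2"

text \<open>The primitive of \<open>kern\<close> in the first variable that vanishes on the left
  half-plane. For small \<epsilon> it acts as a point mass in the height, switched on only to the
  right.\<close>

definition kern_prim :: "real \<Rightarrow> point \<Rightarrow> real" where
  "kern_prim \<epsilon> y = smoothstep (fst y / \<epsilon>) * bump (snd y / \<epsilon>) / \<epsilon>"

definition kern_prim_z :: "real \<Rightarrow> point \<Rightarrow> real" where
  "kern_prim_z \<epsilon> y = smoothstep (fst y / \<epsilon>) * bump_deriv (snd y / \<epsilon>) / \<epsilon>\<^sup>2"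

lemma kern_continuous:
  assumes "continuous_on A f"
  shows "continuous_on A (\<lambda>x. kern \<epsilon> (f x))" "continuous_on A (\<lambda>x. kern_prim \<epsilon> (f x))"
    "continuous_on A (\<lambda>x. kern_prim_z \<epsilon> (f x))"
  unfolding kern_def kern_prim_def kern_prim_z_def divide_inverse
  by (intro continuous_intros assms continuous_on_compose2[OF continuous_on_bump[of UNIV]]
      continuous_on_compose2[OF continuous_on_bump_deriv[of UNIV]]
      continuous_on_compose2[OF continuous_on_smoothstep[of UNIV]]; simp)+

lemma kern_nonneg: "0 \<le> kern \<epsilon> y"
  by (simp add: kern_def bump_nonneg)

lemma kern_support: "\<epsilon> > 0 \<Longrightarrow> kern \<epsilon> y \<noteq> 0 \<Longrightarrow> norm y < 2 * \<epsilon>"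
proof -
  assume e: "\<epsilon> > 0" and "kern \<epsilon> y \<noteq> 0"
  then have "bump (fst y / \<epsilon>) \<noteq> 0" "bump (snd y / \<epsilon>) \<noteq> 0" by (auto simp: kern_def)
  then have "0 < fst y" "fst y < \<epsilon>" "0 < snd y" "snd y < \<epsilon>"
    using e by (auto dest!: bump_nonzeroD simp: zero_less_divide_iff)
  moreover have "norm y \<le> \<bar>fst y\<bar> + \<bar>snd y\<bar>"
    using norm_Pair_le[of "fst y" "snd y"] by simp
  ultimately show ?thesis by linarith
qed

lemma kern_prim_eq_0: "\<epsilon> > 0 \<Longrightarrow> fst y \<le> 0 \<Longrightarrow> kern_prim \<epsilon> y = 0"
  by (simp add: kern_prim_def smoothstep_le_0 divide_nonpos_pos)

lemma kern_prim_has_derivative: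
  "\<epsilon> > 0 \<Longrightarrow> (kern_prim \<epsilon> has_derivative (\<lambda>h. h \<bullet> (kern \<epsilon> y, kern_prim_z \<epsilon> y))) (at y)"
proof -
  assume e: "\<epsilon> > 0"
  have 1: "((\<lambda>y. smoothstep (fst y / \<epsilon>)) has_derivative (\<lambda>h. bump (fst y / \<epsilon>) * (fst h / \<epsilon>))) (at y)"
    by (rule has_derivative_eq_rhs, rule DERIV_compose_FDERIV[OF smoothstep_has_derivative,
          where g' = "\<lambda>h. fst h / \<epsilon>"]) (use e in \<open>auto intro!: derivative_eq_intros\<close>)
  have 2: "((\<lambda>y. bump (snd y / \<epsilon>)) has_derivative (\<lambda>h. bump_deriv (snd y / \<epsilon>) * (snd h / \<epsilon>))) (at y)"
    by (rule has_derivative_eq_rhs, rule DERIV_compose_FDERIV[OF bump_has_derivative,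
          where g' = "\<lambda>h. snd h / \<epsilon>"]) (use e in \<open>auto intro!: derivative_eq_intros\<close>)
  from has_derivative_mult_left[OF has_derivative_mult[OF 1 2], of "inverse \<epsilon>"]
  show ?thesis unfolding kern_prim_def[abs_def] divide_inverse
    by (rule has_derivative_eq_rhs)
      (auto simp: fun_eq_iff kern_def kern_prim_z_def inner_prod_def power2_eq_square divide_inverse algebra_simps)
qed

text \<open>As \<open>\<epsilon>\<close> tends to 0, the sum of this function over the edges of a polygonal line that starts
  and ends on the axis approximates the signed number of edges crossed by the horizontal ray from
  \<open>x\<close> to the right. The kernels are supported in the positive quadrant, so that the ends of the
  line, having first coordinate 0, do not contribute to the gradient in the half-plane.\<close>

definition crossing :: "real \<Rightarrow> point \<Rightarrow> point \<Rightarrow> point \<Rightarrow> real" where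
  "crossing \<epsilon> a b x = integral {0..1} (\<lambda>s. snd (b - a) * kern_prim \<epsilon> (a + s *\<^sub>R (b - a) - x))"

text \<open>A smoothed measure on the edge in the parameter from 0 to 1; the length of the edge is
  supplied by the factor \<open>perp (b - a)\<close> in \<open>crossing_grad\<close>.\<close>

definition edge_kern :: "real \<Rightarrow> point \<Rightarrow> point \<Rightarrow> point \<Rightarrow> real" where
  "edge_kern \<epsilon> a b x = integral {0..1} (\<lambda>s. kern \<epsilon> (a + s *\<^sub>R (b - a) - x))"

text \<open>The first summand is concentrated near the edge and points along its normal. The second
  stems from the two end points and cancels between consecutive edges.\<close>

definition crossing_grad :: "real \<Rightarrow> point \<Rightarrow> point \<Rightarrow> point \<Rightarrow> point" where
  "crossing_grad \<epsilon> a b x = - (edge_kern \<epsilon> a b x *\<^sub>R perp (b - a))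
     - (0, kern_prim \<epsilon> (b - x) - kern_prim \<epsilon> (a - x))"

text \<open>Differentiation under the integral produces \<open>kern\<close> and
  \<open>kern_prim_z\<close>, both times the rise \<open>snd (b - a)\<close>. The first component is
  then a multiple of \<open>edge_kern\<close>. In the second, the rise times
  \<open>kern_prim_z\<close> is the derivative of \<open>kern_prim\<close> along the edge minus
  \<open>fst (b - a)\<close> times \<open>kern\<close>; integration leaves the end values and
  \<open>edge_kern\<close>.\<close>

lemma crossing_has_derivative:
  assumes e: "\<epsilon> > 0"
  shows "(crossing \<epsilon> a b has_derivative (\<lambda>h. h \<bullet> crossing_grad \<epsilon> a b x)) (at x)"
proof -
  define X where "X = (\<lambda>s. a + s *\<^sub>R (b - a))"
  have cX: "continuous_on A (\<lambda>s. X s - x)" for A x unfolding X_def by (intro continuous_intros)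
  \<comment> \<open>The minus sign is due to \<open>x\<close> entering the kernel as
    \<open>X s - x\<close>.\<close>
  define G where "G = (\<lambda>x s. - snd (b - a) *\<^sub>R (kern \<epsilon> (X s - x), kern_prim_z \<epsilon> (X s - x)))"
  have cG: "continuous_on A (\<lambda>z. G (fst z) (snd z))" for A
    unfolding G_def X_def by (intro continuous_intros kern_continuous)
  have cGs: "continuous_on A (G x)" for A x
    unfolding G_def by (intro continuous_intros kern_continuous cX)
  have "((\<lambda>x. integral (cbox 0 1) (\<lambda>s. snd (b - a) * kern_prim \<epsilon> (X s - x))) has_derivative
      blinfun_apply (integral (cbox 0 1) (\<lambda>s. blinfun_inner_left (G x s)))) (at x within UNIV)"
  proof (rule leibniz_rule)
    fix x :: point and t :: real
    have "((\<lambda>x. kern_prim \<epsilon> (X t - x)) has_derivative (\<lambda>h. (- h) \<bullet> (kern \<epsilon> (X t - x), kern_prim_z \<epsilon> (X t - x)))) (at x)"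
      by (rule has_derivative_compose[OF _ kern_prim_has_derivative[OF e]]) (auto intro!: derivative_eq_intros)
    from has_derivative_mult_right[OF this, of "snd (b - a)"]
    show "((\<lambda>x. snd (b - a) * kern_prim \<epsilon> (X t - x)) has_derivative blinfun_apply (blinfun_inner_left (G x t))) (at x within UNIV)"
      by (rule has_derivative_eq_rhs) (auto simp: G_def blinfun_inner_left.rep_eq inner_prod_def algebra_simps)
    show "(\<lambda>s. snd (b - a) * kern_prim \<epsilon> (X s - x)) integrable_on cbox 0 1"
      by (intro integrable_continuous continuous_intros kern_continuous cX)
    show "continuous_on (UNIV \<times> cbox 0 1) (\<lambda>(x, t). blinfun_inner_left (G x t))"
      unfolding case_prod_beta by (intro continuous_intros cG)
  qed auto
  moreover have "integral (cbox 0 1) (\<lambda>s. blinfun_inner_left (G x s)) = blinfun_inner_left (integral (cbox 0 1) (G x))"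
  proof -
    have "G x integrable_on cbox 0 1" by (intro integrable_continuous cGs)
    from integral_linear[OF this bounded_linear_blinfun_inner_left]
    show ?thesis by (simp add: o_def)
  qed
  moreover have "integral (cbox 0 1) (G x) = crossing_grad \<epsilon> a b x"
  proof -
    have i1: "((\<lambda>s. kern \<epsilon> (X s - x)) has_integral edge_kern \<epsilon> a b x) {0..1}"
      unfolding edge_kern_def X_def
      by (intro integrable_integral integrable_continuous_real kern_continuous continuous_intros)
    have FTC: "((\<lambda>s. (b - a) \<bullet> (kern \<epsilon> (X s - x), kern_prim_z \<epsilon> (X s - x))) has_integral
        (kern_prim \<epsilon> (X 1 - x) - kern_prim \<epsilon> (X 0 - x))) {0..1}"
    proof (rule fundamental_theorem_of_calculus)
      fix s :: real
      have "((\<lambda>s. X s - x) has_derivative (\<lambda>h. h *\<^sub>R (b - a))) (at s)"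
        unfolding X_def by (auto intro!: derivative_eq_intros)
      from has_derivative_compose[OF this kern_prim_has_derivative[OF e]]
      show "((\<lambda>s. kern_prim \<epsilon> (X s - x)) has_vector_derivative
          (b - a) \<bullet> (kern \<epsilon> (X s - x), kern_prim_z \<epsilon> (X s - x))) (at s within {0..1})"
        by - (rule has_vector_derivative_at_within, simp add: has_vector_derivative_def)
    qed simp
    have "((\<lambda>s. snd (b - a) * kern_prim_z \<epsilon> (X s - x)) has_integral
        (kern_prim \<epsilon> (X 1 - x) - kern_prim \<epsilon> (X 0 - x) - fst (b - a) * edge_kern \<epsilon> a b x)) {0..1}"
      using has_integral_diff[OF FTC has_integral_mult_right[OF i1, of "fst (b - a)"]]
      by (simp add: inner_prod_def)
    then have i2: "((\<lambda>s. snd (b - a) * kern_prim_z \<epsilon> (X s - x)) has_integral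
        (kern_prim \<epsilon> (b - x) - kern_prim \<epsilon> (a - x) - fst (b - a) * edge_kern \<epsilon> a b x)) {0..1}"
      by (simp add: X_def)
    have "((\<lambda>s. (snd (b - a) * kern \<epsilon> (X s - x), snd (b - a) * kern_prim_z \<epsilon> (X s - x))) has_integral
      (snd (b - a) * edge_kern \<epsilon> a b x,
       kern_prim \<epsilon> (b - x) - kern_prim \<epsilon> (a - x) - fst (b - a) * edge_kern \<epsilon> a b x)) {0..1}"
      using has_integral_add[OF has_integral_scaleR_left[OF has_integral_mult_right[OF i1, of "snd (b - a)"], of "(1, 0) :: point"]
          has_integral_scaleR_left[OF i2, of "(0, 1) :: point"]] by simp
    from has_integral_neg[OF this]
    have "(G x has_integral crossing_grad \<epsilon> a b x) {0..1}"
      by (simp add: G_def crossing_grad_def perp_def scaleR_prod_def uminus_prod_def algebra_simps)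
    then show ?thesis by (simp add: integral_unique)
  qed
  ultimately show ?thesis
    unfolding crossing_def[abs_def] X_def by (simp add: blinfun_inner_left.rep_eq inner_commute)
qed

lemma edge_kern_continuous: "continuous_on A (edge_kern \<epsilon> a b)"
proof -
  have "continuous_on UNIV (\<lambda>x. integral (cbox 0 1) (\<lambda>s. kern \<epsilon> (a + s *\<^sub>R (b - a) - x)))"
    by (rule integral_continuous_on_param) (auto intro!: continuous_intros kern_continuous simp: case_prod_beta)
  then show ?thesis unfolding edge_kern_def[abs_def] by (auto intro: continuous_on_subset)
qed

lemma crossing_grad_continuous: "continuous_on A (crossing_grad \<epsilon> a b)"
  unfolding crossing_grad_def[abs_def] by (intro continuous_intros edge_kern_continuous kern_continuous)

text \<open>Although \<open>kern_prim\<close> is of size 1 / \<epsilon>, the rise times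
  \<open>bump\<close> over \<epsilon> is the derivative of \<open>smoothstep\<close> along the edge,
  whose total variation is at most 1. The bound is uniform in \<epsilon>, as dominated convergence
  requires.\<close>

lemma crossing_bound:
  assumes e: "\<epsilon> > 0"
  shows "\<bar>crossing \<epsilon> a b x\<bar> \<le> 1"
proof -
  define c where "c = snd (b - a)"
  define X where "X = (\<lambda>s. a + s *\<^sub>R (b - a))"
  define y where "y = (\<lambda>s. (snd a + s * c - snd x) / \<epsilon>)"
  have cX: "continuous_on A (\<lambda>s. X s - x)" for A unfolding X_def by (intro continuous_intros)
  have FTC: "((\<lambda>s. bump (y s) * (c / \<epsilon>)) has_integral (smoothstep (y 1) - smoothstep (y 0))) {0..1}"
  proof (rule fundamental_theorem_of_calculus)
    fix s :: real
    have "(y has_real_derivative c / \<epsilon>) (at s)"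
      unfolding y_def using e by (auto intro!: derivative_eq_intros simp: field_simps)
    from DERIV_chain2[OF smoothstep_has_derivative this]
    show "((\<lambda>s. smoothstep (y s)) has_vector_derivative bump (y s) * (c / \<epsilon>)) (at s within {0..1})"
      by - (rule has_vector_derivative_at_within, simp add: has_real_derivative_iff_has_vector_derivative)
  qed simp
  have i: "(\<lambda>s. c * kern_prim \<epsilon> (X s - x)) integrable_on {0..1}"
    by (intro integrable_continuous_real continuous_intros kern_continuous cX)
  have eq: "c * kern_prim \<epsilon> (X s - x) = smoothstep (fst (X s - x) / \<epsilon>) * (bump (y s) * (c / \<epsilon>))" for s
    by (simp add: kern_prim_def y_def X_def c_def)
  \<comment> \<open>The factor \<open>sgn c\<close> makes the majorant nonnegative for rising and
    falling edges alike, while it remains an exact derivative.\<close>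
  have b: "norm (c * kern_prim \<epsilon> (X s - x)) \<le> sgn c * (bump (y s) * (c / \<epsilon>))" for s
  proof -
    have "norm (c * kern_prim \<epsilon> (X s - x)) = smoothstep (fst (X s - x) / \<epsilon>) * (bump (y s) * (\<bar>c\<bar> / \<epsilon>))"
      unfolding eq using e by (simp add: abs_mult smoothstep_bounds bump_nonneg)
    also have "\<dots> \<le> 1 * (bump (y s) * (\<bar>c\<bar> / \<epsilon>))"
      using e by (intro mult_right_mono smoothstep_bounds) (simp add: bump_nonneg)
    also have "\<dots> = sgn c * (bump (y s) * (c / \<epsilon>))" by (simp add: sgn_if)
    finally show ?thesis .
  qed
  have "norm (integral {0..1} (\<lambda>s. c * kern_prim \<epsilon> (X s - x)))
      \<le> integral {0..1} (\<lambda>s. sgn c * (bump (y s) * (c / \<epsilon>)))"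
    using has_integral_mult_right[OF FTC, of "sgn c"] i b
    by (intro integral_norm_bound_integral) auto
  also have "\<dots> = sgn c * (smoothstep (y 1) - smoothstep (y 0))"
    using has_integral_mult_right[OF FTC, of "sgn c"] by (rule integral_unique)
  also have "\<dots> \<le> 1"
    using smoothstep_bounds[of "y 1"] smoothstep_bounds[of "y 0"] by (auto simp: sgn_if)
  finally show ?thesis unfolding crossing_def c_def X_def by simp
qed

section \<open>The kernel as an approximate identity\<close>

lemma integral_bump: "integrable lborel bump" "(\<integral>t. bump t \<partial>lborel) = 1"
proof -
  have i: "set_integrable lborel (ball 0 2) bump"
    by (rule set_integrable_bounded_continuous[OF open_ball bounded_ball continuous_on_bump, where C = 30])
      (auto simp: bump_def power2_eq_square intro!: mult_le_one)
  have eq: "indicator (ball 0 2) t *\<^sub>R bump t = bump t" for t :: real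
    using bump_nonzeroD[of t] by (cases "bump t = 0") (auto simp: dist_real_def)
  show ii: "integrable lborel bump" using i unfolding set_integrable_def eq .
  have "(bump has_integral (smoothstep 2 - smoothstep (- 2))) {-2..2}"
    by (rule fundamental_theorem_of_calculus)
      (simp_all flip: has_real_derivative_iff_has_vector_derivative
        add: has_field_derivative_at_within[OF smoothstep_has_derivative])
  then have "((\<lambda>t. if t \<in> {-2..2} then bump t else 0) has_integral 1) UNIV"
    unfolding has_integral_restrict_UNIV by (simp add: smoothstep_def)
  moreover have "(\<lambda>t. if t \<in> {-2..2} then bump t else 0) = bump"
    using bump_nonzeroD by (fastforce simp: fun_eq_iff)
  ultimately have "(bump has_integral 1) UNIV" by simp
  then show "(\<integral>t. bump t \<partial>lborel) = 1"
    using has_integral_integral_lborel[OF ii] by (metis has_integral_unique)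
qed

lemma integral_kern:
  assumes e: "\<epsilon> > 0"
  shows "integrable lborel (\<lambda>x. kern \<epsilon> (y - x))" "(\<integral>x. kern \<epsilon> (y - x) \<partial>lborel) = 1"
proof -
  have one: "(\<integral>t. bump ((z - t) / \<epsilon>) / \<epsilon> \<partial>lborel) = 1" for z
  proof -
    \<comment> \<open>The substitution has negative slope; its absolute value 1 / \<epsilon> is the
      normalising factor of the kernel in one variable.\<close>
    have "(\<integral>t. bump t \<partial>lborel) = \<bar>- 1 / \<epsilon>\<bar> *\<^sub>R (\<integral>t. bump (z / \<epsilon> + (- 1 / \<epsilon>) * t) \<partial>lborel)"
      by (rule lborel_integral_real_affine) (use e in simp)
    moreover have "z / \<epsilon> + (- 1 / \<epsilon>) * t = (z - t) / \<epsilon>" for t by (simp add: diff_divide_distrib)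
    ultimately show ?thesis using e integral_bump(2) by simp
  qed
  have cont: "continuous_on A (\<lambda>x. kern \<epsilon> (y - x))" for A by (intro continuous_intros kern_continuous)
  have eq: "indicator (ball y (2 * \<epsilon>)) x *\<^sub>R kern \<epsilon> (y - x) = kern \<epsilon> (y - x)" for x
    using kern_support[OF e, of "y - x"] by (cases "kern \<epsilon> (y - x) = 0") (auto simp: dist_norm)
  obtain C where C: "\<And>x. x \<in> cball y (2 * \<epsilon>) \<Longrightarrow> norm (kern \<epsilon> (y - x)) \<le> C"
    using compact_imp_bounded[OF compact_continuous_image[OF cont compact_cball]] unfolding bounded_iff by blast
  have "set_integrable lborel (ball y (2 * \<epsilon>)) (\<lambda>x. kern \<epsilon> (y - x))"
    by (rule set_integrable_bounded_continuous[OF open_ball bounded_ball cont, where C = C]) (rule C, simp)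
  then show int: "integrable lborel (\<lambda>x. kern \<epsilon> (y - x))" unfolding set_integrable_def eq .
  then have int': "integrable (lborel \<Otimes>\<^sub>M lborel) (case_prod (\<lambda>r z. kern \<epsilon> (y - (r, z))))"
    unfolding lborel_prod by (simp add: case_prod_beta')
  have "(\<integral>x. kern \<epsilon> (y - x) \<partial>lborel) = (\<integral>r. (\<integral>z. kern \<epsilon> (y - (r, z)) \<partial>lborel) \<partial>lborel)"
    using lborel_pair.integral_fst[OF int'] unfolding lborel_prod by (simp add: case_prod_beta')
  also have "\<dots> = (\<integral>r. bump ((fst y - r) / \<epsilon>) / \<epsilon> * (\<integral>z. bump ((snd y - z) / \<epsilon>) / \<epsilon> \<partial>lborel) \<partial>lborel)"
    by (subst integral_mult_right_zero[symmetric])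
      (auto intro!: Bochner_Integration.integral_cong simp: kern_def power2_eq_square)
  also have "\<dots> = 1" by (simp only: one mult_1_right)
  finally show "(\<integral>x. kern \<epsilon> (y - x) \<partial>lborel) = 1" .
qed

lemma bump_le: "bump t \<le> 30"
proof (cases "0 \<le> t \<and> t \<le> 1")
  case True
  then have "t\<^sup>2 * (1 - t)\<^sup>2 \<le> 1" by (intro mult_le_one) (auto simp: power_le_one)
  then show ?thesis by (simp add: bump_def)
qed (auto simp: bump_def)

lemma kern_le: "kern \<epsilon> y \<le> 900 / \<epsilon>\<^sup>2"
proof -
  have "bump (fst y / \<epsilon>) * bump (snd y / \<epsilon>) \<le> 30 * 30"
    by (intro mult_mono bump_le bump_nonneg) auto
  then show ?thesis unfolding kern_def by (intro divide_right_mono) auto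
qed

text \<open>\<open>negligible\<close> refers to the completed measure. Closedness makes the set
  Borel, so that it is null for \<open>lborel\<close> as well.\<close>

lemma AE_lborel_negligible:
  assumes "negligible N" "closed N"
  shows "AE x in lborel. x \<notin> N"
proof -
  have "N \<in> null_sets (completion lborel)" using assms(1) by (simp add: negligible_iff_null_sets)
  then have "N \<in> null_sets lborel" using assms(2) null_sets_completion_iff[of N lborel] by simp
  then show ?thesis by (rule AE_not_in)
qed

text \<open>Converts the gauge integral, convenient for differentiation under the integral sign,
  into the Lebesgue form to which Fubini's theorem applies.\<close>

lemma edge_kern_eq_set_integral:
  "edge_kern \<epsilon> a b x = (LINT s:{0<..<1}|lborel. kern \<epsilon> (a + s *\<^sub>R (b - a) - x))"
proof -
  have c: "continuous_on A (\<lambda>s. kern \<epsilon> (a + s *\<^sub>R (b - a) - x))" for A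
    by (intro kern_continuous continuous_intros)
  have "set_integrable lborel {0<..<1::real} (\<lambda>s. kern \<epsilon> (a + s *\<^sub>R (b - a) - x))"
    by (rule set_integrable_bounded_continuous[OF _ _ c, where C = "900 / \<epsilon>\<^sup>2"])
      (simp_all add: kern_le kern_nonneg)
  from set_borel_integral_eq_integral(2)[OF this]
  show ?thesis unfolding edge_kern_def by (simp add: integral_open_interval_real)
qed

text \<open>The weights are nonnegative of total mass 1, so the bound \<open>H\<close> is inherited
  uniformly in \<epsilon> and \<open>y\<close>, also when part of the mass falls outside
  \<open>S\<close>.\<close>

lemma kern_average:
  assumes e: "\<epsilon> > 0" and S: "open S" and h: "continuous_on S h" "\<And>x. x \<in> S \<Longrightarrow> \<bar>h x\<bar> \<le> H" "0 \<le> H"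
  shows "integrable lborel (\<lambda>x. indicator S x *\<^sub>R (kern \<epsilon> (y - x) * h x))"
    "\<bar>LINT x:S|lborel. kern \<epsilon> (y - x) * h x\<bar> \<le> H"
proof -
  have cont: "continuous_on S (\<lambda>x. kern \<epsilon> (y - x) * h x)"
    by (intro continuous_intros kern_continuous h)
  have b: "norm (indicator S x *\<^sub>R (kern \<epsilon> (y - x) * h x)) \<le> H * kern \<epsilon> (y - x)" for x
    using h(2)[of x] h(3) kern_nonneg[of \<epsilon> "y - x"]
    by (cases "x \<in> S") (auto simp: abs_mult mult.commute[of H] intro!: mult_left_mono)
  have i: "integrable lborel (\<lambda>x. H * kern \<epsilon> (y - x))"
    using integral_kern(1)[OF e] by simp
  show int: "integrable lborel (\<lambda>x. indicator S x *\<^sub>R (kern \<epsilon> (y - x) * h x))"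
  proof (rule Bochner_Integration.integrable_bound[OF i])
    show "(\<lambda>x. indicator S x *\<^sub>R (kern \<epsilon> (y - x) * h x)) \<in> borel_measurable lborel"
      using borel_measurable_continuous_on_indicator[OF _ cont] S by simp
    show "AE x in lborel. norm (indicator S x *\<^sub>R (kern \<epsilon> (y - x) * h x)) \<le> norm (H * kern \<epsilon> (y - x))"
      using b by (intro AE_I2 order_trans[OF b]) simp
  qed
  have "\<bar>LINT x:S|lborel. kern \<epsilon> (y - x) * h x\<bar> \<le> (\<integral>x. norm (indicator S x *\<^sub>R (kern \<epsilon> (y - x) * h x)) \<partial>lborel)"
    unfolding set_lebesgue_integral_def real_norm_def[symmetric] by (rule integral_norm_bound)
  also have "\<dots> \<le> (\<integral>x. H * kern \<epsilon> (y - x) \<partial>lborel)"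
    by (rule integral_mono[OF integrable_norm[OF int] i b])
  also have "\<dots> = H" using integral_kern(2)[OF e] by simp
  finally show "\<bar>LINT x:S|lborel. kern \<epsilon> (y - x) * h x\<bar> \<le> H" .
qed

text \<open>Once the support of the kernel lies in a small ball inside \<open>R\<close>, the
  integral averages values of \<open>h\<close> close to \<open>h y\<close>. No mass is lost because
  \<open>S\<close> has full measure in \<open>R\<close>.\<close>

lemma kern_average_tendsto:
  assumes e: "\<And>n. e n > 0" "e \<longlonglongrightarrow> 0"
    and S: "open R" "open S" "S \<subseteq> R" "AE x in lborel. x \<in> R \<longrightarrow> x \<in> S"
    and h: "continuous_on R h" "\<And>x. x \<in> R \<Longrightarrow> \<bar>h x\<bar> \<le> H" "0 \<le> H" and y: "y \<in> R"
  shows "(\<lambda>n. LINT x:S|lborel. kern (e n) (y - x) * h x) \<longlonglongrightarrow> h y"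
proof (rule metric_LIMSEQ_I)
  fix \<eta> :: real assume \<eta>: "\<eta> > 0"
  have "isCont h y" using h(1) S(1) y by (simp add: continuous_on_eq_continuous_at)
  then obtain d1 where d1: "d1 > 0" "\<And>x. dist x y < d1 \<Longrightarrow> dist (h x) (h y) < \<eta> / 2"
    unfolding continuous_at_eps_delta using \<eta> by (metis half_gt_zero)
  obtain d2 where d2: "d2 > 0" "ball y d2 \<subseteq> R" using S(1) y by (metis openE)
  define d where "d = min d1 d2"
  have d: "d > 0" using d1 d2 by (simp add: d_def)
  obtain N where N: "\<And>n. n \<ge> N \<Longrightarrow> \<bar>e n\<bar> < d / 2"
    using LIMSEQ_D[OF e(2), of "d / 2"] d by auto
  show "\<exists>N. \<forall>n\<ge>N. dist (LINT x:S|lborel. kern (e n) (y - x) * h x) (h y) < \<eta>"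
  proof (intro exI[of _ N] allI impI)
    fix n assume "n \<ge> N"
    then have n: "2 * e n < d" using N[of n] by auto
    have iS: "integrable lborel (\<lambda>x. indicator S x *\<^sub>R (kern (e n) (y - x) * h x))"
      by (rule kern_average(1)[OF e(1) S(2) continuous_on_subset[OF h(1) S(3)]]) (use h S(3) in auto)
    have ik: "integrable lborel (\<lambda>x. kern (e n) (y - x))" by (rule integral_kern(1)[OF e(1)])
    \<comment> \<open>The unit mass of the kernel turns \<open>h y\<close> into an integral over the
      whole plane.\<close>
    have eq: "(LINT x:S|lborel. kern (e n) (y - x) * h x) - h y
        = (\<integral>x. indicator S x *\<^sub>R (kern (e n) (y - x) * h x) - h y * kern (e n) (y - x) \<partial>lborel)"
      using iS ik integral_kern(2)[OF e(1)] by (simp add: set_lebesgue_integral_def)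
    have "\<bar>(LINT x:S|lborel. kern (e n) (y - x) * h x) - h y\<bar>
        \<le> (\<integral>x. norm (indicator S x *\<^sub>R (kern (e n) (y - x) * h x) - h y * kern (e n) (y - x)) \<partial>lborel)"
      unfolding eq real_norm_def[symmetric] by (rule integral_norm_bound)
    also have "\<dots> \<le> (\<integral>x. \<eta> / 2 * kern (e n) (y - x) \<partial>lborel)"
    proof (rule integral_mono_AE)
      show "integrable lborel (\<lambda>x. norm (indicator S x *\<^sub>R (kern (e n) (y - x) * h x) - h y * kern (e n) (y - x)))"
        using iS ik by (intro integrable_norm Bochner_Integration.integrable_diff) auto
      show "integrable lborel (\<lambda>x. \<eta> / 2 * kern (e n) (y - x))" using ik by simp
      show "AE x in lborel. norm (indicator S x *\<^sub>R (kern (e n) (y - x) * h x) - h y * kern (e n) (y - x))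
        \<le> \<eta> / 2 * kern (e n) (y - x)"
        using S(4)
      proof eventually_elim
        case (elim x)
        show ?case
        proof (cases "kern (e n) (y - x) = 0")
          case False
          then have "norm (y - x) < 2 * e n" by (rule kern_support[OF e(1)])
          then have xd: "dist x y < d" using n by (simp add: dist_norm norm_minus_commute)
          then have "x \<in> R" using d2(2) by (auto simp: d_def dist_commute)
          then have "x \<in> S" using elim by blast
          moreover have "\<bar>h x - h y\<bar> \<le> \<eta> / 2"
            using d1(2)[of x] xd by (simp add: d_def dist_real_def)
          then have "kern (e n) (y - x) * \<bar>h x - h y\<bar> \<le> kern (e n) (y - x) * (\<eta> / 2)"
            by (intro mult_left_mono kern_nonneg)
          moreover have "kern (e n) (y - x) * h x - h y * kern (e n) (y - x) = kern (e n) (y - x) * (h x - h y)"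
            by (simp add: algebra_simps)
          ultimately show ?thesis by (simp add: abs_mult kern_nonneg mult.commute)
        qed simp
      qed
    qed
    also have "\<dots> = \<eta> / 2" using integral_kern(2)[OF e(1)] by simp
    finally show "dist (LINT x:S|lborel. kern (e n) (y - x) * h x) (h y) < \<eta>"
      using \<eta> by (simp add: dist_real_def)
  qed
qed

text \<open>By Fubini's theorem the left side is an integral along the edge of kernel averages of
  \<open>h\<close>, which converge at each interior point of the edge and are bounded by
  \<open>H\<close>. The condition concerns the open edge, because the first and last vertex of the
  curve lie on the axis.\<close>

lemma mollified_edge_tendsto:
  fixes a b :: point
  assumes e: "\<And>n. e n > 0" "e \<longlonglongrightarrow> 0"
    and S: "open R" "bounded R" "open S" "S \<subseteq> R" "AE x in lborel. x \<in> R \<longrightarrow> x \<in> S"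
    and h: "continuous_on R h" "\<And>x. x \<in> R \<Longrightarrow> \<bar>h x\<bar> \<le> H" "0 \<le> H"
    and ab: "\<And>s. 0 < s \<Longrightarrow> s < 1 \<Longrightarrow> a + s *\<^sub>R (b - a) \<in> R"
  shows "(\<lambda>n. LINT x:S|lborel. edge_kern (e n) a b x * h x)
    \<longlonglongrightarrow> (LINT s:{0<..<1}|lborel. h (a + s *\<^sub>R (b - a)))"
proof -
  define X where "X = (\<lambda>s. a + s *\<^sub>R (b - a))"
  have bS: "bounded S" using S(2,4) bounded_subset by blast
  have hS: "continuous_on S h" "\<And>x. x \<in> S \<Longrightarrow> \<bar>h x\<bar> \<le> H"
    using h S(4) continuous_on_subset by blast+
  define m where "m = (\<lambda>n s. LINT x:S|lborel. kern (e n) (X s - x) * h x)"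
  define k where "k = (\<lambda>n s x. indicator {0<..<1} s * indicator S x * (kern (e n) (X s - x) * h x) :: real)"
  \<comment> \<open>The integrand is bounded and continuous on a bounded open product; 900 is the
    square of the bound 30 for \<open>bump\<close>.\<close>
  have ik: "integrable (lborel \<Otimes>\<^sub>M lborel) (case_prod (k n))" for n
  proof -
    have "set_integrable lborel ({0<..<1} \<times> S) (\<lambda>z. kern (e n) (X (fst z) - snd z) * h (snd z))"
    proof (rule set_integrable_bounded_continuous[where C = "900 / (e n)\<^sup>2 * H"])
      show "open ({0<..<1::real} \<times> S)" using S(3) by (intro open_Times) auto
      show "bounded ({0<..<1::real} \<times> S)" using bS by (intro bounded_Times) auto
      show "continuous_on ({0<..<1} \<times> S) (\<lambda>z. kern (e n) (X (fst z) - snd z) * h (snd z))"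
        unfolding X_def
        by (intro continuous_intros kern_continuous continuous_on_compose2[OF hS(1)]) auto
      fix z :: "real \<times> point" assume "z \<in> {0<..<1} \<times> S"
      then have "\<bar>h (snd z)\<bar> \<le> H" using hS(2) by auto
      then have "kern (e n) (X (fst z) - snd z) * \<bar>h (snd z)\<bar> \<le> 900 / (e n)\<^sup>2 * H"
        by (intro mult_mono kern_le) auto
      then show "norm (kern (e n) (X (fst z) - snd z) * h (snd z)) \<le> 900 / (e n)\<^sup>2 * H"
        by (simp add: abs_mult kern_nonneg)
    qed
    then show ?thesis
      unfolding set_integrable_def lborel_prod k_def
      by (rule back_subst[of "integrable lborel"]) (auto simp: indicator_def fun_eq_iff)
  qed
  have eq1: "(\<integral>x. k n s x \<partial>lborel) = indicator {0<..<1} s *\<^sub>R m n s" for n s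
    unfolding k_def m_def set_lebesgue_integral_def by (simp add: mult.assoc)
  have eq2: "(\<integral>s. k n s x \<partial>lborel) = indicator S x *\<^sub>R (edge_kern (e n) a b x * h x)" for n x
  proof -
    have "(\<integral>s. k n s x \<partial>lborel) = (\<integral>s. (indicator {0<..<1} s *\<^sub>R kern (e n) (X s - x)) * (indicator S x * h x) \<partial>lborel)"
      unfolding k_def by (intro Bochner_Integration.integral_cong) (auto simp: mult_ac)
    also have "\<dots> = edge_kern (e n) a b x * (indicator S x * h x)"
      unfolding edge_kern_eq_set_integral set_lebesgue_integral_def X_def by (rule integral_mult_left_zero)
    finally show ?thesis by (simp add: mult_ac)
  qed
  have "(LINT x:S|lborel. edge_kern (e n) a b x * h x) = (\<integral>s. indicator {0<..<1} s *\<^sub>R m n s \<partial>lborel)" for n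
    using lborel_pair.integral_fst[OF ik[of n]] lborel_pair.integral_snd[OF ik[of n]]
    unfolding eq1 eq2 set_lebesgue_integral_def by simp
  moreover have "(\<lambda>n. \<integral>s. indicator {0<..<1} s *\<^sub>R m n s \<partial>lborel)
      \<longlonglongrightarrow> (\<integral>s. indicator {0<..<1} s *\<^sub>R h (X s) \<partial>lborel)"
  proof (rule integral_dominated_convergence)
    have cX: "continuous_on {0<..<1} (\<lambda>s. h (X s))"
      using ab unfolding X_def
      by (intro continuous_on_compose2[OF h(1)] continuous_intros) auto
    show "(\<lambda>s. indicator {0<..<1} s *\<^sub>R h (X s)) \<in> borel_measurable lborel"
      using borel_measurable_continuous_on_indicator[OF _ cX] by simp
    show "(\<lambda>s. indicator {0<..<1} s *\<^sub>R m n s) \<in> borel_measurable lborel" for n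
      using lborel_pair.integrable_fst[OF ik[of n]] unfolding eq1 by simp
    have "set_integrable lborel {0<..<1::real} (\<lambda>s. H)"
      by (rule set_integrable_bounded_continuous[where C = H]) (use h(3) in auto)
    then show "integrable lborel (\<lambda>s. indicator {0<..<1::real} s *\<^sub>R H)" unfolding set_integrable_def .
    show "AE s in lborel. (\<lambda>n. indicator {0<..<1} s *\<^sub>R m n s) \<longlonglongrightarrow> indicator {0<..<1} s *\<^sub>R h (X s)"
    proof (rule AE_I2)
      fix s :: real
      show "(\<lambda>n. indicator {0<..<1} s *\<^sub>R m n s) \<longlonglongrightarrow> indicator {0<..<1} s *\<^sub>R h (X s)"
      proof (cases "s \<in> {0<..<1}")
        case True
        then have "X s \<in> R" using ab unfolding X_def by simp
        then have "(\<lambda>n. m n s) \<longlonglongrightarrow> h (X s)"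
          unfolding m_def by - (rule kern_average_tendsto[OF e S(1,3,4,5) h], assumption+)
        then show ?thesis using True by simp
      qed simp
    qed
    show "AE s in lborel. norm (indicator {0<..<1} s *\<^sub>R m n s) \<le> indicator {0<..<1} s *\<^sub>R H" for n
    proof (rule AE_I2)
      fix s :: real
      have "\<bar>m n s\<bar> \<le> H" unfolding m_def by (rule kern_average(2)[OF e(1) S(3) hS h(3)])
      then show "norm (indicator {0<..<1} s *\<^sub>R m n s) \<le> indicator {0<..<1} s *\<^sub>R H"
        by (cases "s \<in> {0<..<1}") auto
    qed
  qed
  ultimately show ?thesis unfolding set_lebesgue_integral_def X_def by simp
qed

subsection \<open>The flux through a polygonal line\<close>

text \<open>End-point terms cancel at common vertices. Those of the first and last vertex vanish
  because \<open>c 0 - x\<close> and \<open>c J - x\<close> have negative first coordinate, where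
  \<open>kern_prim\<close> is 0.\<close>

lemma crossing_grad_sum:
  assumes e: "\<epsilon> > 0" and c: "fst (c 0) = 0" "fst (c J) = 0" and x: "fst x > 0"
  shows "(\<Sum>j<J. crossing_grad \<epsilon> (c j) (c (Suc j)) x)
    = - (\<Sum>j<J. edge_kern \<epsilon> (c j) (c (Suc j)) x *\<^sub>R perp (c (Suc j) - c j))"
proof -
  have "(\<Sum>j<J. crossing_grad \<epsilon> (c j) (c (Suc j)) x)
    = - (\<Sum>j<J. edge_kern \<epsilon> (c j) (c (Suc j)) x *\<^sub>R perp (c (Suc j) - c j))
      - (\<Sum>j<J. (0, kern_prim \<epsilon> (c (Suc j) - x)) - (0, kern_prim \<epsilon> (c j - x)))"
    unfolding crossing_grad_def by (simp add: sum_subtractf sum_negf)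
  also have "(\<Sum>j<J. (0::real, kern_prim \<epsilon> (c (Suc j) - x)) - (0, kern_prim \<epsilon> (c j - x)))
      = (0, kern_prim \<epsilon> (c J - x)) - (0, kern_prim \<epsilon> (c 0 - x))"
    by (rule sum_lessThan_telescope)
  also have "\<dots> = 0"
    using kern_prim_eq_0[OF e, of "c J - x"] kern_prim_eq_0[OF e, of "c 0 - x"] c x by (simp add: zero_prod_def)
  finally show ?thesis by simp
qed

lemma edge_kern_eq_0:
  assumes e: "\<epsilon> > 0" and far: "\<And>y. y \<in> closed_segment a b \<Longrightarrow> 2 * \<epsilon> \<le> dist x y"
  shows "edge_kern \<epsilon> a b x = 0"
proof -
  have "kern \<epsilon> (a + s *\<^sub>R (b - a) - x) = 0" if "s \<in> {0..1}" for s
  proof (rule ccontr)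
    assume "kern \<epsilon> (a + s *\<^sub>R (b - a) - x) \<noteq> 0"
    from kern_support[OF e this] have "dist x (a + s *\<^sub>R (b - a)) < 2 * \<epsilon>"
      by (simp add: dist_norm norm_minus_commute)
    moreover have "a + s *\<^sub>R (b - a) \<in> closed_segment a b"
      unfolding in_segment using that by (intro exI[of _ s]) (auto simp: algebra_simps)
    ultimately show False using far by fastforce
  qed
  then show ?thesis unfolding edge_kern_def by (metis (mono_tags, lifting) integral_0 integral_cong)
qed

lemma crossing_sum_bound:
  "\<epsilon> > 0 \<Longrightarrow> \<bar>\<Sum>j<J. crossing \<epsilon> (c j) (c (Suc j)) x\<bar> \<le> real J"
  using sum_norm_bound[of "{..<J}" "\<lambda>j. crossing \<epsilon> (c j) (c (Suc j)) x" 1] crossing_bound by simp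

lemma crossing_sum_has_derivative:
  "\<epsilon> > 0 \<Longrightarrow> ((\<lambda>x. \<Sum>j<J. crossing \<epsilon> (c j) (c (Suc j)) x) has_derivative
    (\<lambda>h. h \<bullet> (\<Sum>j<J. crossing_grad \<epsilon> (c j) (c (Suc j)) x))) (at x)"
  unfolding inner_sum_right by (intro has_derivative_sum crossing_has_derivative)

lemma crossing_sum_continuous:
  "\<epsilon> > 0 \<Longrightarrow> continuous_on A (\<lambda>x. \<Sum>j<J. crossing \<epsilon> (c j) (c (Suc j)) x)"
  by (rule continuous_at_imp_continuous_on)
    (use crossing_sum_has_derivative has_derivative_continuous in blast)

text \<open>A path from \<open>p0\<close> to \<open>p\<close> inside \<open>Q\<close> is compact and
  keeps a positive distance from the polygonal line. When the kernels are finer than this distance,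
  the gradient of the sum vanishes near the path. The threshold depends on \<open>p\<close>, as
  points of \<open>Q\<close> may come arbitrarily close to the line.\<close>

lemma crossing_sum_eventually_const:
  assumes c: "fst (c 0) = 0" "fst (c J) = 0"
    and Q: "open Q" "connected Q" "Q \<subseteq> {x. fst x > 0}" "Q \<inter> (\<Union>j<J. closed_segment (c j) (c (Suc j))) = {}"
    and p: "p \<in> Q" "p0 \<in> Q"
  obtains e0 where "e0 > 0" "\<And>\<epsilon>. 0 < \<epsilon> \<Longrightarrow> \<epsilon> < e0 \<Longrightarrow>
    (\<Sum>j<J. crossing \<epsilon> (c j) (c (Suc j)) p) = (\<Sum>j<J. crossing \<epsilon> (c j) (c (Suc j)) p0)"
proof -
  define \<Gamma> where "\<Gamma> = (\<Union>j<J. closed_segment (c j) (c (Suc j)))"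
  have clG: "closed \<Gamma>" unfolding \<Gamma>_def by (intro closed_UN) auto
  have "path_connected Q" using Q(1,2) by (simp add: connected_open_path_connected)
  then obtain g where g: "path g" "path_image g \<subseteq> Q" "pathstart g = p0" "pathfinish g = p"
    using p unfolding path_connected_def by blast
  have "compact (path_image g)" using g(1) by (rule compact_path_image)
  moreover have "path_image g \<inter> \<Gamma> = {}" using g(2) Q(4) unfolding \<Gamma>_def by blast
  ultimately obtain d where d: "d > 0" "\<And>x y. x \<in> path_image g \<Longrightarrow> y \<in> \<Gamma> \<Longrightarrow> d \<le> dist x y"
    using separate_compact_closed clG by metis
  \<comment> \<open>Points within \<open>d / 2\<close> of the path keep distance
    \<open>d / 2\<close> from the line, more than the kernel range \<open>2 * \<epsilon>\<close>
    when \<epsilon> < d / 4.\<close>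
  define W where "W = Q \<inter> (\<Union>x\<in>path_image g. ball x (d / 2))"
  have W: "open W" unfolding W_def using Q(1) by auto
  have gW: "path_image g \<subseteq> W" unfolding W_def using g(2) d(1) by force
  have Wd: "d / 2 \<le> dist x y" if x: "x \<in> W" and y: "y \<in> \<Gamma>" for x y
  proof -
    obtain z where z: "z \<in> path_image g" "dist z x < d / 2" using x unfolding W_def by auto
    show ?thesis using d(2)[OF z(1) y] z(2) dist_triangle[of z y x] by linarith
  qed
  \<comment> \<open>A zero derivative yields a constant on a connected open set; the connected path
    lies in a single component of \<open>W\<close>.\<close>
  define C where "C = connected_component_set W p0"
  have p0g: "p0 \<in> path_image g" "p \<in> path_image g" using g(3,4) by (metis pathstart_in_path_image pathfinish_in_path_image)+
  have "path_image g \<subseteq> C" unfolding C_def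
    by (rule connected_component_maximal[OF p0g(1) connected_path_image[OF g(1)] gW])
  then have pC: "p \<in> C" "p0 \<in> C" using p0g by auto
  have oC: "open C" unfolding C_def by (rule open_connected_component[OF W])
  have CW: "C \<subseteq> W" unfolding C_def by (rule connected_component_subset)
  show ?thesis
  proof (rule that[of "d / 4"])
    show "d / 4 > 0" using d by simp
    fix \<epsilon> assume e: "0 < \<epsilon>" "\<epsilon> < d / 4"
    have der: "((\<lambda>x. \<Sum>j<J. crossing \<epsilon> (c j) (c (Suc j)) x) has_derivative (\<lambda>h. 0)) (at x within C)" if x: "x \<in> C" for x
    proof -
      have "((\<lambda>x. \<Sum>j<J. crossing \<epsilon> (c j) (c (Suc j)) x) has_derivative
        (\<lambda>h. \<Sum>j<J. h \<bullet> crossing_grad \<epsilon> (c j) (c (Suc j)) x)) (at x)"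
        by (intro has_derivative_sum crossing_has_derivative e)
      moreover have "(\<Sum>j<J. h \<bullet> crossing_grad \<epsilon> (c j) (c (Suc j)) x) = 0" for h
      proof -
        have xW: "x \<in> W" using x CW by blast
        then have "fst x > 0" using Q(3) unfolding W_def by blast
        moreover have "edge_kern \<epsilon> (c j) (c (Suc j)) x = 0" if "j < J" for j
        proof (rule edge_kern_eq_0[OF e(1)])
          fix y assume "y \<in> closed_segment (c j) (c (Suc j))"
          then have "y \<in> \<Gamma>" using that unfolding \<Gamma>_def by blast
          then show "2 * \<epsilon> \<le> dist x y" using Wd[OF xW] e(2) by fastforce
        qed
        ultimately have "(\<Sum>j<J. crossing_grad \<epsilon> (c j) (c (Suc j)) x) = 0"
          using crossing_grad_sum[OF e(1) c] by simp
        then show ?thesis by (simp flip: inner_sum_right)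
      qed
      ultimately show ?thesis by (simp add: has_derivative_at_withinI)
    qed
    then have "(\<lambda>x. \<Sum>j<J. crossing \<epsilon> (c j) (c (Suc j)) x) constant_on C"
      using oC by (intro has_derivative_zero_connected_constant_on[where K = "{}"])
        (auto simp: C_def intro: crossing_sum_continuous[OF e(1)])
    then show "(\<Sum>j<J. crossing \<epsilon> (c j) (c (Suc j)) p) = (\<Sum>j<J. crossing \<epsilon> (c j) (c (Suc j)) p0)"
      using pC unfolding constant_on_def by metis
  qed
qed

text \<open>Since \<open>D\<close> has integral 0, the value of the sum at a fixed \<open>p0\<close>
  can be subtracted without changing the integral. The differences are bounded by twice the number
  of edges and eventually 0 at each point, whether or not the values at \<open>p0\<close>
  converge.\<close>

lemma component_integral_tendsto_0:
  fixes D :: "point \<Rightarrow> real"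
  assumes c: "fst (c 0) = 0" "fst (c J) = 0"
    and Q: "open Q" "connected Q" "Q \<noteq> {}" "Q \<subseteq> {x. fst x > 0}"
      "Q \<inter> (\<Union>j<J. closed_segment (c j) (c (Suc j))) = {}"
    and S: "open S" "bounded S" "S \<subseteq> Q"
    and D: "continuous_on S D" "\<And>x. x \<in> S \<Longrightarrow> \<bar>D x\<bar> \<le> C" "(LINT x:S|lborel. D x) = 0"
    and e: "\<And>n. e n > 0" "e \<longlonglongrightarrow> 0"
  shows "(\<lambda>n. LINT x:S|lborel. (\<Sum>j<J. crossing (e n) (c j) (c (Suc j)) x) * D x) \<longlonglongrightarrow> 0"
proof -
  define \<Phi> where "\<Phi> = (\<lambda>n x. \<Sum>j<J. crossing (e n) (c j) (c (Suc j)) x)"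
  obtain p0 where p0: "p0 \<in> Q" using Q(3) by blast
  have cP: "continuous_on A (\<Phi> n)" for A n unfolding \<Phi>_def by (rule crossing_sum_continuous[OF e(1)])
  have bP: "\<bar>\<Phi> n x\<bar> \<le> real J" for n x unfolding \<Phi>_def by (rule crossing_sum_bound[OF e(1)])
  have iD: "set_integrable lborel S D"
    by (rule set_integrable_bounded_continuous[OF S(1,2) D(1)]) (use D(2) in simp)
  have iPD: "set_integrable lborel S (\<lambda>x. \<Phi> n x * D x)" for n
  proof (rule set_integrable_bounded_continuous[OF S(1,2), where C = "real J * C"])
    fix x assume "x \<in> S"
    then have "\<bar>\<Phi> n x\<bar> * \<bar>D x\<bar> \<le> real J * C" using D(2) bP by (intro mult_mono) auto
    then show "norm (\<Phi> n x * D x) \<le> real J * C" by (simp add: abs_mult)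
  qed (intro continuous_intros cP D)
  have "(LINT x:S|lborel. \<Phi> n x * D x) = (\<integral>x. indicator S x *\<^sub>R ((\<Phi> n x - \<Phi> n p0) * D x) \<partial>lborel)" for n
  proof -
    have "(LINT x:S|lborel. \<Phi> n x * D x - \<Phi> n p0 * D x) = (LINT x:S|lborel. \<Phi> n x * D x) - (LINT x:S|lborel. \<Phi> n p0 * D x)"
      using iPD iD by (intro set_integral_diff) auto
    then show ?thesis using D(3) by (simp add: set_lebesgue_integral_def left_diff_distrib)
  qed
  moreover have "(\<lambda>n. \<integral>x. indicator S x *\<^sub>R ((\<Phi> n x - \<Phi> n p0) * D x) \<partial>lborel) \<longlonglongrightarrow> (\<integral>x. 0 \<partial>(lborel::point measure))"
  proof (rule integral_dominated_convergence)
    show "(\<lambda>x. indicator S x *\<^sub>R ((\<Phi> n x - \<Phi> n p0) * D x)) \<in> borel_measurable lborel" for n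
      using borel_measurable_continuous_on_indicator[of S "\<lambda>x. (\<Phi> n x - \<Phi> n p0) * D x"] S(1)
      by (simp add: continuous_intros cP D(1))
    have "set_integrable lborel S (\<lambda>x. 2 * real J * C)"
      by (rule set_integrable_bounded_continuous[OF S(1,2), where C = "\<bar>2 * real J * C\<bar>"]) auto
    then show "integrable lborel (\<lambda>x. indicator S x *\<^sub>R (2 * real J * C))" unfolding set_integrable_def .
    show "AE x in lborel. norm (indicator S x *\<^sub>R ((\<Phi> n x - \<Phi> n p0) * D x)) \<le> indicator S x *\<^sub>R (2 * real J * C)" for n
    proof (rule AE_I2)
      fix x
      show "norm (indicator S x *\<^sub>R ((\<Phi> n x - \<Phi> n p0) * D x)) \<le> indicator S x *\<^sub>R (2 * real J * C)"
      proof (cases "x \<in> S")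
        case True
        have "\<bar>\<Phi> n x - \<Phi> n p0\<bar> \<le> 2 * real J" using bP[of n x] bP[of n p0] by linarith
        then have "\<bar>\<Phi> n x - \<Phi> n p0\<bar> * \<bar>D x\<bar> \<le> 2 * real J * C" using D(2)[OF True] by (intro mult_mono) auto
        then show ?thesis using True by (simp add: abs_mult)
      qed simp
    qed
    show "AE x in lborel. (\<lambda>n. indicator S x *\<^sub>R ((\<Phi> n x - \<Phi> n p0) * D x)) \<longlonglongrightarrow> 0"
    proof (rule AE_I2)
      fix x
      show "(\<lambda>n. indicator S x *\<^sub>R ((\<Phi> n x - \<Phi> n p0) * D x)) \<longlonglongrightarrow> 0"
      proof (cases "x \<in> S")
        case True
        then have xQ: "x \<in> Q" using S(3) by blast
        obtain e0 where e0: "e0 > 0" "\<And>\<epsilon>. 0 < \<epsilon> \<Longrightarrow> \<epsilon> < e0 \<Longrightarrow>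
            (\<Sum>j<J. crossing \<epsilon> (c j) (c (Suc j)) x) = (\<Sum>j<J. crossing \<epsilon> (c j) (c (Suc j)) p0)"
          using crossing_sum_eventually_const[OF c Q(1,2,4,5) xQ p0] by blast
        have "\<forall>\<^sub>F n in sequentially. e n < e0" using order_tendstoD(2)[OF e(2) e0(1)] .
        then have "\<forall>\<^sub>F n in sequentially. indicator S x *\<^sub>R ((\<Phi> n x - \<Phi> n p0) * D x) = 0"
          by eventually_elim (use e0(2) e(1) in \<open>simp add: \<Phi>_def\<close>)
        then show ?thesis by (rule tendsto_eventually)
      qed simp
    qed
  qed simp_all
  ultimately show ?thesis unfolding \<Phi>_def by simp
qed

lemma set_integral_split:
  fixes f :: "point \<Rightarrow> real"
  assumes S: "open S" "bounded S" "continuous_on S f" "\<And>x. x \<in> S \<Longrightarrow> \<bar>f x\<bar> \<le> C"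
    and AB: "open A" "open B" "A \<inter> B = {}" "S - N \<subseteq> A \<union> B" and N: "negligible N" "closed N"
  shows "(LINT x:S|lborel. f x) = (LINT x:S \<inter> A|lborel. f x) + (LINT x:S \<inter> B|lborel. f x)"
proof -
  have i: "set_integrable lborel (S \<inter> T) f" if "open T" for T
    by (rule set_integrable_bounded_continuous[where C = C])
      (use S that in \<open>auto intro: continuous_on_subset\<close>)
  have i': "set_integrable lborel S f" using i[of UNIV] by simp
  have "(LINT x:S|lborel. f x) = (\<integral>x. indicator (S \<inter> A) x *\<^sub>R f x + indicator (S \<inter> B) x *\<^sub>R f x \<partial>lborel)"
    unfolding set_lebesgue_integral_def
  proof (rule integral_cong_AE)
    show "(\<lambda>x. indicat_real S x *\<^sub>R f x) \<in> borel_measurable lborel"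
      using i' unfolding set_integrable_def by simp
    show "(\<lambda>x. indicator (S \<inter> A) x *\<^sub>R f x + indicator (S \<inter> B) x *\<^sub>R f x) \<in> borel_measurable lborel"
      using i[OF AB(1)] i[OF AB(2)] unfolding set_integrable_def by (intro borel_measurable_add) auto
    show "AE x in lborel. indicat_real S x *\<^sub>R f x = indicator (S \<inter> A) x *\<^sub>R f x + indicator (S \<inter> B) x *\<^sub>R f x"
      using AE_lborel_negligible[OF N]
    proof eventually_elim
      case (elim x)
      then show ?case using AB(3,4) by (auto simp: indicator_def)
    qed
  qed
  also have "\<dots> = (LINT x:S \<inter> A|lborel. f x) + (LINT x:S \<inter> B|lborel. f x)"
    using i[OF AB(1)] i[OF AB(2)] unfolding set_integrable_def set_lebesgue_integral_def
    by (intro Bochner_Integration.integral_add) auto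
  finally show ?thesis .
qed

text \<open>The smoothed crossing count is an admissible \<phi> in the weak identity. The term with
  \<open>D\<close> tends to 0 because it does so on each component, and the gradient term tends to
  the flux up to sign because \<open>edge_kern\<close> concentrates on the edges.\<close>

lemma flux_eq_0:
  fixes V :: "point \<Rightarrow> point" and D :: "point \<Rightarrow> real"
  assumes R: "open R" "bounded R" "R \<subseteq> {x. fst x > 0}"
    and S: "open S" "S \<subseteq> R" "AE x in lborel. x \<in> R \<longrightarrow> x \<in> S"
    and V: "continuous_on (closure R) V"
    and D: "continuous_on S D" "\<And>x. x \<in> S \<Longrightarrow> \<bar>D x\<bar> \<le> C"
    and weak: "\<And>\<phi> \<phi>'. (\<And>x. (\<phi> has_derivative (\<lambda>h. h \<bullet> \<phi>' x)) (at x)) \<Longrightarrow> continuous_on UNIV \<phi>' \<Longrightarrow>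
      (LINT x:S|lborel. \<phi> x * D x + V x \<bullet> \<phi>' x) = 0"
    and c: "fst (c 0) = 0" "fst (c J) = 0"
      "\<And>j s. j < J \<Longrightarrow> 0 < s \<Longrightarrow> s < 1 \<Longrightarrow> c j + s *\<^sub>R (c (Suc j) - c j) \<in> R"
    and Q: "open A" "connected A" "A \<noteq> {}" "open B" "connected B" "B \<noteq> {}" "A \<inter> B = {}"
      "A \<union> B = R - (\<Union>j<J. closed_segment (c j) (c (Suc j)))"
    and DQ: "(LINT x:S \<inter> A|lborel. D x) = 0" "(LINT x:S \<inter> B|lborel. D x) = 0"
  shows "(\<Sum>j<J. LINT s:{0<..<1}|lborel. V (c j + s *\<^sub>R (c (Suc j) - c j)) \<bullet> perp (c (Suc j) - c j)) = 0"
proof -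
  define N where "N = (\<Union>j<J. closed_segment (c j) (c (Suc j)))"
  have N: "negligible N" "closed N" unfolding N_def
    by (auto intro!: negligible_Union closed_UN simp: negligible_closed_segment)
  have bS: "bounded S" using R(2) S(2) bounded_subset by blast
  define e where "e = (\<lambda>n. inverse (real (Suc n)))"
  have e: "e n > 0" "e \<longlonglongrightarrow> 0" for n
    unfolding e_def using LIMSEQ_inverse_real_of_nat by auto
  define \<Phi> where "\<Phi> = (\<lambda>n x. \<Sum>j<J. crossing (e n) (c j) (c (Suc j)) x)"
  have bP: "\<bar>\<Phi> n x\<bar> \<le> real J" for n x unfolding \<Phi>_def by (rule crossing_sum_bound[OF e(1)])
  have cP: "continuous_on T (\<Phi> n)" for T n unfolding \<Phi>_def by (rule crossing_sum_continuous[OF e(1)])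
  have cPD: "continuous_on S (\<lambda>x. \<Phi> n x * D x)" for n by (intro continuous_intros cP D)
  have bPD: "\<bar>\<Phi> n x * D x\<bar> \<le> real J * C" if "x \<in> S" for n x
    unfolding abs_mult using D(2)[OF that] bP by (intro mult_mono) auto
  have iPD: "set_integrable lborel S (\<lambda>x. \<Phi> n x * D x)" for n
    by (rule set_integrable_bounded_continuous[OF S(1) bS cPD]) (use bPD in simp)
  have lim0: "(\<lambda>n. LINT x:S|lborel. \<Phi> n x * D x) \<longlonglongrightarrow> 0"
  proof -
    have AR: "A \<subseteq> R" "B \<subseteq> R" "A \<inter> N = {}" "B \<inter> N = {}" "S - N \<subseteq> A \<union> B"
      using Q(8) S(2) unfolding N_def by blast+
    have 1: "(\<lambda>n. LINT x:S \<inter> A|lborel. \<Phi> n x * D x) \<longlonglongrightarrow> 0"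
      unfolding \<Phi>_def
      by (rule component_integral_tendsto_0[OF c(1,2) Q(1,2,3) _ _ _ _ _ _ _ DQ(1) e])
        (use AR R S bS Q(1) D in \<open>auto simp: N_def intro: continuous_on_subset bounded_subset\<close>)
    have 2: "(\<lambda>n. LINT x:S \<inter> B|lborel. \<Phi> n x * D x) \<longlonglongrightarrow> 0"
      unfolding \<Phi>_def
      by (rule component_integral_tendsto_0[OF c(1,2) Q(4,5,6) _ _ _ _ _ _ _ DQ(2) e])
        (use AR R S bS Q(4) D in \<open>auto simp: N_def intro: continuous_on_subset bounded_subset\<close>)
    have "(LINT x:S|lborel. \<Phi> n x * D x)
        = (LINT x:S \<inter> A|lborel. \<Phi> n x * D x) + (LINT x:S \<inter> B|lborel. \<Phi> n x * D x)" for n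
      by (rule set_integral_split[OF S(1) bS cPD bPD Q(1,4,7) AR(5) N])
    then show ?thesis using tendsto_add[OF 1 2] by simp
  qed
  define h where "h = (\<lambda>j x. V x \<bullet> perp (c (Suc j) - c j))"
  have cR: "compact (closure R)" using R(2) by simp
  have ch: "continuous_on (closure R) (h j)" for j unfolding h_def by (intro continuous_intros V)
  have RR: "R \<subseteq> closure R" by (rule closure_subset)
  have chR: "continuous_on R (h j)" for j by (rule continuous_on_subset[OF ch RR])
  have SR: "S \<subseteq> closure R" using S(2) RR by blast
  have "\<exists>H\<ge>0. \<forall>x\<in>closure R. \<bar>h j x\<bar> \<le> H" for j
  proof -
    obtain H where "\<forall>x\<in>closure R. \<bar>h j x\<bar> \<le> H"
      using compact_imp_bounded[OF compact_continuous_image[OF ch cR]] unfolding bounded_iff by auto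
    then show ?thesis by (intro exI[of _ "\<bar>H\<bar>"]) (auto intro: order_trans)
  qed
  then obtain H where H: "\<And>j. 0 \<le> H j" "\<And>j x. x \<in> closure R \<Longrightarrow> \<bar>h j x\<bar> \<le> H j" by metis
  have iE: "set_integrable lborel S (\<lambda>x. edge_kern (e n) (c j) (c (Suc j)) x * h j x)" for n j
  proof -
    have ce: "continuous_on (closure R) (\<lambda>x. edge_kern (e n) (c j) (c (Suc j)) x * h j x)"
      by (intro continuous_intros edge_kern_continuous ch)
    obtain K where K: "\<And>x. x \<in> closure R \<Longrightarrow> norm (edge_kern (e n) (c j) (c (Suc j)) x * h j x) \<le> K"
      using compact_imp_bounded[OF compact_continuous_image[OF ce cR]] unfolding bounded_iff by blast
    show ?thesis
      by (rule set_integrable_bounded_continuous[OF S(1) bS continuous_on_subset[OF ce SR], where C = K])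
        (use K SR in blast)
  qed
  have key: "(LINT x:S|lborel. \<Phi> n x * D x) = (\<Sum>j<J. LINT x:S|lborel. edge_kern (e n) (c j) (c (Suc j)) x * h j x)" for n
  proof -
    have "(LINT x:S|lborel. \<Phi> n x * D x + V x \<bullet> (\<Sum>j<J. crossing_grad (e n) (c j) (c (Suc j)) x)) = 0"
    proof (rule weak)
      show "(\<Phi> n has_derivative (\<lambda>h. h \<bullet> (\<Sum>j<J. crossing_grad (e n) (c j) (c (Suc j)) x))) (at x)" for x
        unfolding \<Phi>_def by (rule crossing_sum_has_derivative[OF e(1)])
      show "continuous_on UNIV (\<lambda>x. \<Sum>j<J. crossing_grad (e n) (c j) (c (Suc j)) x)"
        by (intro continuous_intros crossing_grad_continuous)
    qed
    moreover have "(LINT x:S|lborel. \<Phi> n x * D x + V x \<bullet> (\<Sum>j<J. crossing_grad (e n) (c j) (c (Suc j)) x))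
      = (LINT x:S|lborel. \<Phi> n x * D x - (\<Sum>j<J. edge_kern (e n) (c j) (c (Suc j)) x * h j x))"
    proof (rule set_lebesgue_integral_cong)
      show "S \<in> sets lborel" using S(1) by simp
      show "\<forall>x. x \<in> S \<longrightarrow> \<Phi> n x * D x + V x \<bullet> (\<Sum>j<J. crossing_grad (e n) (c j) (c (Suc j)) x)
        = \<Phi> n x * D x - (\<Sum>j<J. edge_kern (e n) (c j) (c (Suc j)) x * h j x)"
      proof (intro allI impI)
        fix x assume "x \<in> S"
        \<comment> \<open>Positivity of the first coordinate removes the end-point terms of the
          gradient.\<close>
        then have "fst x > 0" using S(2) R(3) by blast
        from crossing_grad_sum[where c = c, OF e(1) c(1,2) this]
        show "\<Phi> n x * D x + V x \<bullet> (\<Sum>j<J. crossing_grad (e n) (c j) (c (Suc j)) x)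
          = \<Phi> n x * D x - (\<Sum>j<J. edge_kern (e n) (c j) (c (Suc j)) x * h j x)"
          by (simp add: h_def inner_sum_right)
      qed
    qed
    moreover have "\<dots> = (LINT x:S|lborel. \<Phi> n x * D x) - (LINT x:S|lborel. \<Sum>j<J. edge_kern (e n) (c j) (c (Suc j)) x * h j x)"
      by (intro set_integral_diff(2) iPD set_integral_sum(1) iE)
    moreover have "(LINT x:S|lborel. \<Sum>j<J. edge_kern (e n) (c j) (c (Suc j)) x * h j x)
      = (\<Sum>j<J. LINT x:S|lborel. edge_kern (e n) (c j) (c (Suc j)) x * h j x)"
      by (intro set_integral_sum(2) iE)
    ultimately show ?thesis by linarith
  qed
  have "(\<lambda>n. \<Sum>j<J. LINT x:S|lborel. edge_kern (e n) (c j) (c (Suc j)) x * h j x) \<longlonglongrightarrow>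
      (\<Sum>j<J. LINT s:{0<..<1}|lborel. h j (c j + s *\<^sub>R (c (Suc j) - c j)))"
  proof (rule tendsto_sum)
    fix j assume "j \<in> {..<J}"
    then have j: "j < J" by simp
    show "(\<lambda>n. LINT x:S|lborel. edge_kern (e n) (c j) (c (Suc j)) x * h j x) \<longlonglongrightarrow>
      (LINT s:{0<..<1}|lborel. h j (c j + s *\<^sub>R (c (Suc j) - c j)))"
      by (rule mollified_edge_tendsto[OF e R(1,2) S chR _ H(1) c(3)[OF j]]) (use H(2) RR in blast)
  qed
  then have "(\<lambda>n. LINT x:S|lborel. \<Phi> n x * D x) \<longlonglongrightarrow>
      (\<Sum>j<J. LINT s:{0<..<1}|lborel. h j (c j + s *\<^sub>R (c (Suc j) - c j)))"
    unfolding key .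
  from LIMSEQ_unique[OF this lim0] show ?thesis unfolding h_def .
qed

subsection \<open>Polygonal curves and the enclosed volume\<close>

text \<open>The inner products of the scheme are \<open>lebesgue\<close> integrals over a whole
  domain or interval, with integrands controlled only off a null set. This turns them into
  \<open>lborel\<close> integrals over a subset of full measure; measurability on \<open>T\<close>
  follows from agreement almost everywhere.\<close>

lemma lebesgue_set_integral_spike:
  fixes f :: "'a::euclidean_space \<Rightarrow> real"
  assumes i: "set_integrable lborel S f" and ST: "S \<subseteq> T" "negligible (T - S)"
  shows "(LINT x:T|lebesgue. f x) = (LINT x:S|lborel. f x)"
proof -
  have m: "(\<lambda>x. indicator S x *\<^sub>R f x) \<in> borel_measurable lborel"
    using i unfolding set_integrable_def by simp
  then have m': "(\<lambda>x. indicator S x *\<^sub>R f x) \<in> borel_measurable lebesgue"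
    by (rule measurable_completion)
  have "T - S \<in> null_sets lebesgue" using ST(2) by (simp add: negligible_iff_null_sets)
  then have ae: "AE x in lebesgue. indicator S x *\<^sub>R f x = indicator T x *\<^sub>R f x"
  proof -
    assume "T - S \<in> null_sets lebesgue"
    then have "AE x in lebesgue. x \<notin> T - S" by (rule AE_not_in)
    then show ?thesis by eventually_elim (use ST(1) in \<open>auto simp: indicator_def\<close>)
  qed
  have mT: "(\<lambda>x. indicator T x *\<^sub>R f x) \<in> borel_measurable lebesgue"
    by (rule borel_measurable_AE[OF m' ae])
  have "(LINT x:T|lebesgue. f x) = (\<integral>x. indicator S x *\<^sub>R f x \<partial>lebesgue)"
    unfolding set_lebesgue_integral_def
  proof (rule integral_cong_AE[OF mT m'])
    show "AE x in lebesgue. indicator T x *\<^sub>R f x = indicator S x *\<^sub>R f x"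
      using ae by eventually_elim (rule sym)
  qed
  also have "\<dots> = (LINT x:S|lborel. f x)"
    unfolding set_lebesgue_integral_def by (rule integral_completion[OF m])
  finally show ?thesis .
qed

text \<open>Unlike integrability, this property passes to products, so polynomial integrands in a
  curve and its derivative are handled by introduction rules. On bounded open sets it implies
  integrability.\<close>

definition bdd_cont :: "'a::euclidean_space set \<Rightarrow> ('a \<Rightarrow> real) \<Rightarrow> bool" where
  "bdd_cont S f \<longleftrightarrow> continuous_on S f \<and> (\<exists>C. \<forall>x\<in>S. \<bar>f x\<bar> \<le> C)"

lemma bdd_cont_const: "bdd_cont S (\<lambda>x. c)"
  unfolding bdd_cont_def by auto

lemma bdd_cont_add: "bdd_cont S f \<Longrightarrow> bdd_cont S g \<Longrightarrow> bdd_cont S (\<lambda>x. f x + g x)"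
  unfolding bdd_cont_def
proof safe
  fix a b assume "\<forall>x\<in>S. \<bar>f x\<bar> \<le> a" "\<forall>x\<in>S. \<bar>g x\<bar> \<le> b"
  then show "\<exists>C. \<forall>x\<in>S. \<bar>f x + g x\<bar> \<le> C"
    by (intro exI[of _ "a + b"] ballI) (smt (verit))
qed (intro continuous_intros)

lemma bdd_cont_mult: "bdd_cont S f \<Longrightarrow> bdd_cont S g \<Longrightarrow> bdd_cont S (\<lambda>x. f x * g x)"
  unfolding bdd_cont_def
proof safe
  fix a b assume "\<forall>x\<in>S. \<bar>f x\<bar> \<le> a" "\<forall>x\<in>S. \<bar>g x\<bar> \<le> b"
  then show "\<exists>C. \<forall>x\<in>S. \<bar>f x * g x\<bar> \<le> C"
    by (intro exI[of _ "a * b"] ballI) (auto simp: abs_mult intro!: mult_mono intro: order_trans[OF abs_ge_zero])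
qed (intro continuous_intros)

lemma bdd_cont_diff: "bdd_cont S f \<Longrightarrow> bdd_cont S g \<Longrightarrow> bdd_cont S (\<lambda>x. f x - g x)"
  using bdd_cont_add[of S f "\<lambda>x. (- 1) * g x"] bdd_cont_mult[OF bdd_cont_const[of S "- 1"], of g] by simp

lemma bdd_cont_power2: "bdd_cont S f \<Longrightarrow> bdd_cont S (\<lambda>x. (f x)\<^sup>2)"
  unfolding power2_eq_square by (rule bdd_cont_mult)

lemmas bdd_cont_intros = bdd_cont_const bdd_cont_add bdd_cont_diff bdd_cont_mult bdd_cont_power2

lemma bdd_cont_compact:
  assumes "compact K" "S \<subseteq> K" "continuous_on K f"
  shows "bdd_cont S f"
proof -
  obtain C where "\<forall>x\<in>K. \<bar>f x\<bar> \<le> C"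
    using compact_imp_bounded[OF compact_continuous_image[OF assms(3,1)]] unfolding bounded_iff by auto
  then show ?thesis unfolding bdd_cont_def using assms continuous_on_subset by blast
qed

lemma bdd_cont_compose:
  fixes K :: "'a::euclidean_space set" and S :: "'b::euclidean_space set"
  assumes "compact K" "continuous_on K f" "continuous_on S g" "g ` S \<subseteq> K"
  shows "bdd_cont S (\<lambda>t. f (g t))"
proof -
  have "bdd_cont K f" using assms(1,2) by (intro bdd_cont_compact[of K]) auto
  then obtain C where C: "\<forall>x\<in>K. \<bar>f x\<bar> \<le> C" unfolding bdd_cont_def by blast
  have "\<forall>t\<in>S. \<bar>f (g t)\<bar> \<le> C" using C assms(4) by (simp add: image_subset_iff)
  moreover have "continuous_on S (\<lambda>t. f (g t))"
    using continuous_on_compose2[OF assms(2,3,4)] .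
  ultimately show ?thesis unfolding bdd_cont_def by (intro conjI exI)
qed

lemma bdd_cont_integrable: "open S \<Longrightarrow> bounded S \<Longrightarrow> bdd_cont S f \<Longrightarrow> set_integrable lborel S f"
  unfolding bdd_cont_def using set_integrable_bounded_continuous[of S f] by (metis real_norm_def)

section \<open>The grid and piecewise affine curves\<close>

definition piece :: "nat \<Rightarrow> nat \<Rightarrow> real set" where
  "piece J j = {real j / real J <..< real (Suc j) / real J}"

lemma pieces_cover:
  assumes "J \<ge> 1"
  shows "{0<..<1} - grid_nodes J = (\<Union>j<J. piece J j)"
    "{0..1} = (\<Union>j<J. {real j / real J .. real (Suc j) / real J})"
    "disjoint_family_on (piece J) {..<J}"
proof -
  have J: "real J > 0" using assms by simp
  have mem: "t \<in> piece J j \<longleftrightarrow> real j < t * real J \<and> t * real J < real (Suc j)" for t j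
    unfolding piece_def using J by (simp add: pos_divide_less_eq pos_less_divide_eq)
  have memc: "t \<in> {real j / real J .. real (Suc j) / real J} \<longleftrightarrow> real j \<le> t * real J \<and> t * real J \<le> real (Suc j)" for t j
    using J by (simp add: pos_divide_le_eq pos_le_divide_eq)
  have node: "t \<in> grid_nodes J \<longleftrightarrow> (\<exists>j\<le>J. t * real J = real j)" for t
    unfolding grid_nodes_def using J by (auto simp: eq_divide_eq intro!: image_eqI)
  show "{0<..<1} - grid_nodes J = (\<Union>j<J. piece J j)"
  proof (intro set_eqI iffI)
    fix t assume t: "t \<in> {0<..<1} - grid_nodes J"
    define j where "j = nat \<lfloor>t * real J\<rfloor>"
    have tJ: "0 < t * real J" "t * real J < real J" using t J by auto
    have "real j = of_int \<lfloor>t * real J\<rfloor>" unfolding j_def using tJ by simp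
    then have 1: "real j \<le> t * real J" "t * real J < real (Suc j)" by simp_all linarith
    then have "j < J" using tJ by linarith
    moreover have "t \<notin> grid_nodes J" using t by blast
    then have "t * real J \<noteq> real j" using \<open>j < J\<close> unfolding node by auto
    ultimately show "t \<in> (\<Union>j<J. piece J j)" using 1 by (auto simp: mem intro!: bexI[of _ j])
  next
    fix t assume "t \<in> (\<Union>j<J. piece J j)"
    then obtain j where j: "j < J" "real j < t * real J" "t * real J < real (Suc j)" by (auto simp: mem)
    have "real (Suc j) \<le> real J" using j(1) by linarith
    then have "0 < t * real J" "t * real J < 1 * real J" using j by linarith+
    then have "t \<in> {0<..<1}" using J by (simp add: zero_less_mult_iff)
    moreover have "t \<notin> grid_nodes J"
    proof
      assume "t \<in> grid_nodes J"
      then obtain i where "t * real J = real i" unfolding node by blast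
      then show False using j by simp
    qed
    ultimately show "t \<in> {0<..<1} - grid_nodes J" by blast
  qed
  show "{0..1} = (\<Union>j<J. {real j / real J .. real (Suc j) / real J})"
  proof (intro set_eqI iffI)
    fix t :: real assume t: "t \<in> {0..1}"
    then have tJ: "0 \<le> t * real J" "t * real J \<le> real J" using J by (auto simp: mult_le_cancel_right1)
    show "t \<in> (\<Union>j<J. {real j / real J .. real (Suc j) / real J})"
    proof (cases "t * real J = real J")
      case True
      \<comment> \<open>At \<open>t = 1\<close> rounding down would give the index \<open>J\<close>,
        so the last piece is taken.\<close>
      then show ?thesis using assms by (auto simp only: UN_iff memc lessThan_iff intro!: bexI[of _ "J - 1"])
    next
      case False
      define j where "j = nat \<lfloor>t * real J\<rfloor>"
      have "real j = of_int \<lfloor>t * real J\<rfloor>" unfolding j_def using tJ by simp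
      then have 1: "real j \<le> t * real J" "t * real J < real (Suc j)" by simp_all linarith
      then have "j < J" using tJ False by linarith
      then show ?thesis using 1 unfolding UN_iff memc by (intro bexI[of _ j]) auto
    qed
  next
    fix t assume "t \<in> (\<Union>j<J. {real j / real J .. real (Suc j) / real J})"
    then obtain j where j: "j < J" "real j \<le> t * real J" "t * real J \<le> real (Suc j)" unfolding UN_iff memc by auto
    have "real (Suc j) \<le> real J" using j(1) by linarith
    then have "0 \<le> t * real J" "t * real J \<le> 1 * real J" using j by linarith+
    then show "t \<in> {0..1}" using J by (simp add: zero_le_mult_iff)
  qed
  show "disjoint_family_on (piece J) {..<J}"
    unfolding disjoint_family_on_def
  proof (intro ballI impI)
    fix i j :: nat assume ij: "i \<noteq> j"
    show "piece J i \<inter> piece J j = {}"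
    proof (rule ccontr)
      assume "piece J i \<inter> piece J j \<noteq> {}"
      then obtain t where "t \<in> piece J i" "t \<in> piece J j" by blast
      then have "real i < real (Suc j)" "real j < real (Suc i)" unfolding mem by linarith+
      then show False using ij by linarith
    qed
  qed
qed

definition vertex :: "nat \<Rightarrow> (real \<Rightarrow> point) \<Rightarrow> nat \<Rightarrow> point" where
  "vertex J X j = X (real j / real J)"

lemma Vh_affine:
  assumes f: "f \<in> Vh J" and j: "j < J" and t: "t \<in> {real j / real J .. real (Suc j) / real J}"
  shows "f t = f (real j / real J) + (real J * t - real j) * (f (real (Suc j) / real J) - f (real j / real J))"
proof -
  have J: "real J > 0" using j by simp
  \<comment> \<open>\<open>Vh\<close> numbers the subintervals from 1, whereas \<open>j\<close>
    starts at 0.\<close>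
  have "Suc j \<in> {1..J}" using j by simp
  then obtain a b where ab: "\<And>t. t \<in> {real j / real J .. real (Suc j) / real J} \<Longrightarrow> f t = a + b * t"
    using f unfolding Vh_def mem_Collect_eq by (metis diff_Suc_1)
  have e: "f (real j / real J) = a + b * (real j / real J)" "f (real (Suc j) / real J) = a + b * (real (Suc j) / real J)"
    by (rule ab, use J in \<open>simp add: divide_right_mono\<close>)+
  have d: "f (real (Suc j) / real J) - f (real j / real J) = b / real J"
    unfolding e by (simp add: add_divide_distrib algebra_simps)
  show ?thesis unfolding d unfolding e(1) ab[OF t] using J by (simp add: field_simps)
qed

lemma Vh_bd_affine:
  assumes X: "X \<in> Vh_bd J" and j: "j < J" and t: "t \<in> {real j / real J .. real (Suc j) / real J}"
  shows "X t = vertex J X j + (real J * t - real j) *\<^sub>R (vertex J X (Suc j) - vertex J X j)"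
proof -
  have "fst \<circ> X \<in> Vh J" "snd \<circ> X \<in> Vh J" using X by (auto simp: Vh_bd_def)
  from Vh_affine[OF this(1) j t] Vh_affine[OF this(2) j t]
  show ?thesis by (simp add: vertex_def prod_eq_iff)
qed

lemma Vh_bd_derivative:
  assumes X: "X \<in> Vh_bd J" and j: "j < J" and t: "t \<in> piece J j"
  shows "(X has_vector_derivative d_\<alpha> X t) (at t)"
    "d_\<alpha> X t = real J *\<^sub>R (vertex J X (Suc j) - vertex J X j)"
proof -
  define v where "v = vertex J X (Suc j) - vertex J X j"
  have "((\<lambda>t. vertex J X j + (real J * t - real j) *\<^sub>R v) has_vector_derivative real J *\<^sub>R v) (at t)"
    by (auto intro!: derivative_eq_intros)
  then have d: "(X has_vector_derivative real J *\<^sub>R v) (at t)"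
  proof (rule has_vector_derivative_transform_within_open)
    show "open (piece J j)" by (simp add: piece_def)
    show "t \<in> piece J j" by (rule t)
    show "\<And>s. s \<in> piece J j \<Longrightarrow> vertex J X j + (real J * s - real j) *\<^sub>R v = X s"
      unfolding v_def by (rule Vh_bd_affine[OF X j, symmetric]) (simp add: piece_def)
  qed
  then show "d_\<alpha> X t = real J *\<^sub>R (vertex J X (Suc j) - vertex J X j)"
    unfolding v_def by (rule vector_derivative_at)
  then show "(X has_vector_derivative d_\<alpha> X t) (at t)" using d unfolding v_def by simp
qed

lemma Vh_bd_regularity:
  assumes X: "X \<in> Vh_bd J" and J: "J \<ge> 1"
  defines "S \<equiv> {0<..<1} - grid_nodes J"
  shows "\<And>t. t \<in> S \<Longrightarrow> (X has_vector_derivative d_\<alpha> X t) (at t)"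
    "bdd_cont S (\<lambda>t. fst (d_\<alpha> X t))" "bdd_cont S (\<lambda>t. snd (d_\<alpha> X t))"
    "bdd_cont S (\<lambda>t. fst (X t))" "bdd_cont S (\<lambda>t. snd (X t))"
    "continuous_on {0..1} X" "fst (X 0) = 0" "fst (X 1) = 0"
proof -
  have S: "S = (\<Union>j<J. piece J j)" unfolding S_def by (rule pieces_cover(1)[OF J])
  show d: "(X has_vector_derivative d_\<alpha> X t) (at t)" if "t \<in> S" for t
    using that Vh_bd_derivative(1)[OF X] unfolding S by blast
  show c: "continuous_on {0..1} X" and "fst (X 0) = 0" "fst (X 1) = 0"
    using X by (auto simp: Vh_bd_def V_bd_def inner_prod_def)
  have S01: "S \<subseteq> {0..1}" unfolding S_def by auto
  show "bdd_cont S (\<lambda>t. fst (X t))" "bdd_cont S (\<lambda>t. snd (X t))"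
    by (rule bdd_cont_compact[OF compact_Icc S01], intro continuous_intros c)+
  have cd: "continuous_on S (d_\<alpha> X)"
    unfolding S
  proof (rule continuous_on_open_UN)
    fix j assume "j \<in> {..<J}"
    then have "j < J" by simp
    note d = Vh_bd_derivative(2)[OF X this]
    show "continuous_on (piece J j) (d_\<alpha> X)"
      by (rule continuous_on_eq[where f = "\<lambda>t. real J *\<^sub>R (vertex J X (Suc j) - vertex J X j)"])
        (rule continuous_on_const, rule d[symmetric])
  qed (simp add: piece_def)
  define C where "C = (\<Sum>j<J. norm (real J *\<^sub>R (vertex J X (Suc j) - vertex J X j)))"
  have b: "norm (d_\<alpha> X t) \<le> C" if tS: "t \<in> S" for t
  proof -
    obtain j where j: "j < J" "t \<in> piece J j" using tS unfolding S by blast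
    show ?thesis unfolding Vh_bd_derivative(2)[OF X j] C_def
      using j(1) by (intro member_le_sum[of j "{..<J}" "\<lambda>j. norm (real J *\<^sub>R (vertex J X (Suc j) - vertex J X j))"]) auto
  qed
  show "bdd_cont S (\<lambda>t. fst (d_\<alpha> X t))" unfolding bdd_cont_def
    using b order_trans[OF abs_fst_le_norm b] by (intro conjI continuous_intros cd exI[of _ C]) auto
  show "bdd_cont S (\<lambda>t. snd (d_\<alpha> X t))" unfolding bdd_cont_def
    using b order_trans[OF abs_snd_le_norm b] by (intro conjI continuous_intros cd exI[of _ C]) auto
qed

lemma grid_nodes_simps: "finite (grid_nodes J)" "open ({0<..<1} - grid_nodes J)"
  "bounded ({0<..<1} - grid_nodes J)" "negligible ({0<..<1} - ({0<..<1} - grid_nodes J))"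
proof -
  show f: "finite (grid_nodes J)" by (simp add: grid_nodes_def)
  then show "open ({0<..<1} - grid_nodes J)" by (intro open_Diff finite_imp_closed) auto
  show "bounded ({0<..<1} - grid_nodes J)" by (rule bounded_subset[of "{0<..<1}"]) auto
  show "negligible ({0<..<1} - ({0<..<1} - grid_nodes J))"
    by (rule negligible_subset[OF negligible_finite[OF f]]) auto
qed

text \<open>At the grid nodes the curve may have no derivative. Without them an open set of full
  measure remains on which the integrand is a bounded continuous function.\<close>

lemma ipI_eq:
  assumes "bdd_cont ({0<..<1} - grid_nodes J) h"
    and "\<And>t. t \<in> {0<..<1} - grid_nodes J \<Longrightarrow> f t \<bullet> g t = h t"
  shows "ipI f g = (LINT t:{0<..<1} - grid_nodes J|lborel. h t)"
proof -
  have i: "set_integrable lborel ({0<..<1} - grid_nodes J) h"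
    by (rule bdd_cont_integrable[OF grid_nodes_simps(2,3) assms(1)])
  have *: "set_integrable lborel ({0<..<1} - grid_nodes J) (\<lambda>t. f t \<bullet> g t)
      \<longleftrightarrow> set_integrable lborel ({0<..<1} - grid_nodes J) h"
    by (rule set_integrable_cong) (use assms(2) in auto)
  have "ipI f g = (LINT t:{0<..<1} - grid_nodes J|lborel. f t \<bullet> g t)"
    unfolding ipI_def using i * by (intro lebesgue_set_integral_spike grid_nodes_simps) auto
  also have "\<dots> = (LINT t:{0<..<1} - grid_nodes J|lborel. h t)"
    by (rule set_lebesgue_integral_cong) (use assms(2) grid_nodes_simps(2) in auto)
  finally show ?thesis .
qed

section \<open>The enclosed volume and its increment\<close>

lemma norm_scale_normal: "norm (d_\<alpha> X t) *\<^sub>R normal X t = - perp (d_\<alpha> X t)"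
  by (cases "d_\<alpha> X t = 0") (simp_all add: normal_def tangent_def perp_simps, simp add: perp_def zero_prod_def)

text \<open>The length factor cancels the normalisation of the normal, and clockwise rotation puts
  the second component of the derivative first; the sign is that of the normal.\<close>

lemma enclosed_volume_eq:
  assumes X: "X \<in> Vh_bd J" and J: "J \<ge> 1"
  shows "enclosed_volume X = - pi * (LINT t:{0<..<1} - grid_nodes J|lborel. (fst (X t))\<^sup>2 * snd (d_\<alpha> X t))"
proof -
  note r = Vh_bd_regularity[OF X J]
  have "ipI (\<lambda>t. (X t \<bullet> e1)\<^sup>2 *\<^sub>R normal X t) (\<lambda>t. norm (d_\<alpha> X t) *\<^sub>R e1)
    = (LINT t:{0<..<1} - grid_nodes J|lborel. (- 1) * ((fst (X t))\<^sup>2 * snd (d_\<alpha> X t)))"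
  proof (rule ipI_eq)
    show "bdd_cont ({0<..<1} - grid_nodes J) (\<lambda>t. (- 1) * ((fst (X t))\<^sup>2 * snd (d_\<alpha> X t)))"
      by (intro bdd_cont_intros r)
    fix t
    have "((X t \<bullet> e1)\<^sup>2 *\<^sub>R normal X t) \<bullet> (norm (d_\<alpha> X t) *\<^sub>R e1)
        = (X t \<bullet> e1)\<^sup>2 * ((norm (d_\<alpha> X t) *\<^sub>R normal X t) \<bullet> e1)"
      by (simp only: inner_scaleR_left inner_scaleR_right mult_ac)
    also have "\<dots> = (- 1) * ((fst (X t))\<^sup>2 * snd (d_\<alpha> X t))"
      unfolding norm_scale_normal by (simp add: perp_def inner_prod_def)
    finally show "((X t \<bullet> e1)\<^sup>2 *\<^sub>R normal X t) \<bullet> (norm (d_\<alpha> X t) *\<^sub>R e1)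
        = (- 1) * ((fst (X t))\<^sup>2 * snd (d_\<alpha> X t))" .
  qed
  then show ?thesis unfolding enclosed_volume_def by (simp only: set_integral_mult_right)
qed

lemma set_integral_derivative_grid:
  assumes "continuous_on {0..1} G" and "bdd_cont ({0<..<1} - grid_nodes J) g"
    and "\<And>t. t \<in> {0<..<1} - grid_nodes J \<Longrightarrow> (G has_real_derivative g t) (at t)"
  shows "(LINT t:{0<..<1} - grid_nodes J|lborel. g t) = G 1 - G 0"
proof -
  let ?S = "{0<..<1} - grid_nodes J"
  have "(g has_integral (G 1 - G 0)) {0..1}"
    using assms grid_nodes_simps(1)[of J]
    by (intro fundamental_theorem_of_calculus_interior_strong[of "grid_nodes J"])
      (auto simp: has_real_derivative_iff_has_vector_derivative[symmetric])
  note G = this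
  have "negligible ({0..1} - ?S)"
    by (rule negligible_subset[OF negligible_finite[of "insert 0 (insert 1 (grid_nodes J))"]])
      (auto simp: grid_nodes_simps(1))
  then have "negligible {t \<in> {0..1} - ?S. g t \<noteq> 0}" by (rule negligible_subset) blast
  moreover have "{t \<in> ?S - {0..1}. g t \<noteq> 0} = {}" by auto
  then have "negligible {t \<in> ?S - {0..1}. g t \<noteq> 0}" by (simp only: negligible_empty)
  ultimately have "(g has_integral (G 1 - G 0)) {0..1} \<longleftrightarrow> (g has_integral (G 1 - G 0)) ?S"
    by (intro has_integral_spike_set_eq)
  then have "integral ?S g = G 1 - G 0" using G by (metis integral_unique)
  then show ?thesis
    using set_borel_integral_eq_integral(2)[OF bdd_cont_integrable[OF grid_nodes_simps(2,3) assms(2)]] by simp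
qed

text \<open>Simpson's rule integrates the cubic dependence of the volume on the interpolation between
  the two curves exactly; the remainder is the derivative of a product that vanishes at both ends.\<close>

lemma enclosed_volume_diff:
  assumes X: "X \<in> Vh_bd J" and Y: "Y \<in> Vh_bd J" and J: "J \<ge> 1"
  shows "enclosed_volume Y - enclosed_volume X = 2 * pi * ipI (\<lambda>t. Y t - X t) (\<lambda>t. 1 *\<^sub>R f_half X Y t)"
proof -
  let ?S = "{0<..<1} - grid_nodes J"
  note rX = Vh_bd_regularity[OF X J] and rY = Vh_bd_regularity[OF Y J]
  define x where "x = (\<lambda>t. fst (X t))"
  define z where "z = (\<lambda>t. snd (X t))"
  define y where "y = (\<lambda>t. fst (Y t))"
  define w where "w = (\<lambda>t. snd (Y t))"
  define x' where "x' = (\<lambda>t. fst (d_\<alpha> X t))"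
  define z' where "z' = (\<lambda>t. snd (d_\<alpha> X t))"
  define y' where "y' = (\<lambda>t. fst (d_\<alpha> Y t))"
  define w' where "w' = (\<lambda>t. snd (d_\<alpha> Y t))"
  have bc: "bdd_cont ?S x" "bdd_cont ?S z" "bdd_cont ?S y" "bdd_cont ?S w"
    "bdd_cont ?S x'" "bdd_cont ?S z'" "bdd_cont ?S y'" "bdd_cont ?S w'"
    unfolding x_def z_def y_def w_def x'_def z'_def y'_def w'_def by (intro rX rY)+
  \<comment> \<open>The Simpson weights 1, 4, 1 combine to the coefficients
    \<open>2 * x t + y t\<close> and \<open>x t + 2 * y t\<close>, because the weighted midpoint
    term is the product of the sums \<open>x t + y t\<close> and \<open>x' t + y' t\<close>, and
    likewise with the second components.\<close>
  define k where "k = (\<lambda>t. (- 1 / 6) * ((y t - x t) * ((2 * x t + y t) * z' t + (x t + 2 * y t) * w' t)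
    - (w t - z t) * ((2 * x t + y t) * x' t + (x t + 2 * y t) * y' t)))"
  \<comment> \<open>The quadratic factor vanishes at 0 and 1, where both curves meet the axis, so
    its derivative \<open>g\<close> has integral 0.\<close>
  define G where "G = (\<lambda>t. (w t - z t) * ((x t)\<^sup>2 + x t * y t + (y t)\<^sup>2))"
  define g where "g = (\<lambda>t. (w' t - z' t) * ((x t)\<^sup>2 + x t * y t + (y t)\<^sup>2)
    + (w t - z t) * ((2 * x t + y t) * x' t + (x t + 2 * y t) * y' t))"
  have bk: "bdd_cont ?S k" and bg: "bdd_cont ?S g"
    unfolding k_def g_def by (intro bdd_cont_intros bc)+
  have g0: "(LINT t:?S|lborel. g t) = 0"
  proof -
    have "(LINT t:?S|lborel. g t) = G 1 - G 0"
    proof (rule set_integral_derivative_grid[OF _ bg])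
      show "continuous_on {0..1} G"
        unfolding G_def x_def y_def z_def w_def by (intro continuous_intros rX(6) rY(6))
      fix t assume t: "t \<in> ?S"
      have d: "(x has_real_derivative x' t) (at t)" "(z has_real_derivative z' t) (at t)"
        "(y has_real_derivative y' t) (at t)" "(w has_real_derivative w' t) (at t)"
        unfolding has_real_derivative_iff_has_vector_derivative x_def z_def y_def w_def x'_def z'_def y'_def w'_def
        using bounded_linear.has_vector_derivative[OF bounded_linear_fst rX(1)[OF t]]
          bounded_linear.has_vector_derivative[OF bounded_linear_snd rX(1)[OF t]]
          bounded_linear.has_vector_derivative[OF bounded_linear_fst rY(1)[OF t]]
          bounded_linear.has_vector_derivative[OF bounded_linear_snd rY(1)[OF t]]
        by simp_all
      show "(G has_real_derivative g t) (at t)"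
        unfolding G_def g_def by (rule derivative_eq_intros d refl)+ (simp add: algebra_simps)
    qed
    also have "\<dots> = 0" using rX(7,8) rY(7,8) by (simp add: G_def x_def y_def)
    finally show ?thesis .
  qed
  have ik: "ipI (\<lambda>t. Y t - X t) (\<lambda>t. 1 *\<^sub>R f_half X Y t) = (LINT t:?S|lborel. k t)"
  proof (rule ipI_eq[OF bk])
    fix t assume t: "t \<in> ?S"
    have "((\<lambda>s. (1/2) *\<^sub>R (X s + Y s)) has_vector_derivative (1/2) *\<^sub>R (d_\<alpha> X t + d_\<alpha> Y t)) (at t)"
      using has_vector_derivative_scaleR[OF DERIV_const[of "1/2"] has_vector_derivative_add[OF rX(1)[OF t] rY(1)[OF t]]]
      by simp
    then have dZ: "d_\<alpha> (\<lambda>s. (1/2) *\<^sub>R (X s + Y s)) t = (1/2) *\<^sub>R (d_\<alpha> X t + d_\<alpha> Y t)"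
      by (rule vector_derivative_at)
    have S: "(X t \<bullet> e1) *\<^sub>R d_\<alpha> X t + (4 * (((1/2) *\<^sub>R (X t + Y t)) \<bullet> e1)) *\<^sub>R ((1/2) *\<^sub>R (d_\<alpha> X t + d_\<alpha> Y t)) + (Y t \<bullet> e1) *\<^sub>R d_\<alpha> Y t
        = ((2 * x t + y t) * x' t + (x t + 2 * y t) * y' t, (2 * x t + y t) * z' t + (x t + 2 * y t) * w' t)"
      by (simp add: prod_eq_iff x_def y_def x'_def y'_def z'_def w'_def inner_prod_def field_simps)
    have YX: "Y t - X t = (y t - x t, w t - z t)" by (simp add: prod_eq_iff x_def y_def z_def w_def)
    have inn: "(a, b) \<bullet> (1 *\<^sub>R (- (1 / 6) *\<^sub>R perp (s1, s2))) = (- 1 / 6) * (a * s2 - b * s1)" for a b s1 s2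
      by (simp add: perp_def algebra_simps)
    show "(Y t - X t) \<bullet> (1 *\<^sub>R f_half X Y t) = k t"
      unfolding f_half_def Let_def dZ S YX k_def by (rule inn)
  qed
  have i: "set_integrable lborel ?S f" if "bdd_cont ?S f" for f
    by (rule bdd_cont_integrable[OF grid_nodes_simps(2,3) that])
  have b1: "bdd_cont ?S (\<lambda>t. (y t)\<^sup>2 * w' t)" "bdd_cont ?S (\<lambda>t. (x t)\<^sup>2 * z' t)"
    by (intro bdd_cont_intros bc)+
  \<comment> \<open>The terms with \<open>w t - z t\<close> cancel; what remains has coefficients
    \<open>3 * (y t)\<^sup>2\<close> and \<open>- 3 * (x t)\<^sup>2\<close>, whence the factor
    1/3.\<close>
  have "(y t)\<^sup>2 * w' t = (x t)\<^sup>2 * z' t + ((1/3) * g t - 2 * k t)" for t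
    unfolding g_def k_def by (simp add: field_simps power2_eq_square)
  then have "(LINT t:?S|lborel. (y t)\<^sup>2 * w' t) = (LINT t:?S|lborel. (x t)\<^sup>2 * z' t + ((1/3) * g t - 2 * k t))" by simp
  also have "\<dots> = (LINT t:?S|lborel. (x t)\<^sup>2 * z' t) + (LINT t:?S|lborel. (1/3) * g t - 2 * k t)"
    by (intro set_integral_add(2) i bdd_cont_intros bc bk bg)
  also have "(LINT t:?S|lborel. (1/3) * g t - 2 * k t) = (LINT t:?S|lborel. (1/3) * g t) - (LINT t:?S|lborel. 2 * k t)"
    by (intro set_integral_diff(2) i bdd_cont_intros bk bg)
  finally have "(LINT t:?S|lborel. (y t)\<^sup>2 * w' t) = (LINT t:?S|lborel. (x t)\<^sup>2 * z' t) - 2 * (LINT t:?S|lborel. k t)"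
    using g0 by (simp only: set_integral_mult_right)
  then have fin: "(LINT t:?S|lborel. (fst (Y t))\<^sup>2 * snd (d_\<alpha> Y t))
      = (LINT t:?S|lborel. (fst (X t))\<^sup>2 * snd (d_\<alpha> X t)) - 2 * (LINT t:?S|lborel. k t)"
    unfolding x_def y_def z'_def w'_def .
  show ?thesis
    unfolding enclosed_volume_eq[OF X J] enclosed_volume_eq[OF Y J] ik fin
    by (simp add: right_diff_distrib)
qed

lemma Vh_bd_image:
  assumes X: "X \<in> Vh_bd J" and J: "J \<ge> 1"
  shows "X ` {0..1} = (\<Union>j<J. closed_segment (vertex J X j) (vertex J X (Suc j)))"
proof -
  have J0: "real J > 0" using J by simp
  have "X ` {real j / real J .. real (Suc j) / real J} = closed_segment (vertex J X j) (vertex J X (Suc j))"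
    if j: "j < J" for j
  proof (intro set_eqI iffI)
    fix p assume "p \<in> X ` {real j / real J .. real (Suc j) / real J}"
    then obtain t where t: "t \<in> {real j / real J .. real (Suc j) / real J}" "p = X t" by blast
    have "0 \<le> real J * t - real j" "real J * t - real j \<le> 1"
      using t(1) J0 by (auto simp: pos_divide_le_eq pos_le_divide_eq mult.commute)
    then show "p \<in> closed_segment (vertex J X j) (vertex J X (Suc j))"
      unfolding t(2) Vh_bd_affine[OF X j t(1)] in_segment
      by (intro exI[of _ "real J * t - real j"]) (auto simp: algebra_simps)
  next
    fix p assume "p \<in> closed_segment (vertex J X j) (vertex J X (Suc j))"
    then obtain u where u: "0 \<le> u" "u \<le> 1" "p = vertex J X j + u *\<^sub>R (vertex J X (Suc j) - vertex J X j)"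
      by (rule closed_segment_param)
    define t where "t = (real j + u) / real J"
    have t: "t \<in> {real j / real J .. real (Suc j) / real J}"
      unfolding t_def using u J0 by (auto intro!: divide_right_mono)
    have "real J * t - real j = u" using J0 by (simp add: t_def)
    then have "p = X t" unfolding Vh_bd_affine[OF X j t] u(3) by simp
    then show "p \<in> X ` {real j / real J .. real (Suc j) / real J}" using t by blast
  qed
  then show ?thesis unfolding pieces_cover(2)[OF J] image_UN by auto
qed

lemma Vh_bd_edge_interior:
  assumes X: "X \<in> Vh_bd J" and j: "j < J" and s: "0 < s" "s < 1"
  shows "vertex J X j + s *\<^sub>R (vertex J X (Suc j) - vertex J X j) = X ((real j + s) / real J)"
    "(real j + s) / real J \<in> {0<..<1}" "(real j + s) / real J \<in> piece J j"
proof -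
  have J0: "real J > 0" using j by simp
  have t: "(real j + s) / real J \<in> {real j / real J .. real (Suc j) / real J}"
    using s J0 by (auto intro!: divide_right_mono)
  show "vertex J X j + s *\<^sub>R (vertex J X (Suc j) - vertex J X j) = X ((real j + s) / real J)"
    unfolding Vh_bd_affine[OF X j t] using J0 by simp
  have "real j + s < real J" using j s by linarith
  then show "(real j + s) / real J \<in> {0<..<1}" using s J0 by (auto simp: pos_divide_less_eq intro!: divide_pos_pos)
  show "(real j + s) / real J \<in> piece J j"
    unfolding piece_def using s J0 by (auto intro!: divide_strict_right_mono)
qed

text \<open>On each piece the substitution contributes \<open>1 / real J\<close> and the derivative
  of the curve \<open>real J\<close>. These cancel and leave the parametrisation of the edges by the
  unit interval that the crossing count uses.\<close>

lemma curve_integral_eq_sum: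
  fixes V :: "point \<Rightarrow> point"
  assumes X: "X \<in> Vh_bd J" and J: "J \<ge> 1"
    and i: "set_integrable lborel ({0<..<1} - grid_nodes J) (\<lambda>t. V (X t) \<bullet> perp (d_\<alpha> X t))"
  shows "(LINT t:{0<..<1} - grid_nodes J|lborel. V (X t) \<bullet> perp (d_\<alpha> X t))
    = (\<Sum>j<J. LINT s:{0<..<1}|lborel. V (vertex J X j + s *\<^sub>R (vertex J X (Suc j) - vertex J X j))
        \<bullet> perp (vertex J X (Suc j) - vertex J X j))"
proof -
  define h where "h = (\<lambda>t. V (X t) \<bullet> perp (d_\<alpha> X t))"
  have J0: "real J > 0" using J by simp
  have ij: "set_integrable lborel (piece J j) h" if "j < J" for j
  proof (rule set_integrable_subset[OF i[folded h_def]])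
    show "piece J j \<in> sets lborel" by (simp add: piece_def)
    show "piece J j \<subseteq> {0<..<1} - grid_nodes J" unfolding pieces_cover(1)[OF J] using that by blast
  qed
  have "(LINT t:{0<..<1} - grid_nodes J|lborel. h t) = (\<integral>t. (\<Sum>j<J. indicator (piece J j) t *\<^sub>R h t) \<partial>lborel)"
    unfolding set_lebesgue_integral_def pieces_cover(1)[OF J]
    by (simp add: indicator_UN_disjoint[OF _ pieces_cover(3)[OF J]] sum_distrib_right)
  also have "\<dots> = (\<Sum>j<J. LINT t:piece J j|lborel. h t)"
    unfolding set_lebesgue_integral_def using ij
    by (intro Bochner_Integration.integral_sum) (simp add: set_integrable_def)
  also have "\<dots> = (\<Sum>j<J. LINT s:{0<..<1}|lborel. V (vertex J X j + s *\<^sub>R (vertex J X (Suc j) - vertex J X j))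
        \<bullet> perp (vertex J X (Suc j) - vertex J X j))"
  proof (rule sum.cong[OF refl])
    fix j assume "j \<in> {..<J}"
    then have j: "j < J" by simp
    define v where "v = vertex J X (Suc j) - vertex J X j"
    have "(LINT t:piece J j|lborel. h t)
        = \<bar>1 / real J\<bar> *\<^sub>R (\<integral>s. indicator (piece J j) (real j / real J + 1 / real J * s) *\<^sub>R h (real j / real J + 1 / real J * s) \<partial>lborel)"
      unfolding set_lebesgue_integral_def by (rule lborel_integral_real_affine) (use J0 in simp)
    also have "\<dots> = (\<integral>s. (1 / real J) * (indicator (piece J j) (real j / real J + 1 / real J * s) *\<^sub>R h (real j / real J + 1 / real J * s)) \<partial>lborel)"
      using J0 by simp
    also have "\<dots> = (\<integral>s. indicator {0<..<1} s *\<^sub>R (V (vertex J X j + s *\<^sub>R v) \<bullet> perp v) \<partial>lborel)"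
    proof (rule Bochner_Integration.integral_cong[OF refl])
      fix s :: real
      have t: "real j / real J + 1 / real J * s = (real j + s) / real J" by (simp add: add_divide_distrib)
      show "(1 / real J) * (indicator (piece J j) (real j / real J + 1 / real J * s) *\<^sub>R h (real j / real J + 1 / real J * s))
        = indicator {0<..<1} s *\<^sub>R (V (vertex J X j + s *\<^sub>R v) \<bullet> perp v)"
        unfolding t
      proof (cases "s \<in> {0<..<1}")
        case True
        note e = Vh_bd_edge_interior[OF X j, of s]
        have "h ((real j + s) / real J) = real J * (V (vertex J X j + s *\<^sub>R v) \<bullet> perp v)"
          unfolding h_def v_def using True e Vh_bd_derivative(2)[OF X j e(3)] by (simp add: perp_simps)
        then show "(1 / real J) * (indicator (piece J j) ((real j + s) / real J) *\<^sub>R h ((real j + s) / real J))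
          = indicator {0<..<1} s *\<^sub>R (V (vertex J X j + s *\<^sub>R v) \<bullet> perp v)"
          using True e(3) J0 by simp
      next
        case False
        then have "(real j + s) / real J \<notin> piece J j"
          unfolding piece_def using J0 by (auto simp: divide_less_cancel)
        then show "(1 / real J) * (indicator (piece J j) ((real j + s) / real J) *\<^sub>R h ((real j + s) / real J))
          = indicator {0<..<1} s *\<^sub>R (V (vertex J X j + s *\<^sub>R v) \<bullet> perp v)"
          using False by simp
      qed
    qed
    finally show "(LINT t:piece J j|lborel. h t) = (LINT s:{0<..<1}|lborel. V (vertex J X j + s *\<^sub>R (vertex J X (Suc j) - vertex J X j))
        \<bullet> perp (vertex J X (Suc j) - vertex J X j))"
      unfolding set_lebesgue_integral_def v_def .
  qed
  finally show ?thesis unfolding h_def .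
qed

subsection \<open>Conservation of volume\<close>

text \<open>With a and b the integrals of \<open>D\<close> over the two phases, the constant test
  function gives a + b = 0 and the phase function gives (1 - \<omega>) a - \<omega> b = 0. Hence a =
  \<omega> (a + b) = 0, and b = 0. These are the conditions under which \<open>flux_eq_0\<close>
  applies.\<close>

lemma velocity_flux_eq_0:
  assumes R: "polygonal_domain R" "R \<subseteq> {x. fst x > 0}"
    and bd: "frontier R = d1 \<union> d2 \<union> axis_boundary R"
    and mesh: "regular_partition R \<T>" and U: "U \<in> U_FE R d1 d2 \<T>"
    and X: "X \<in> Vh_bd J" and J: "J \<ge> 1"
    and div: "divides_domain R J X A B"
    and inc: "incompressibility_eq R U (phase_fun R A)"
  shows "ipI (\<lambda>t. (X t \<bullet> e1) *\<^sub>R U (X t)) (\<lambda>t. (1 * norm (d_\<alpha> X t)) *\<^sub>R normal X t) = 0"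
proof -
  define S where "S = mesh_interior R \<T>"
  define V where "V = (\<lambda>x. fst x *\<^sub>R U x)"
  define D where "D = div_rU U"
  define c where "c = vertex J X"
  define \<Gamma> where "\<Gamma> = (\<Union>j<J. closed_segment (c j) (c (Suc j)))"
  have oR: "open R" "bounded R" using R(1) by (auto simp: polygonal_domain_def)
  note S = mesh_interior_simps[OF mesh R(1), folded S_def]
  note W = weak_divergence[OF R(1) bd mesh U, folded S_def D_def]
  have bS: "bounded S" using oR(2) S(2) bounded_subset by blast
  obtain C where C: "\<And>x. x \<in> S \<Longrightarrow> \<bar>D x\<bar> \<le> C" using W(2) by blast
  have XG: "X ` {0..1} = \<Gamma>" unfolding \<Gamma>_def c_def by (rule Vh_bd_image[OF X J])
  have negG: "negligible \<Gamma>" "closed \<Gamma>" unfolding \<Gamma>_def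
    by (auto intro!: negligible_Union closed_UN simp: negligible_closed_segment)
  have comps: "components (R - \<Gamma>) = {A, B}" and AB: "A \<noteq> B" and XR: "X ` {0<..<1} \<subseteq> R"
    using div unfolding divides_domain_def XG by auto
  have oRG: "open (R - \<Gamma>)" using oR(1) negG(2) by (rule open_Diff)
  have inAB: "A \<in> components (R - \<Gamma>)" "B \<in> components (R - \<Gamma>)" using comps by auto
  have oAB: "open A" "open B" using open_components[OF oRG] inAB by auto
  have cAB: "connected A" "connected B" "A \<noteq> {}" "B \<noteq> {}"
    using inAB in_components_connected in_components_nonempty by blast+
  have disj: "A \<inter> B = {}" using components_nonoverlap[OF inAB] AB by simp
  have un: "A \<union> B = R - \<Gamma>" using Union_components[of "R - \<Gamma>"] unfolding comps by simp
  have total: "(LINT x:S|lborel. D x) = 0"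
    using W(4)[of "\<lambda>x. 1" "\<lambda>x. 0"] by simp
  have "(LINT x:S|lborel. D x) = (LINT x:S \<inter> A|lborel. D x) + (LINT x:S \<inter> B|lborel. D x)"
  proof (rule set_integral_split[OF S(1) bS W(1) C oAB disj _ negG])
    show "S - \<Gamma> \<subseteq> A \<union> B" unfolding un using S(2) by (rule Diff_mono) simp
  qed
  then have sumAB: "(LINT x:S \<inter> A|lborel. D x) + (LINT x:S \<inter> B|lborel. D x) = 0" using total by simp
  define \<omega> where "\<omega> = vol_ratio R A"
  \<comment> \<open>Off the curve the indicator of a phase is continuous, so integrability again
    follows from continuity.\<close>
  define S' where "S' = S - \<Gamma>"
  define f where "f = (\<lambda>x. D x * (indicator A x - \<omega>))"
  have S': "open S'" "bounded S'" "S' \<subseteq> S" "S' \<subseteq> A \<union> B"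
    unfolding S'_def using S(1) negG(2) bS un S(2) by (auto intro: bounded_subset)
  have cf: "continuous_on S' f"
  proof -
    have "continuous_on A (indicator A :: point \<Rightarrow> real)"
      by (rule continuous_on_eq[of A "\<lambda>x. 1"]) (auto simp: indicator_def)
    moreover have "continuous_on B (indicator A :: point \<Rightarrow> real)"
      by (rule continuous_on_eq[of B "\<lambda>x. 0"]) (use disj in \<open>auto simp: indicator_def\<close>)
    ultimately have "continuous_on (A \<union> B) (indicator A :: point \<Rightarrow> real)"
      by (rule continuous_on_open_Un[OF oAB])
    then have "continuous_on S' (indicator A :: point \<Rightarrow> real)" using S'(4) continuous_on_subset by blast
    then show ?thesis unfolding f_def
      by (intro continuous_intros continuous_on_subset[OF W(1) S'(3)])
  qed
  have bf: "\<bar>f x\<bar> \<le> C * (1 + \<bar>\<omega>\<bar>)" if "x \<in> S'" for x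
  proof -
    have "\<bar>indicator A x - \<omega>\<bar> \<le> 1 + \<bar>\<omega>\<bar>" by (cases "x \<in> A") auto
    moreover have "\<bar>D x\<bar> \<le> C" using C that S'(3) by blast
    ultimately show ?thesis unfolding f_def abs_mult by (intro mult_mono) (auto intro: order_trans[OF abs_ge_zero])
  qed
  have negS': "negligible (R - S')"
    by (rule negligible_subset[OF negligible_Un[OF S(3) negG(1)]]) (auto simp: S'_def)
  have f0: "(LINT x:S'|lborel. f x) = 0"
  proof -
    have eq: "div_c V x \<bullet> phase_fun R A x = f x" if "x \<in> S'" for x
      using W(3)[of x] that S'(3) by (auto simp: f_def phase_fun_def \<omega>_def V_def)
    have i: "set_integrable lborel S' f"
      by (rule set_integrable_bounded_continuous[OF S'(1,2) cf]) (use bf in simp)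
    have "set_integrable lborel S' (\<lambda>x. div_c V x \<bullet> phase_fun R A x) \<longleftrightarrow> set_integrable lborel S' f"
      by (rule set_integrable_cong) (use eq in auto)
    then have "set_integrable lborel S' (\<lambda>x. div_c V x \<bullet> phase_fun R A x)" using i by simp
    then have "(LINT x:R|lebesgue. div_c V x \<bullet> phase_fun R A x) = (LINT x:S'|lborel. div_c V x \<bullet> phase_fun R A x)"
      using S'(3) S(2) negS' by (intro lebesgue_set_integral_spike) auto
    also have "\<dots> = (LINT x:S'|lborel. f x)"
      by (rule set_lebesgue_integral_cong) (use eq S'(1) in auto)
    finally show ?thesis using inc unfolding incompressibility_eq_def ip_def V_def by simp
  qed
  have "(LINT x:S'|lborel. f x) = (LINT x:S' \<inter> A|lborel. f x) + (LINT x:S' \<inter> B|lborel. f x)"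
  proof (rule set_integral_split[OF S'(1,2) cf bf oAB disj _ negG])
    show "S' - \<Gamma> \<subseteq> A \<union> B" by (rule order_trans[OF Diff_subset S'(4)])
  qed
  moreover have "S' \<inter> A = S \<inter> A" "S' \<inter> B = S \<inter> B" unfolding S'_def using un by auto
  moreover have "(LINT x:S \<inter> A|lborel. f x) = (LINT x:S \<inter> A|lborel. (1 - \<omega>) * D x)"
    by (rule set_lebesgue_integral_cong) (use S(1) oAB in \<open>auto simp: f_def\<close>)
  moreover have "(LINT x:S \<inter> B|lborel. f x) = (LINT x:S \<inter> B|lborel. (- \<omega>) * D x)"
    by (rule set_lebesgue_integral_cong) (use S(1) oAB disj in \<open>auto simp: f_def indicator_def\<close>)
  ultimately have "(1 - \<omega>) * (LINT x:S \<inter> A|lborel. D x) + (- \<omega>) * (LINT x:S \<inter> B|lborel. D x) = 0"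
    using f0 by (simp only: set_integral_mult_right)
  then have DA: "(LINT x:S \<inter> A|lborel. D x) = 0" using sumAB by algebra
  then have DB: "(LINT x:S \<inter> B|lborel. D x) = 0" using sumAB by simp
  have cU: "continuous_on (closure R) U" using U by (simp add: U_FE_def velocity_space_def)
  have cV: "continuous_on (closure R) V" unfolding V_def by (intro continuous_intros cU)
  note r = Vh_bd_regularity[OF X J]
  have J0: "real J \<noteq> 0" using J by simp
  have flux: "(\<Sum>j<J. LINT s:{0<..<1}|lborel. V (c j + s *\<^sub>R (c (Suc j) - c j)) \<bullet> perp (c (Suc j) - c j)) = 0"
  proof (rule flux_eq_0[OF oR R(2) S(1,2) _ cV W(1) C _ _ _ _ oAB(1) cAB(1,3) oAB(2) cAB(2,4) disj _ DA DB])
    have N: "negligible (frontier R \<union> (\<Union>K\<in>\<T>. frontier K))" "closed (frontier R \<union> (\<Union>K\<in>\<T>. frontier K))"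
    proof -
      have "segment_union (frontier R)" using R(1) by (simp add: polygonal_domain_def)
      note E = mesh_skeleton(1)[OF mesh this]
      show "negligible (frontier R \<union> (\<Union>K\<in>\<T>. frontier K))" by (rule segment_union_negligible[OF E])
      show "closed (frontier R \<union> (\<Union>K\<in>\<T>. frontier K))" by (rule segment_union_closed[OF E])
    qed
    show "AE x in lborel. x \<in> R \<longrightarrow> x \<in> S"
      using AE_lborel_negligible[OF N] by eventually_elim (auto simp: S_def mesh_interior_def)
    show "(LINT x:S|lborel. \<phi> x * D x + V x \<bullet> \<phi>' x) = 0"
      if "\<And>x. (\<phi> has_derivative (\<lambda>h. h \<bullet> \<phi>' x)) (at x)" "continuous_on UNIV \<phi>'" for \<phi> \<phi>'
      using W(4)[OF that] unfolding V_def .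
    show "fst (c 0) = 0" "fst (c J) = 0" using r(7,8) J0 by (auto simp: c_def vertex_def)
    show "c j + s *\<^sub>R (c (Suc j) - c j) \<in> R" if "j < J" "0 < s" "s < 1" for j s
      using Vh_bd_edge_interior(1,2)[OF X that] XR unfolding c_def by auto
    show "A \<union> B = R - (\<Union>j<J. closed_segment (c j) (c (Suc j)))" using un unfolding \<Gamma>_def .
  qed
  have bcV: "bdd_cont ({0<..<1} - grid_nodes J) (\<lambda>t. fst (V (X t)))"
    "bdd_cont ({0<..<1} - grid_nodes J) (\<lambda>t. snd (V (X t)))"
  proof -
    have im: "X ` ({0<..<1} - grid_nodes J) \<subseteq> closure R" using XR closure_subset[of R] by blast
    have cX: "continuous_on ({0<..<1} - grid_nodes J) X"
      by (rule continuous_on_subset[OF r(6)]) auto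
    have cR: "compact (closure R)" using oR(2) by simp
    show "bdd_cont ({0<..<1} - grid_nodes J) (\<lambda>t. fst (V (X t)))"
      by (rule bdd_cont_compose[OF cR continuous_on_fst[OF cV] cX im])
    show "bdd_cont ({0<..<1} - grid_nodes J) (\<lambda>t. snd (V (X t)))"
      by (rule bdd_cont_compose[OF cR continuous_on_snd[OF cV] cX im])
  qed
  have bc: "bdd_cont ({0<..<1} - grid_nodes J) (\<lambda>t. V (X t) \<bullet> perp (d_\<alpha> X t))"
    unfolding inner_prod_def perp_def fst_conv snd_conv inner_real_def
    using bdd_cont_add[OF bdd_cont_mult[OF bcV(1) r(3)] bdd_cont_mult[OF bdd_cont_const[of _ "- 1"] bdd_cont_mult[OF bcV(2) r(2)]]]
    by simp
  have "ipI (\<lambda>t. (X t \<bullet> e1) *\<^sub>R U (X t)) (\<lambda>t. (1 * norm (d_\<alpha> X t)) *\<^sub>R normal X t)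
    = (LINT t:{0<..<1} - grid_nodes J|lborel. (- 1) * (V (X t) \<bullet> perp (d_\<alpha> X t)))"
  proof (rule ipI_eq)
    show "bdd_cont ({0<..<1} - grid_nodes J) (\<lambda>t. (- 1) * (V (X t) \<bullet> perp (d_\<alpha> X t)))"
      by (intro bdd_cont_mult bdd_cont_const bc)
    fix t
    have "X t \<bullet> e1 = fst (X t)" by (simp add: inner_prod_def)
    then show "((X t \<bullet> e1) *\<^sub>R U (X t)) \<bullet> ((1 * norm (d_\<alpha> X t)) *\<^sub>R normal X t)
        = (- 1) * (V (X t) \<bullet> perp (d_\<alpha> X t))"
      unfolding mult_1 norm_scale_normal V_def by simp
  qed
  also have "\<dots> = (- 1) * (LINT t:{0<..<1} - grid_nodes J|lborel. V (X t) \<bullet> perp (d_\<alpha> X t))"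
    by (rule set_integral_mult_right)
  also have "(LINT t:{0<..<1} - grid_nodes J|lborel. V (X t) \<bullet> perp (d_\<alpha> X t)) = 0"
    using curve_integral_eq_sum[OF X J bdd_cont_integrable[OF grid_nodes_simps(2,3) bc]] flux
    unfolding c_def by simp
  finally show ?thesis by simp
qed

lemma one_in_Vh: "(\<lambda>t. 1) \<in> Vh J"
  unfolding Vh_def by (auto intro: exI[of _ 1] exI[of _ 0])

theorem theorem3:
  fixes R d1 d2 :: "point set"
    and \<rho>m \<rho>p \<mu>m \<mu>p \<gamma> T :: real
    and g :: "point \<Rightarrow> point"
    and M J :: nat
    and \<T> :: "nat \<Rightarrow> point set set"
    and Q :: "nat \<Rightarrow> point set \<Rightarrow> (point \<times> real) set"
    and Rm Rp :: "nat \<Rightarrow> point set"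
    and \<rho> \<mu> :: "nat \<Rightarrow> point \<Rightarrow> real"
    and PP :: "nat \<Rightarrow> (point \<Rightarrow> real) set"
    and X :: "nat \<Rightarrow> real \<Rightarrow> point"
    and U :: "nat \<Rightarrow> point \<Rightarrow> point"
    and P :: "nat \<Rightarrow> point \<Rightarrow> real"
    and \<kappa> :: "nat \<Rightarrow> real \<Rightarrow> real"
  assumes domain: "polygonal_domain R" "R \<subseteq> {x. fst x > 0}"
    and boundary: "segment_union d1" "segment_union d2" "frontier R = d1 \<union> d2 \<union> axis_boundary R"
    and constants: "\<rho>m > 0" "\<rho>p > 0" "\<mu>m > 0" "\<mu>p > 0" "\<gamma> > 0"
    and body_force: "(fst \<circ> g) \<in> L2r 1 R" "(snd \<circ> g) \<in> L2r 1 R"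
    and discretization: "T > 0" "M \<ge> 1" "J \<ge> 1"
    and meshes: "\<And>m. m < M \<Longrightarrow> regular_partition R (\<T> m)"
    and quadrature: "\<And>m. m < M \<Longrightarrow> interior_quadrature (\<T> m) (Q m)"
    and curves: "\<And>m. m \<le> M \<Longrightarrow> X m \<in> Vh_bd J"
      "\<And>m t. m \<le> M \<Longrightarrow> t \<in> {0<..<1} \<Longrightarrow> X m t \<bullet> e1 > 0"
      "\<And>m t. m \<le> M \<Longrightarrow> t \<in> {0<..<1} - grid_nodes J \<Longrightarrow> norm (d_\<alpha> (X m) t) > 0"
    and phases: "\<And>m. m < M \<Longrightarrow> divides_domain R J (X m) (Rm m) (Rp m)"
    and coefficients: "\<And>m. m < M \<Longrightarrow> \<rho> m = phase_coeff (\<T> m) (Rm m) (Rp m) \<rho>m \<rho>p"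
      "\<And>m. m < M \<Longrightarrow> \<mu> m = phase_coeff (\<T> m) (Rm m) (Rp m) \<mu>m \<mu>p"
    and pressure_spaces:
      "\<And>m. m < M \<Longrightarrow> PP m = P_FE R (\<T> m) \<or> PP m = P_FE_enriched R (\<T> m) (Rm m)"
    and initial: "U 0 \<in> U_FE R d1 d2 (\<T> 0)"
    \<comment> \<open>For \<open>m = 0\<close> the truncated \<open>m - 1\<close> is 0, which is the convention \<open>\<rho>\<^sup>-\<^sup>1 = \<rho>\<^sup>0\<close>.\<close>
    and solution: "\<And>m. m < M \<Longrightarrow>
      scheme_solution R d1 d2 (\<T> m) (Q m) (PP m) J \<gamma> (T / real M) g (\<rho> m) (\<rho> (m - 1)) (\<mu> m)
        (X m) (U m) (U (m + 1)) (P (m + 1)) (X (m + 1)) (\<kappa> (m + 1))"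
    and enriched: "\<And>m. m < M \<Longrightarrow> phase_fun R (Rm m) \<in> PP m"
  shows "\<forall>m<M. enclosed_volume (X (m + 1)) = enclosed_volume (X m)"
proof (intro allI impI)
  fix m assume m: "m < M"
  let ?X = "X m" and ?Y = "X (m + 1)"
  have X: "?X \<in> Vh_bd J" "?Y \<in> Vh_bd J" using curves(1) m by auto
  note sol = solution[OF m, unfolded scheme_solution_def]
  have U: "U (m + 1) \<in> U_FE R d1 d2 (\<T> m)" using sol by blast
  \<comment> \<open>The scheme quantifies over four test functions at once. The phase function and
    the constant 1 carry the argument; \<open>U (m + 1)\<close> and \<open>X m\<close> merely
    inhabit the other two test spaces.\<close>
  have "incompressibility_eq R (U (m + 1)) (phase_fun R (Rm m))
      \<and> kinematic_eq (T / real M) ?X (U (m + 1)) ?Y (\<lambda>t. 1)"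
    using sol U enriched[OF m] one_in_Vh[of J] X(1) by blast
  then have inc: "incompressibility_eq R (U (m + 1)) (phase_fun R (Rm m))"
    and kin: "kinematic_eq (T / real M) ?X (U (m + 1)) ?Y (\<lambda>t. 1)" by auto
  have "ipI (\<lambda>t. (?X t \<bullet> e1) *\<^sub>R U (m + 1) (?X t)) (\<lambda>t. (1 * norm (d_\<alpha> ?X t)) *\<^sub>R normal ?X t) = 0"
    by (rule velocity_flux_eq_0[OF domain boundary(3) meshes[OF m] U X(1) discretization(3) phases[OF m] inc])
  \<comment> \<open>The time step is positive, so its inverse can be cancelled.\<close>
  then have "ipI (\<lambda>t. ?Y t - ?X t) (\<lambda>t. 1 *\<^sub>R f_half ?X ?Y t) = 0"
    using kin discretization(1,2) unfolding kinematic_eq_def by simp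
  then show "enclosed_volume ?Y = enclosed_volume ?X"
    using enclosed_volume_diff[OF X discretization(3)] by simp
qed

end
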